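(* Let $0 < r \leq q < p < 1$ and let $u,v,w$ be weights on $(0, \infty)$. Then there is a finite constant $C$ such that the inequality $$\bigg(\int_0^{\infty} \bigg(\int_0^t f(s)^r v(s)\, ds \bigg)^{\frac{q}{r}} u(t)\, dt \bigg)^{\frac{1}{q}} \leq C \bigg(\int_0^{\infty} \bigg(\int_t^{\infty} f(s)\, ds \bigg)^{p} w(t)\, dt\bigg)^{\frac{1}{p}}$$ holds for all $f\in\mathcal{M}^+$ if and only if $\max\{\mathcal{C}_5, \mathcal{C}_6\} < \infty$, where $$\mathcal{C}_5 = \bigg(\int_0^{\infty} \bigg(\int_0^x w\bigg)^{-\frac{p}{p-q}} w(x) \bigg( \int_0^{x} \bigg( \int_t^{\infty} u \bigg)^{\frac{q}{1-q}} u(t) V_r(0,t)^{\frac{q}{1-q}} dt \bigg)^{\frac{p(1-q)}{p-q}} dx \bigg)^{\frac{p-q}{pq}} + \bigg(\int_0^{\infty} w\bigg)^{-\frac{1}{p}} \bigg( \int_0^{\infty} \bigg( \int_t^{\infty} u \bigg)^{\frac{q}{1-q}} u(t) V_r(0, t)^{\frac{q}{1-q}} dt \bigg)^{\frac{1-q}{q}}$$ and $$\mathcal{C}_6 = \bigg(\int_0^{\infty} \bigg(\int_t^{\infty} u\bigg)^{\frac{q}{p-q}} u(t) \bigg(\int_0^t \bigg(\int_0^s w \bigg)^{-\frac{p}{p-r}} w(s) V_r(0, s)^{\frac{pr}{p-r}} ds \bigg)^{\frac{q(p-r)}{r(p-q)}} dt \bigg)^{\frac{p-q}{pq}}.$$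 Moreover, the best constant $C$ in the inequality satisfies $C \approx \mathcal{C}_5 + \mathcal{C}_6$.
   Context: $\mathcal{M}^+$ is the set of all non-negative measurable functions on $(0,\infty)$. A weight on $(0,\infty)$ is a measurable function that is positive and finite a.e. on $(0,\infty)$. For $a,b\in[0,\infty]$, $a<b$, and $0<r\le 1$, $$V_r(a, b) = \begin{cases} \big(\int_a^b v^{\frac{1}{1-r}}\big)^{\frac{1-r}{r}} & \text{if } 0<r<1,\\ \operatorname*{ess\,sup}_{s \in (a, b)} v(s) & \text{if } r=1.\end{cases}$$ Conventions: $1/(\pm\infty)=0$, $0/0=0$, $0\cdot(\pm\infty)=0$. The best constant is the smallest $C$ for which the inequality holds for all $f\in\mathcal{M}^+$. $A\approx B$ means that $A\le cB$ and $B\le cA$ with a constant $c\in(0,\infty)$ independent of appropriate quantities (here, of the weights $u,v,w$).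
   Formalization: The weight w is additionally required not to let its integral over (0,x) jump from a finite value at some T>0 to infinity for every x>T; for such w the stated characterization fails under the conventions 1/∞=0 and 0·∞=0. *)

theory Defs
  imports "HOL-Analysis.Analysis" "HOL-Probability.Essential_Supremum"
begin

text \<open>
  Real powers on \<open>[0,\<infinity>]\<close>. A negative power is the reciprocal of the positive one, with
  \<open>1/\<infinity> = 0\<close> and \<open>1/0 = \<infinity>\<close>; products use \<open>0 \<cdot> \<infinity> = 0\<close>, as is built into \<^typ>\<open>ennreal\<close>.
\<close>

definition epowr :: "ennreal \<Rightarrow> real \<Rightarrow> ennreal"  (infixr \<open>epowr\<close> 80)
  where "x epowr a =
    (if a = 0 then 1
     else if x = \<infinity> then (if a > 0 then \<infinity> else 0)
     else if x = 0 then (if a > 0 then 0 else \<infinity>)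
     else ennreal (enn2real x powr a))"

text \<open>
  Functions on \<open>(0,\<infinity>)\<close> are given by functions on the whole line; only their values on
  \<open>(0,\<infinity>)\<close> matter. Measurability is Lebesgue measurability.
\<close>

definition Mplus :: "(real \<Rightarrow> ennreal) set"
  where "Mplus = borel_measurable (lebesgue_on {0<..})"

definition weight :: "(real \<Rightarrow> ennreal) \<Rightarrow> bool"
  where "weight w \<longleftrightarrow> w \<in> borel_measurable (lebesgue_on {0<..}) \<and>
    (AE x in lebesgue_on {0<..}. 0 < w x \<and> w x < \<infinity>)"

text \<open>
  The primitive \<open>W(x) = \<integral>\<^sub>0\<^sup>x w\<close> does not jump from a finite value to \<open>\<infinity>\<close>; this holds in particular
  if \<open>W\<close> is finite everywhere, or infinite everywhere. Such a jump at \<open>T\<close> is invisible to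
  \<open>C5\<close> and \<open>C6\<close>, because \<open>W(x) = \<infinity>\<close> makes \<open>W(x)\<close> to a negative power vanish for \<open>x > T\<close>, and
  \<open>0 \<cdot> \<infinity> = 0\<close>. The characterization then fails: take \<open>w = 1\<close> on \<open>(0,1]\<close>,
  \<open>w(x) = 1/(x-1)\<close> for \<open>x > 1\<close>, \<open>u(t) = exp(-t)\<close>, and \<open>v(s) = s powr m * \<bar>1-s\<bar> powr (-(1+e)*(1-r))\<close>
  with \<open>m\<close> large and \<open>e > 0\<close> small. Both \<open>C5\<close> and \<open>C6\<close> are finite, but some integrable \<open>f\<close>
  supported in \<open>(0,1)\<close> has \<open>\<integral> f powr r * v = \<infinity>\<close>, so no finite constant is admissible.
\<close>

definition no_jump_to_infinity :: "(real \<Rightarrow> ennreal) \<Rightarrow> bool"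
  where "no_jump_to_infinity w \<longleftrightarrow> (\<forall>t>0.
    (\<integral>\<^sup>+s\<in>{0<..<t}. w s \<partial>lebesgue) < \<infinity> \<longrightarrow> (\<exists>x>t. (\<integral>\<^sup>+s\<in>{0<..<x}. w s \<partial>lebesgue) < \<infinity>))"

text \<open>Meaningful for \<open>0 \<le> a < b \<le> \<infinity>\<close> and \<open>0 < r \<le> 1\<close>.\<close>

definition V :: "(real \<Rightarrow> ennreal) \<Rightarrow> real \<Rightarrow> ereal \<Rightarrow> ereal \<Rightarrow> ennreal"
  where "V v r a b =
    (if r < 1
     then (\<integral>\<^sup>+s\<in>einterval a b. v s epowr (1 / (1 - r)) \<partial>lebesgue) epowr ((1 - r) / r)
     else esssup (lebesgue_on (einterval a b)) v)"

definition ineq_holds ::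
    "real \<Rightarrow> real \<Rightarrow> real \<Rightarrow> (real \<Rightarrow> ennreal) \<Rightarrow> (real \<Rightarrow> ennreal) \<Rightarrow> (real \<Rightarrow> ennreal) \<Rightarrow> ennreal \<Rightarrow> bool"
  where "ineq_holds p q r u v w C \<longleftrightarrow> (\<forall>f\<in>Mplus.
    (\<integral>\<^sup>+t\<in>{0<..}. (\<integral>\<^sup>+s\<in>{0<..<t}. f s epowr r * v s \<partial>lebesgue) epowr (q / r) * u t \<partial>lebesgue)
      epowr (1 / q)
    \<le> C * (\<integral>\<^sup>+t\<in>{0<..}. (\<integral>\<^sup>+s\<in>{t<..}. f s \<partial>lebesgue) epowr p * w t \<partial>lebesgue) epowr (1 / p))"

text \<open>The best constant is \<open>\<infinity>\<close> if the inequality holds with no finite constant.\<close>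

definition best_constant ::
    "real \<Rightarrow> real \<Rightarrow> real \<Rightarrow> (real \<Rightarrow> ennreal) \<Rightarrow> (real \<Rightarrow> ennreal) \<Rightarrow> (real \<Rightarrow> ennreal) \<Rightarrow> ennreal"
  where "best_constant p q r u v w = Inf {C. C < \<infinity> \<and> ineq_holds p q r u v w C}"

definition C5 ::
    "real \<Rightarrow> real \<Rightarrow> real \<Rightarrow> (real \<Rightarrow> ennreal) \<Rightarrow> (real \<Rightarrow> ennreal) \<Rightarrow> (real \<Rightarrow> ennreal) \<Rightarrow> ennreal"
  where "C5 p q r u v w =
    (\<integral>\<^sup>+x\<in>{0<..}.
        (\<integral>\<^sup>+s\<in>{0<..<x}. w s \<partial>lebesgue) epowr (- (p / (p - q))) * w x *
        (\<integral>\<^sup>+t\<in>{0<..<x}.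
            (\<integral>\<^sup>+s\<in>{t<..}. u s \<partial>lebesgue) epowr (q / (1 - q)) * u t *
            V v r 0 (ereal t) epowr (q / (1 - q)) \<partial>lebesgue)
          epowr (p * (1 - q) / (p - q)) \<partial>lebesgue)
      epowr ((p - q) / (p * q))
    + (\<integral>\<^sup>+s\<in>{0<..}. w s \<partial>lebesgue) epowr (- (1 / p)) *
      (\<integral>\<^sup>+t\<in>{0<..}.
          (\<integral>\<^sup>+s\<in>{t<..}. u s \<partial>lebesgue) epowr (q / (1 - q)) * u t *
          V v r 0 (ereal t) epowr (q / (1 - q)) \<partial>lebesgue)
        epowr ((1 - q) / q)"

definition C6 ::
    "real \<Rightarrow> real \<Rightarrow> real \<Rightarrow> (real \<Rightarrow> ennreal) \<Rightarrow> (real \<Rightarrow> ennreal) \<Rightarrow> (real \<Rightarrow> ennreal) \<Rightarrow> ennreal"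
  where "C6 p q r u v w =
    (\<integral>\<^sup>+t\<in>{0<..}.
        (\<integral>\<^sup>+s\<in>{t<..}. u s \<partial>lebesgue) epowr (q / (p - q)) * u t *
        (\<integral>\<^sup>+s\<in>{0<..<t}.
            (\<integral>\<^sup>+y\<in>{0<..<s}. w y \<partial>lebesgue) epowr (- (p / (p - r))) * w s *
            V v r 0 (ereal s) epowr (p * r / (p - r)) \<partial>lebesgue)
          epowr (q * (p - r) / (r * (p - q))) \<partial>lebesgue)
      epowr ((p - q) / (p * q))"

end

theory Submission
  imports Defs
begin

text \<open>
  Write \<open>W\<close> for the primitive of \<open>w\<close>, \<open>U\<close> for the tail of \<open>u\<close> and \<open>v = om\<^sup>1\<^sup>-\<^sup>r\<close>. The argument
  discretizes along the levels \<open>2\<^sup>k\<close> of \<open>W\<close>.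

  Sufficiency: the inner integral over \<open>s < t\<close> is split at \<open>W(s) = W(t)/2\<close>. On the near part the
  tail of \<open>f\<close> is controlled by its value one level below, so on each level block the inequality with
  \<open>\<integral> f\<close> on the right-hand side applies, and Hoelder's inequality over the blocks produces \<open>C5\<close>.
  The far part is averaged over the points \<open>y\<close> with \<open>W(s) < W(y) \<le> 2 W(s)\<close>; it is then governed by the same
  inequality with \<open>r/p\<close>, \<open>q/p\<close> in place of \<open>r\<close>, \<open>q\<close>, whose constant is exactly \<open>C6\<close>. That
  inequality with \<open>\<integral> f\<close> on the right follows from Hoelder's inequality with three factors and a weighted Hardy inequality.

  Necessity: for \<open>f = \<theta> X\<close> with \<open>\<theta>\<close> constant on level blocks and decreasing, subadditivity of the
  \<open>p\<close>-th power turns the right-hand side into a sum over the levels, and two choices of \<open>\<theta>\<close> and \<open>X\<close>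
  make it comparable with discrete versions of \<open>C5\<close> and \<open>C6\<close> while bounding the left-hand side from
  below by the same quantities. For truncated \<open>u\<close> and \<open>v\<close> these are finite, so a power of them can be cancelled;
  the general case is a monotone limit.
\<close>

subsection \<open>Real powers of extended nonnegative reals\<close>

text \<open>For \<open>p < 1\<close> the right-hand side is not a norm of the tail of
  \<open>f\<close>, so it can neither be dualized nor be compared with \<open>\<integral> f\<close>
  globally. On a single level of \<open>W\<close>, however, the weight has mass about
  \<open>2^k\<close> and in essence one value of the tail matters, so the comparison is possible
  there; recombining the levels by Hoelder's inequality with exponent \<open>p/q\<close> and its
  conjugate is what forces the power \<open>-q/(p-q)\<close> of \<open>W\<close> in
  \<open>C5\<close>.

  The second term of \<open>C5\<close> comes from the end of the half-line: the integral term sees a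
  level only through the \<open>w\<close>-mass of the next one, and if \<open>w\<close> is
  integrable, the last levels have no successor.

  The function \<open>om\<close> is introduced because \<open>f^r * om^(1-r)\<close> is adapted to
  Hoelder's inequality with exponents \<open>r\<close> and \<open>1-r\<close>, and because
  \<open>V\<close> is a power of the primitive of \<open>om\<close>.

  Primitives may be infinite and the functions are merely measurable, so the chain rule for powers
  of primitives is replaced by estimates of mass. This turns identities into pairs of inequalities
  whose constants depend on the exponents only.\<close>

lemma epowr_0 [simp]: "x epowr 0 = 1"
  by (simp add: epowr_def)

lemma zero_epowr: "a > 0 \<Longrightarrow> 0 epowr a = 0"
  by (simp add: epowr_def)

lemma top_epowr: "a > 0 \<Longrightarrow> top epowr a = top"
  by (simp add: epowr_def)

lemma top_epowr_neg: "a < 0 \<Longrightarrow> top epowr a = 0"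
  by (simp add: epowr_def)

lemma one_epowr [simp]: "1 epowr a = 1"
  by (simp add: epowr_def)

lemma ennreal_epowr: "0 < x \<Longrightarrow> ennreal x epowr a = ennreal (x powr a)"
  by (auto simp: epowr_def)

lemma ennreal_epowr': "0 \<le> x \<Longrightarrow> 0 < a \<Longrightarrow> ennreal x epowr a = ennreal (x powr a)"
  by (auto simp: epowr_def)

lemma ennreal_cases3 [case_names zero pos top]:
  obtains "(x::ennreal) = 0" | r where "0 < r" "x = ennreal r" | "x = top"
proof (cases x)
  case (real r)
  then show ?thesis using that by (cases "r = 0") auto
qed (use that in auto)

lemma epowr_1 [simp]: "x epowr 1 = x"
  by (cases x rule: ennreal_cases3) (auto simp: ennreal_epowr zero_epowr top_epowr)

lemma epowr_neg0: "a < 0 \<Longrightarrow> 0 epowr a = top"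
  by (simp add: epowr_def)

lemma epowr_epowr: "(x epowr a) epowr b = x epowr (a * b)"
proof (cases "a = 0 \<or> b = 0")
  case True then show ?thesis by auto
next
  case ab: False
  show ?thesis
  proof (cases x rule: ennreal_cases3)
    case zero
    then show ?thesis using ab
      by (cases "a > 0"; cases "b > 0")
        (auto simp: epowr_def zero_less_mult_iff mult_less_0_iff not_less)
  next
    case (pos r)
    then show ?thesis by (simp add: ennreal_epowr powr_powr)
  next
    case top
    then show ?thesis using ab
      by (cases "a > 0"; cases "b > 0")
        (auto simp: epowr_def zero_less_mult_iff mult_less_0_iff not_less)
  qed
qed

lemma epowr_mult: "a \<ge> 0 \<Longrightarrow> (x * y) epowr a = x epowr a * y epowr a"
proof (cases "a = 0")
  case False
  moreover assume "a \<ge> 0"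
  ultimately have a: "a > 0" by simp
  show ?thesis
    by (cases x rule: ennreal_cases3; cases y rule: ennreal_cases3)
      (use a in \<open>auto simp: ennreal_epowr ennreal_mult[symmetric] powr_mult zero_epowr top_epowr
          ennreal_top_mult ennreal_mult_top\<close>)
qed simp

lemma epowr_add: "a \<ge> 0 \<Longrightarrow> b \<ge> 0 \<Longrightarrow> x epowr (a + b) = x epowr a * x epowr b"
  by (cases "a = 0"; cases "b = 0"; cases x rule: ennreal_cases3)
    (auto simp: ennreal_epowr ennreal_mult[symmetric] powr_add zero_epowr top_epowr)

lemma epowr_add_fin: "0 < x \<Longrightarrow> x < top \<Longrightarrow> x epowr (a + b) = x epowr a * x epowr b"
  by (cases x rule: ennreal_cases3)
    (auto simp: ennreal_epowr ennreal_mult[symmetric] powr_add)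

lemma epowr_mono: "a \<ge> 0 \<Longrightarrow> x \<le> y \<Longrightarrow> x epowr a \<le> y epowr a"
  by (cases "a = 0"; cases x rule: ennreal_cases3; cases y rule: ennreal_cases3)
    (auto simp: ennreal_epowr zero_epowr top_epowr top_unique intro!: ennreal_leI powr_mono2)

lemma epowr_antimono: "a \<le> 0 \<Longrightarrow> x \<le> y \<Longrightarrow> y epowr a \<le> x epowr a"
  by (cases "a = 0"; cases x rule: ennreal_cases3; cases y rule: ennreal_cases3)
    (auto simp: ennreal_epowr epowr_neg0 top_epowr_neg top_unique intro!: ennreal_leI powr_mono2')

lemma epowr_pos: "0 < x \<Longrightarrow> (x = top \<Longrightarrow> a \<ge> 0) \<Longrightarrow> 0 < x epowr a"
  by (cases "a = 0"; cases x rule: ennreal_cases3)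
    (auto simp: ennreal_epowr top_epowr)

lemma epowr_less_top: "x < top \<Longrightarrow> (x = 0 \<Longrightarrow> a \<ge> 0) \<Longrightarrow> x epowr a < top"
  by (cases "a = 0"; cases x rule: ennreal_cases3)
    (auto simp: ennreal_epowr zero_epowr)

lemma epowr_eq_0_iff: "a > 0 \<Longrightarrow> x epowr a = 0 \<longleftrightarrow> x = 0"
  by (cases x rule: ennreal_cases3) (auto simp: ennreal_epowr top_epowr zero_epowr)

lemma epowr_le_iff: "a > 0 \<Longrightarrow> x epowr a \<le> y \<longleftrightarrow> x \<le> y epowr (1 / a)"
  using epowr_mono[of a x "y epowr (1/a)"] epowr_mono[of "1/a" "x epowr a" y]
  by (auto simp: epowr_epowr)

lemma measurable_epowr [measurable]: "(\<lambda>x. x epowr a) \<in> borel_measurable borel"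
  unfolding epowr_def by measurable

lemma measurable_epowr' [measurable (raw)]:
  "f \<in> borel_measurable M \<Longrightarrow> (\<lambda>x. f x epowr a) \<in> borel_measurable M"
  by (rule measurable_compose[OF _ measurable_epowr])

lemma SUP_epowr: "a > 0 \<Longrightarrow> I \<noteq> {} \<Longrightarrow> (SUP i\<in>I. f i) epowr a = (SUP i\<in>I. f i epowr a)"
proof (rule antisym)
  assume a: "a > 0" "I \<noteq> {}"
  show "(SUP i\<in>I. f i) epowr a \<le> (SUP i\<in>I. f i epowr a)"
    unfolding epowr_le_iff[OF a(1)]
    by (rule SUP_least, unfold epowr_le_iff[OF a(1), symmetric]) (rule SUP_upper)
  show "(SUP i\<in>I. f i epowr a) \<le> (SUP i\<in>I. f i) epowr a"
    using a by (intro SUP_least epowr_mono SUP_upper) auto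
qed

lemma epowr_add_le: "a \<ge> 0 \<Longrightarrow> (x + y) epowr a \<le> 2 epowr a * (x epowr a + y epowr a)"
proof -
  assume a: "a \<ge> 0"
  have "x + y \<le> 2 * max x y"
    by (metis add_mono max.cobounded1 max.cobounded2 mult_2)
  then have "(x + y) epowr a \<le> 2 epowr a * max x y epowr a"
    using epowr_mono[OF a, of "x + y" "2 * max x y"] by (simp add: epowr_mult a)
  also have "max x y epowr a \<le> x epowr a + y epowr a"
    by (auto simp: max_def)
  finally show ?thesis by (simp add: mult_left_mono)
qed

text \<open>Writing \<open>t^a = t * t^(a-1)\<close>, the claim follows since \<open>t^(a-1)\<close>
  decreases: both summands carry the factor at \<open>x + y\<close>, which is at most the factor at
  \<open>x\<close> and the one at \<open>y\<close>.\<close>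

lemma epowr_subadd:
  assumes a: "0 < a" "a \<le> 1" shows "(x + y) epowr a \<le> x epowr a + y epowr a"
proof (cases "x = 0 \<or> y = 0 \<or> x = top \<or> y = top")
  case True
  then show ?thesis using a by (auto simp: zero_epowr top_epowr)
next
  case False
  have *: "x epowr a = x * x epowr (a - 1)" if "x \<noteq> 0" "x \<noteq> top" for x
    using epowr_add_fin[of x 1 "a - 1"] that by (simp add: less_top zero_less_iff_neq_zero)
  have "(x + y) epowr a = (x + y) * (x + y) epowr (a - 1)"
    using False by (intro *) auto
  also have "\<dots> = x * (x + y) epowr (a - 1) + y * (x + y) epowr (a - 1)"
    by (rule distrib_right)
  also have "\<dots> \<le> x * x epowr (a - 1) + y * y epowr (a - 1)"
    using a by (intro add_mono mult_left_mono epowr_antimono) auto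
  also have "\<dots> = x epowr a + y epowr a" using False * by simp
  finally show ?thesis .
qed

lemma two_epowr: "2 epowr a = ennreal (2 powr a)"
  using ennreal_epowr[of 2 a] by simp

subsection \<open>Hoelder's inequality\<close>

lemma epowr_young:
  assumes "0 < a" "a < 1"
  shows "x epowr a * y epowr (1 - a) \<le> ennreal a * x + ennreal (1 - a) * y"
proof (cases x rule: ennreal_cases3)
  case zero then show ?thesis using assms by (simp add: zero_epowr)
next
  case top
  then show ?thesis using assms by (simp add: ennreal_mult_top)
next
  case x: (pos s)
  show ?thesis
  proof (cases y rule: ennreal_cases3)
    case zero then show ?thesis using assms by (simp add: zero_epowr)
  next
    case top
    then show ?thesis using assms by (simp add: ennreal_mult_top)
  next
    case (pos t)
    have "s powr a * t powr (1 - a) \<le> a * s + (1 - a) * t"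
      using Youngs_inequality_0[of a "1 - a" s t] assms x pos by simp
    then show ?thesis using x pos assms
      by (auto simp: ennreal_epowr ennreal_mult[symmetric] ennreal_plus[symmetric] simp del: ennreal_plus
          intro!: ennreal_leI)
  qed
qed

text \<open>Young's inequality after normalizing both integrals to 1. With
  \<open>0 * \<infinity> = 0\<close> the degenerate cases are genuine: if one integral is 0 and the
  other infinite, the right-hand side is 0, so the integrand has to vanish almost
  everywhere.\<close>

lemma nn_integral_Hoelder:
  assumes [measurable]: "f \<in> borel_measurable M" "g \<in> borel_measurable M"
    and a: "0 < a" "a < 1"
  shows "(\<integral>\<^sup>+x. f x epowr a * g x epowr (1 - a) \<partial>M)
      \<le> (\<integral>\<^sup>+x. f x \<partial>M) epowr a * (\<integral>\<^sup>+x. g x \<partial>M) epowr (1 - a)"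
proof -
  define F where "F = (\<integral>\<^sup>+x. f x \<partial>M)"
  define G where "G = (\<integral>\<^sup>+x. g x \<partial>M)"
  consider "F = 0 \<or> G = 0" | "F \<noteq> 0" "G \<noteq> 0" "F = top \<or> G = top"
    | "F \<noteq> 0" "G \<noteq> 0" "F \<noteq> top" "G \<noteq> top" by blast
  then show ?thesis
  proof cases
    case 1
    then have "AE x in M. f x epowr a * g x epowr (1 - a) = 0"
    proof
      assume "F = 0"
      then have "AE x in M. f x = 0" by (simp add: F_def nn_integral_0_iff_AE)
      then show ?thesis by eventually_elim (use a in \<open>simp add: zero_epowr\<close>)
    next
      assume "G = 0"
      then have "AE x in M. g x = 0" by (simp add: G_def nn_integral_0_iff_AE)
      then show ?thesis by eventually_elim (use a in \<open>simp add: zero_epowr\<close>)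
    qed
    then have "(\<integral>\<^sup>+x. f x epowr a * g x epowr (1 - a) \<partial>M) = 0"
      by (subst nn_integral_0_iff_AE) auto
    then show ?thesis by simp
  next
    case 2
    then have "F epowr a * G epowr (1 - a) = top"
      using a by (auto simp: top_epowr ennreal_mult_eq_top_iff epowr_eq_0_iff)
    then show ?thesis by (simp add: F_def G_def)
  next
    case 3
    then obtain F' G' where F': "F = ennreal F'" "F' > 0" and G': "G = ennreal G'" "G' > 0"
      by (metis ennreal_cases3)
    let ?f = "\<lambda>x. f x * ennreal (1 / F')" let ?g = "\<lambda>x. g x * ennreal (1 / G')"
    have eq: "f x epowr a * g x epowr (1 - a)
        = F epowr a * G epowr (1 - a) * (?f x epowr a * ?g x epowr (1 - a))" for x
    proof -
      have "F * ?f x = f x" "G * ?g x = g x"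
        using F' G' by (simp_all add: mult.left_commute[of "ennreal _"] ennreal_mult[symmetric])
      then have "f x epowr a * g x epowr (1 - a) = (F * ?f x) epowr a * (G * ?g x) epowr (1 - a)"
        by simp
      also have "\<dots> = F epowr a * G epowr (1 - a) * (?f x epowr a * ?g x epowr (1 - a))"
        using a epowr_mult[of a F "?f x"] epowr_mult[of "1 - a" G "?g x"] by (simp add: ac_simps)
      finally show ?thesis .
    qed
    have "(\<integral>\<^sup>+x. ?f x epowr a * ?g x epowr (1 - a) \<partial>M)
        \<le> (\<integral>\<^sup>+x. ennreal a * ?f x + ennreal (1 - a) * ?g x \<partial>M)"
      using a by (intro nn_integral_mono epowr_young)
    also have "\<dots> = ennreal a * (F * ennreal (1 / F')) + ennreal (1 - a) * (G * ennreal (1 / G'))"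
      by (simp add: nn_integral_add nn_integral_cmult nn_integral_multc F_def G_def)
    also have "\<dots> = 1"
      using F' G' a by (simp add: ennreal_mult[symmetric] ennreal_plus[symmetric] del: ennreal_plus)
    finally have *: "(\<integral>\<^sup>+x. ?f x epowr a * ?g x epowr (1 - a) \<partial>M) \<le> 1" .
    have "(\<integral>\<^sup>+x. f x epowr a * g x epowr (1 - a) \<partial>M)
        = F epowr a * G epowr (1 - a) * (\<integral>\<^sup>+x. ?f x epowr a * ?g x epowr (1 - a) \<partial>M)"
      by (subst eq) (simp add: nn_integral_cmult)
    also have "\<dots> \<le> F epowr a * G epowr (1 - a) * 1"
      by (intro mult_left_mono *) simp
    finally show ?thesis by (simp add: F_def G_def)
  qed
qed

lemma nn_integral_Hoelder3:
  assumes [measurable]: "f \<in> borel_measurable M" "g \<in> borel_measurable M" "h \<in> borel_measurable M"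
    and a: "0 < a" "0 \<le> b" "0 < c" "a + b + c = 1"
  shows "(\<integral>\<^sup>+x. f x epowr a * (g x epowr b * h x epowr c) \<partial>M)
      \<le> (\<integral>\<^sup>+x. f x \<partial>M) epowr a * ((\<integral>\<^sup>+x. g x \<partial>M) epowr b * (\<integral>\<^sup>+x. h x \<partial>M) epowr c)"
proof -
  define d where "d = b / (1 - a)"
  have d: "b = d * (1 - a)" "c = (1 - d) * (1 - a)" "0 \<le> d" "d < 1"
  proof -
    show b: "b = d * (1 - a)" using a by (simp add: d_def)
    show "c = (1 - d) * (1 - a)" using a b by (simp add: left_diff_distrib)
    show "0 \<le> d" "d < 1" using a by (auto simp: d_def)
  qed
  have "(\<integral>\<^sup>+x. f x epowr a * (g x epowr b * h x epowr c) \<partial>M)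
      = (\<integral>\<^sup>+x. f x epowr a * (g x epowr d * h x epowr (1 - d)) epowr (1 - a) \<partial>M)"
    using a by (simp add: epowr_mult epowr_epowr d(1,2))
  also have "\<dots> \<le> (\<integral>\<^sup>+x. f x \<partial>M) epowr a * (\<integral>\<^sup>+x. g x epowr d * h x epowr (1 - d) \<partial>M) epowr (1 - a)"
    using a by (intro nn_integral_Hoelder) auto
  also have "\<dots> \<le> (\<integral>\<^sup>+x. f x \<partial>M) epowr a *
      ((\<integral>\<^sup>+x. g x \<partial>M) epowr d * (\<integral>\<^sup>+x. h x \<partial>M) epowr (1 - d)) epowr (1 - a)"
  proof (cases "d = 0")
    case False
    then show ?thesis using a d by (intro mult_left_mono epowr_mono nn_integral_Hoelder) auto
  qed simp
  also have "\<dots> = (\<integral>\<^sup>+x. f x \<partial>M) epowr a *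
      ((\<integral>\<^sup>+x. g x \<partial>M) epowr b * (\<integral>\<^sup>+x. h x \<partial>M) epowr c)"
    using a d by (simp add: epowr_mult epowr_epowr)
  finally show ?thesis .
qed

subsection \<open>Dyadic sums over the integers\<close>

lemma measurable_of_bool [measurable (raw)]:
  "Measurable.pred M P \<Longrightarrow> (\<lambda>x. of_bool (P x) :: ennreal) \<in> borel_measurable M"
  unfolding of_bool_def by measurable

abbreviation zint :: "int measure" where "zint \<equiv> count_space UNIV"

definition dy :: "int \<Rightarrow> ennreal" where "dy k = ennreal (2 powr of_int k)"

lemma dy_pos [simp]: "0 < dy k" and dy_neq_0 [simp]: "dy k \<noteq> 0" and dy_fin [simp]: "dy k < top" "dy k \<noteq> top"
  by (auto simp: dy_def)

lemma dy_Suc: "dy (k + 1) = 2 * dy k"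
  using ennreal_mult[of 2 "2 powr of_int k"] by (simp add: dy_def powr_add mult.commute)

lemma dy_le_iff [simp]: "dy j \<le> dy k \<longleftrightarrow> j \<le> k"
  by (simp add: dy_def)

lemma dy_less_iff [simp]: "dy j < dy k \<longleftrightarrow> j < k"
  by (simp add: dy_def ennreal_less_iff)

lemma dy_epowr: "dy k epowr a = ennreal (2 powr (of_int k * a))"
  by (simp add: dy_def ennreal_epowr powr_powr)

lemma dy_ex:
  assumes "0 < x" "x < top"
  obtains k where "dy k < x" "x \<le> dy (k + 1)"
proof (cases x rule: ennreal_cases3)
  case (pos r)
  \<comment> \<open>The ceiling minus 1, since the intervals \<open>(dy k, dy (k + 1)]\<close> are
    open on the left and closed on the right.\<close>
  let ?k = "\<lceil>log 2 r\<rceil> - 1"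
  have "r \<le> 2 powr of_int (?k + 1)"
    using pos le_of_int_ceiling[of "log 2 r"] by (simp add: log_le_iff[symmetric])
  moreover have "of_int ?k < log 2 r" by linarith
  then have "2 powr of_int ?k < r" using pos by (simp add: less_log_iff)
  ultimately show ?thesis using pos that[of ?k] by (auto simp: dy_def ennreal_less_iff)
qed (use assms in auto)

lemma nn_integral_int_atMost:
  "(\<integral>\<^sup>+k. f k * of_bool (k \<le> K) \<partial>zint) = (\<Sum>n. f (K - int n))"
proof -
  have "(\<integral>\<^sup>+k. f k * of_bool (k \<le> K) \<partial>zint) = (\<integral>\<^sup>+k. f k \<partial>count_space {..K})"
    by (subst nn_integral_count_space_indicator)
      (auto intro!: nn_integral_cong simp: indicator_def)
  also have "\<dots> = (\<integral>\<^sup>+n. f (K - int n) \<partial>count_space UNIV)"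
    by (rule nn_integral_bij_count_space[symmetric], rule bij_betwI[where g = "\<lambda>k. nat (K - k)"]) auto
  finally show ?thesis by (simp add: nn_integral_count_space_nat)
qed

lemma nn_integral_int_atLeast:
  "(\<integral>\<^sup>+k. f k * of_bool (K \<le> k) \<partial>zint) = (\<Sum>n. f (K + int n))"
proof -
  have "(\<integral>\<^sup>+k. f k * of_bool (K \<le> k) \<partial>zint) = (\<integral>\<^sup>+k. f k \<partial>count_space {K..})"
    by (subst nn_integral_count_space_indicator)
      (auto intro!: nn_integral_cong simp: indicator_def)
  also have "\<dots> = (\<integral>\<^sup>+n. f (K + int n) \<partial>count_space UNIV)"
    by (rule nn_integral_bij_count_space[symmetric], rule bij_betwI[where g = "\<lambda>k. nat (k - K)"]) auto
  finally show ?thesis by (simp add: nn_integral_count_space_nat)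
qed

lemma suminf_geom: "a > 0 \<Longrightarrow> (\<Sum>n. ennreal (2 powr (- (real n * a)))) = ennreal (1 / (1 - 2 powr (- a)))"
proof -
  assume a: "a > 0"
  then have 1: "2 powr (- a) < 1" using powr_less_mono[of "- a" 0 2] by simp
  have "2 powr (- (real n * a)) = (2 powr (- a)) ^ n" for n
    by (simp add: powr_realpow[symmetric] powr_powr mult.commute)
  then show ?thesis
    using geometric_sums[of "2 powr (- a)"] 1 by (intro sums_unique[symmetric] sums_ennreal) auto
qed

text \<open>The sum of the geometric series with ratio \<open>2^(-a)\<close>, enlarged by a power of
  two that absorbs the rounding of a threshold to a dyadic number.\<close>

definition geo :: "real \<Rightarrow> real" where "geo a = 2 powr (2 * a) / (1 - 2 powr (- a))"

lemma geo_pos: "a > 0 \<Longrightarrow> geo a > 0"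
  using powr_less_mono[of "- a" 0 2] by (simp add: geo_def)

lemma dy_sum_le:
  assumes a: "a > 0"
  shows "(\<integral>\<^sup>+k. dy k epowr a * of_bool (dy k \<le> X) \<partial>zint) \<le> ennreal (geo a) * X epowr a"
proof (cases "X = 0 \<or> X = top")
  case True
  then show ?thesis
    using geo_pos[OF a] a by (auto simp: top_epowr ennreal_mult_top)
next
  case False
  then obtain K where K: "dy K < X" "X \<le> dy (K + 1)"
    using dy_ex[of X] by (auto simp: less_top zero_less_iff_neq_zero)
  have eq: "dy (K + 1 - int n) epowr a = dy (K + 1) epowr a * ennreal (2 powr (- (real n * a)))" for n
    by (simp add: dy_epowr ennreal_mult[symmetric] powr_add[symmetric] algebra_simps)
  have "(\<integral>\<^sup>+k. dy k epowr a * of_bool (dy k \<le> X) \<partial>zint)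
      \<le> (\<integral>\<^sup>+k. dy k epowr a * of_bool (k \<le> K + 1) \<partial>zint)"
    using K by (intro nn_integral_mono mult_left_mono) (auto simp: of_bool_def simp flip: dy_le_iff)
  also have "\<dots> = dy (K + 1) epowr a * ennreal (1 / (1 - 2 powr (- a)))"
    unfolding nn_integral_int_atMost eq ennreal_suminf_cmult suminf_geom[OF a] ..
  also have "\<dots> = ennreal (2 powr a * (1 / (1 - 2 powr (- a)))) * dy K epowr a"
    using powr_less_mono[of "- a" 0 2] a
    by (simp add: dy_epowr ennreal_mult[symmetric] powr_add[symmetric] algebra_simps)
  also have "\<dots> \<le> ennreal (geo a) * X epowr a"
    using K powr_less_mono[of "- a" 0 2] a unfolding geo_def
    by (intro mult_mono epowr_mono ennreal_leI) (auto simp: divide_right_mono)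
  finally show ?thesis .
qed

text \<open>A geometric series is comparable to its largest term. The cutoff compares
  \<open>X\<close> with \<open>dy (k + 1)\<close> because level \<open>k\<close> stands for
  \<open>(dy k, dy (k + 1)]\<close> and counts as soon as this interval reaches \<open>X\<close>.
  For \<open>X = top\<close> no level counts; for \<open>X = 0\<close> the right-hand side is
  infinite.\<close>

lemma dy_sum_ge:
  assumes a: "a > 0"
  shows "(\<integral>\<^sup>+k. dy k epowr (- a) * of_bool (X \<le> dy (k + 1)) \<partial>zint) \<le> ennreal (geo a) * X epowr (- a)"
proof (cases "X = 0 \<or> X = top")
  case True
  then show ?thesis
    using geo_pos[OF a] a by (auto simp: epowr_neg0 ennreal_mult_top top_unique)
next
  case False
  then obtain K where K: "dy K < X" "X \<le> dy (K + 1)"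
    using dy_ex[of X] by (auto simp: less_top zero_less_iff_neq_zero)
  have eq: "dy (K + int n) epowr (- a) = dy K epowr (- a) * ennreal (2 powr (- (real n * a)))" for n
    by (simp add: dy_epowr ennreal_mult[symmetric] powr_add[symmetric] algebra_simps)
  have "(\<integral>\<^sup>+k. dy k epowr (- a) * of_bool (X \<le> dy (k + 1)) \<partial>zint)
      \<le> (\<integral>\<^sup>+k. dy k epowr (- a) * of_bool (K \<le> k) \<partial>zint)"
  proof (intro nn_integral_mono mult_left_mono)
    fix k
    have "K \<le> k" if "X \<le> dy (k + 1)"
      using less_le_trans[OF K(1) that] by simp
    then show "of_bool (X \<le> dy (k + 1)) \<le> (of_bool (K \<le> k) :: ennreal)" by auto
  qed auto
  also have "\<dots> = dy K epowr (- a) * ennreal (1 / (1 - 2 powr (- a)))"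
    unfolding nn_integral_int_atLeast eq ennreal_suminf_cmult suminf_geom[OF a] ..
  also have "\<dots> = ennreal (2 powr a * (1 / (1 - 2 powr (- a)))) * dy (K + 1) epowr (- a)"
    using powr_less_mono[of "- a" 0 2] a
    by (simp add: dy_epowr ennreal_mult[symmetric] powr_add[symmetric] algebra_simps)
  also have "\<dots> \<le> ennreal (geo a) * X epowr (- a)"
    using K powr_less_mono[of "- a" 0 2] a unfolding geo_def
    by (intro mult_mono epowr_antimono ennreal_leI) (auto simp: divide_right_mono)
  finally show ?thesis .
qed

subsection \<open>Powers of distribution functions\<close>

text \<open>The next lemmas apply to primitives and tails on the half-line and to partial sums over the
  integers alike: what these share is that \<open>g\<close> has mass at most \<open>c\<close> on the set where its
  accumulated mass \<open>G\<close> is at most \<open>c\<close>.\<close>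

definition accumulates :: "'a measure \<Rightarrow> ('a \<Rightarrow> ennreal) \<Rightarrow> ('a \<Rightarrow> ennreal) \<Rightarrow> bool" where
  "accumulates M g G \<longleftrightarrow> g \<in> borel_measurable M \<and> G \<in> borel_measurable M \<and>
    (\<forall>c. (\<integral>\<^sup>+s. g s * of_bool (G s \<le> c) \<partial>M) \<le> c)"

lemma accumulates_AE_pos: "accumulates M g G \<Longrightarrow> AE s in M. g s \<noteq> 0 \<longrightarrow> G s > 0"
proof -
  assume *: "accumulates M g G"
  then have [measurable]: "g \<in> borel_measurable M" "G \<in> borel_measurable M" by (auto simp: accumulates_def)
  have "(\<integral>\<^sup>+s. g s * of_bool (G s \<le> 0) \<partial>M) \<le> 0" using * unfolding accumulates_def by blast
  then have "AE s in M. g s * of_bool (G s \<le> 0) = 0"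
    by (subst nn_integral_0_iff_AE[symmetric]) auto
  then show ?thesis by eventually_elim (auto simp: zero_less_iff_neq_zero)
qed

text \<open>Stands in for the chain rule \<open>d(G^(e+1)) = (e+1) G^e dG\<close>. The set
  \<open>G \<le> S/2\<close> carries at most half of the total mass \<open>S\<close>, so at least
  half of it sits where \<open>G > S/2\<close>.\<close>

lemma power_le_accumulated:
  assumes *: "accumulates M g G" and e: "e \<ge> 0"
  shows "(\<integral>\<^sup>+s. g s \<partial>M) epowr (e + 1) \<le> 2 epowr (e + 1) * (\<integral>\<^sup>+s. G s epowr e * g s \<partial>M)"
proof -
  define S where "S = (\<integral>\<^sup>+s. g s \<partial>M)"
  from * have [measurable]: "g \<in> borel_measurable M" "G \<in> borel_measurable M" by (auto simp: accumulates_def)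
  have split: "S \<le> c + (\<integral>\<^sup>+s. g s * of_bool (c < G s) \<partial>M)" for c
  proof -
    have "S = (\<integral>\<^sup>+s. g s * of_bool (G s \<le> c) + g s * of_bool (c < G s) \<partial>M)"
      unfolding S_def by (intro nn_integral_cong) (auto simp: not_le[symmetric] of_bool_def)
    also have "\<dots> = (\<integral>\<^sup>+s. g s * of_bool (G s \<le> c) \<partial>M) + (\<integral>\<^sup>+s. g s * of_bool (c < G s) \<partial>M)"
      by (rule nn_integral_add) auto
    also have "(\<integral>\<^sup>+s. g s * of_bool (G s \<le> c) \<partial>M) \<le> c" using * unfolding accumulates_def by blast
    finally show ?thesis by (simp add: add_right_mono)
  qed
  have low: "c epowr e * (\<integral>\<^sup>+s. g s * of_bool (c < G s) \<partial>M) \<le> (\<integral>\<^sup>+s. G s epowr e * g s \<partial>M)" for c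
  proof -
    have "c epowr e * (\<integral>\<^sup>+s. g s * of_bool (c < G s) \<partial>M)
        = (\<integral>\<^sup>+s. c epowr e * (g s * of_bool (c < G s)) \<partial>M)" by (simp add: nn_integral_cmult)
    also have "\<dots> \<le> (\<integral>\<^sup>+s. G s epowr e * g s \<partial>M)"
      using e by (intro nn_integral_mono) (auto simp: of_bool_def intro!: mult_right_mono epowr_mono)
    finally show ?thesis .
  qed
  have "S epowr (e + 1) \<le> 2 epowr (e + 1) * (\<integral>\<^sup>+s. G s epowr e * g s \<partial>M)"
  proof (cases "S = top")
    case True
    \<comment> \<open>Any finite threshold works: only a set of finite mass is removed.\<close>
    then have "(\<integral>\<^sup>+s. g s * of_bool (1 < G s) \<partial>M) = top"
      using split[of 1] by (auto simp: top_unique)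
    then have "(\<integral>\<^sup>+s. G s epowr e * g s \<partial>M) = top" using low[of 1] by (simp add: top_unique)
    then show ?thesis by (simp add: two_epowr ennreal_mult_top)
  next
    case False
    define T where "T = S * ennreal (1 / 2)"
    have "2 * ennreal (1 / 2) = 1" by (metis ennreal_1 ennreal_mult' ennreal_numeral
      mult.commute nonzero_eq_divide_eq zero_le_numeral zero_neq_numeral)
    then have ST: "S = 2 * T" by (simp add: T_def mult.left_commute)
    have T: "T \<noteq> top" using False ST by (auto simp: ennreal_mult_top)
    have "T + T \<le> T + (\<integral>\<^sup>+s. g s * of_bool (T < G s) \<partial>M)"
      using split[of T] ST by (simp add: mult_2)
    then have "T \<le> (\<integral>\<^sup>+s. g s * of_bool (T < G s) \<partial>M)"
      using T by (simp add: ennreal_add_left_cancel_le)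
    then have "T epowr e * T \<le> (\<integral>\<^sup>+s. G s epowr e * g s \<partial>M)"
      using low[of T] by (meson mult_left_mono order_trans zero_le)
    moreover have "S epowr (e + 1) = 2 epowr (e + 1) * (T epowr e * T)"
      using e epowr_add[of e 1 T] by (simp add: ST epowr_mult)
    ultimately show ?thesis by (simp add: mult_left_mono)
  qed
  then show ?thesis by (simp add: S_def)
qed

text \<open>The domain is cut into layers along the dyadic values of \<open>G\<close>; layer
  \<open>k\<close> has \<open>g\<close>-mass at most \<open>dy (k + 1) = 2 * dy k\<close>. Points
  with \<open>G = 0\<close> carry no mass, and \<open>\<psi> top = 0\<close> disposes of those with
  \<open>G = top\<close>.\<close>

lemma nn_integral_accumulated_le:
  assumes *: "accumulates M g G" and [measurable]: "\<psi> \<in> borel_measurable borel"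
    and a: "\<And>k x. dy k < x \<Longrightarrow> x \<le> dy (k + 1) \<Longrightarrow> \<psi> x \<le> a k" and top: "\<psi> top = 0"
  shows "(\<integral>\<^sup>+s. \<psi> (G s) * g s \<partial>M) \<le> 2 * (\<integral>\<^sup>+k. a k * dy k \<partial>zint)"
proof -
  from * have [measurable]: "g \<in> borel_measurable M" "G \<in> borel_measurable M" by (auto simp: accumulates_def)
  have "(\<integral>\<^sup>+s. \<psi> (G s) * g s \<partial>M) \<le> (\<integral>\<^sup>+s. (\<integral>\<^sup>+k. a k * (g s * of_bool (G s \<le> dy (k + 1))) \<partial>zint) \<partial>M)"
  proof (rule nn_integral_mono_AE)
    show "AE s in M. \<psi> (G s) * g s \<le> (\<integral>\<^sup>+k. a k * (g s * of_bool (G s \<le> dy (k + 1))) \<partial>zint)"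
      using accumulates_AE_pos[OF *]
    proof eventually_elim
      case (elim s)
      show ?case
      proof (cases "g s = 0 \<or> G s = top")
        case False
        then obtain k where k: "dy k < G s" "G s \<le> dy (k + 1)"
          using elim dy_ex[of "G s"] by (auto simp: less_top)
        have "\<psi> (G s) * g s \<le> a k * (g s * of_bool (G s \<le> dy (k + 1)))"
          using a[OF k] k by (simp add: mult_right_mono)
        also have "\<dots> \<le> (\<integral>\<^sup>+k. a k * (g s * of_bool (G s \<le> dy (k + 1))) \<partial>zint)"
          by (rule nn_integral_ge_point) simp
        finally show ?thesis .
      qed (auto simp: top)
    qed
  qed
  also have "\<dots> = (\<integral>\<^sup>+k. a k * (\<integral>\<^sup>+s. g s * of_bool (G s \<le> dy (k + 1)) \<partial>M) \<partial>zint)"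
    by (subst nn_integral_count_space_nn_integral) (auto simp: nn_integral_cmult)
  also have "\<dots> \<le> (\<integral>\<^sup>+k. a k * dy (k + 1) \<partial>zint)"
    using * unfolding accumulates_def by (intro nn_integral_mono mult_left_mono) auto
  also have "\<dots> = 2 * (\<integral>\<^sup>+k. a k * dy k \<partial>zint)"
    by (simp add: dy_Suc nn_integral_cmult[symmetric] ac_simps)
  finally show ?thesis .
qed

text \<open>The counterpart of \<open>\<integral> G^(a-1) dG = X^a / a\<close> over
  \<open>G \<le> X\<close>. Together with its twin for negative powers it replaces the explicit
  integration of powers of a primitive.\<close>

lemma nn_integral_accumulated_power_le:
  assumes *: "accumulates M g G" and a: "0 < a" "a < 1"
  shows "(\<integral>\<^sup>+s. G s epowr (a - 1) * of_bool (G s \<le> X) * g s \<partial>M) \<le> 2 * ennreal (geo a) * X epowr a"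
proof -
  have "(\<integral>\<^sup>+s. G s epowr (a - 1) * of_bool (G s \<le> X) * g s \<partial>M)
      \<le> 2 * (\<integral>\<^sup>+k. (dy k epowr (a - 1) * of_bool (dy k \<le> X)) * dy k \<partial>zint)"
  proof (rule nn_integral_accumulated_le[OF *, of "\<lambda>x. x epowr (a - 1) * of_bool (x \<le> X)"])
    fix k x assume "dy k < x" "x \<le> dy (k + 1)"
    then show "x epowr (a - 1) * of_bool (x \<le> X) \<le> dy k epowr (a - 1) * of_bool (dy k \<le> X)"
      using a by (intro mult_mono epowr_antimono) (auto simp: of_bool_def)
  qed (use a in \<open>auto simp: top_epowr_neg\<close>)
  also have "(\<lambda>k. (dy k epowr (a - 1) * of_bool (dy k \<le> X)) * dy k) = (\<lambda>k. dy k epowr a * of_bool (dy k \<le> X))"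
    using epowr_add_fin[of "dy _" "a - 1" 1] by (simp add: ac_simps)
  also have "2 * (\<integral>\<^sup>+k. dy k epowr a * of_bool (dy k \<le> X) \<partial>zint) \<le> 2 * (ennreal (geo a) * X epowr a)"
    by (intro mult_left_mono dy_sum_le a) auto
  finally show ?thesis by (simp add: ac_simps)
qed

lemma nn_integral_accumulated_neg_power_le:
  assumes *: "accumulates M g G" and e: "0 < e"
  shows "(\<integral>\<^sup>+s. G s epowr (- e - 1) * of_bool (X \<le> G s) * g s \<partial>M) \<le> 2 * ennreal (geo e) * X epowr (- e)"
proof -
  have "(\<integral>\<^sup>+s. G s epowr (- e - 1) * of_bool (X \<le> G s) * g s \<partial>M)
      \<le> 2 * (\<integral>\<^sup>+k. (dy k epowr (- e - 1) * of_bool (X \<le> dy (k + 1))) * dy k \<partial>zint)"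
  proof (rule nn_integral_accumulated_le[OF *, of "\<lambda>x. x epowr (- e - 1) * of_bool (X \<le> x)"])
    fix k x assume "dy k < x" "x \<le> dy (k + 1)"
    then show "x epowr (- e - 1) * of_bool (X \<le> x) \<le> dy k epowr (- e - 1) * of_bool (X \<le> dy (k + 1))"
      using e by (intro mult_mono epowr_antimono) (auto simp: of_bool_def)
  qed (use e in \<open>auto simp: top_epowr_neg\<close>)
  also have "(\<lambda>k. (dy k epowr (- e - 1) * of_bool (X \<le> dy (k + 1))) * dy k)
      = (\<lambda>k. dy k epowr (- e) * of_bool (X \<le> dy (k + 1)))"
    using epowr_add_fin[of "dy _" "- e - 1" 1] by (simp add: ac_simps)
  also have "2 * (\<integral>\<^sup>+k. dy k epowr (- e) * of_bool (X \<le> dy (k + 1)) \<partial>zint) \<le> 2 * (ennreal (geo e) * X epowr (- e))"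
    by (intro mult_left_mono dy_sum_ge e) auto
  finally show ?thesis by (simp add: ac_simps)
qed

subsection \<open>Primitives and tails on the half-line\<close>

abbreviation hl :: "real measure" where "hl \<equiv> lebesgue_on {0<..}"

definition prim :: "(real \<Rightarrow> ennreal) \<Rightarrow> real \<Rightarrow> ennreal"
  where "prim g t = (\<integral>\<^sup>+s. g s * of_bool (s < t) \<partial>hl)"

definition tail :: "(real \<Rightarrow> ennreal) \<Rightarrow> real \<Rightarrow> ennreal"
  where "tail g t = (\<integral>\<^sup>+s. g s * of_bool (t < s) \<partial>hl)"

lemma space_hl: "space hl = {0<..}"
  by (simp add: space_restrict_space)

lemma measurable_ident_hl [measurable]: "(\<lambda>x. x) \<in> borel_measurable hl"
  by (intro measurable_restrict_space1) (rule measurable_completion, simp)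

lemma sigma_finite_hl: "sigma_finite_measure hl"
proof -
  have "sigma_finite_measure (lebesgue :: real measure)"
  proof
    show "\<exists>A. countable A \<and> A \<subseteq> sets (lebesgue :: real measure) \<and> \<Union> A = space lebesgue \<and> (\<forall>a\<in>A. emeasure lebesgue a \<noteq> \<infinity>)"
    proof (intro exI[of _ "range (\<lambda>n::nat. {- real n..real n})"] conjI)
      show "\<Union> (range (\<lambda>n::nat. {- real n..real n})) = space lebesgue"
      proof safe
        fix x :: real assume "x \<in> space lebesgue"
        obtain n where "\<bar>x\<bar> \<le> real n" using real_arch_simple by blast
        then show "x \<in> \<Union> (range (\<lambda>n::nat. {- real n..real n}))" by (auto intro!: exI[of _ n])
      qed simp
    qed auto
  qed
  then show ?thesis by (intro sigma_finite_measure_restrict_space) auto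
qed

interpretation hl: sigma_finite_measure hl by (rule sigma_finite_hl)
interpretation hl2: pair_sigma_finite hl hl ..

lemma AE_hl_neq: "AE s in hl. s \<noteq> x"
proof -
  have "AE s in lebesgue. s \<noteq> x"
    using AE_completion[OF AE_lborel_singleton[of x]] by simp
  then have "AE s in lebesgue. s \<in> {0<..} \<longrightarrow> s \<noteq> x" by eventually_elim simp
  then show ?thesis by (simp add: AE_restrict_space_iff)
qed

lemma measurable_prim [measurable]: "g \<in> borel_measurable hl \<Longrightarrow> prim g \<in> borel_measurable hl"
proof -
  assume [measurable]: "g \<in> borel_measurable hl"
  show ?thesis unfolding prim_def[abs_def] by measurable
qed

lemma measurable_tail [measurable]: "g \<in> borel_measurable hl \<Longrightarrow> tail g \<in> borel_measurable hl"
proof -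
  assume [measurable]: "g \<in> borel_measurable hl"
  show ?thesis unfolding tail_def[abs_def] by measurable
qed

text \<open>\<open>prim\<close> and \<open>tail\<close> are adjoint to each other; this is the form
  that integration by parts takes below.\<close>

lemma nn_integral_prim_swap:
  assumes [measurable]: "g \<in> borel_measurable hl" "h \<in> borel_measurable hl"
  shows "(\<integral>\<^sup>+t. prim g t * h t \<partial>hl) = (\<integral>\<^sup>+s. g s * tail h s \<partial>hl)"
proof -
  have "(\<integral>\<^sup>+t. prim g t * h t \<partial>hl) = (\<integral>\<^sup>+t. (\<integral>\<^sup>+s. g s * of_bool (s < t) * h t \<partial>hl) \<partial>hl)"
    unfolding prim_def by (intro nn_integral_cong nn_integral_multc[symmetric]) measurable
  also have "\<dots> = (\<integral>\<^sup>+s. (\<integral>\<^sup>+t. g s * of_bool (s < t) * h t \<partial>hl) \<partial>hl)"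
    by (rule hl2.Fubini') measurable
  also have "\<dots> = (\<integral>\<^sup>+s. g s * tail h s \<partial>hl)"
    unfolding tail_def by (intro nn_integral_cong) (simp add: nn_integral_cmult[symmetric] ac_simps)
  finally show ?thesis .
qed

lemma prim_mono: "s \<le> t \<Longrightarrow> prim g s \<le> prim g t"
  unfolding prim_def by (intro nn_integral_mono mult_left_mono) (auto simp: of_bool_def)

lemma tail_mono: "s \<le> t \<Longrightarrow> tail g t \<le> tail g s"
  unfolding tail_def by (intro nn_integral_mono mult_left_mono) (auto simp: of_bool_def)

lemma prim_mono_fun: "(\<And>s. 0 < s \<Longrightarrow> s < t \<Longrightarrow> f s \<le> g s) \<Longrightarrow> prim f t \<le> prim g t"
  unfolding prim_def by (intro nn_integral_mono) (auto simp: of_bool_def space_hl)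

lemma tail_mono_fun: "(\<And>s. 0 < s \<Longrightarrow> t < s \<Longrightarrow> f s \<le> g s) \<Longrightarrow> tail f t \<le> tail g t"
  unfolding tail_def by (intro nn_integral_mono) (auto simp: of_bool_def space_hl)

lemma prim_le: "prim g t \<le> (\<integral>\<^sup>+s. g s \<partial>hl)"
  unfolding prim_def by (intro nn_integral_mono) (auto simp: of_bool_def)

lemma tail_le: "tail g t \<le> (\<integral>\<^sup>+s. g s \<partial>hl)"
  unfolding tail_def by (intro nn_integral_mono) (auto simp: of_bool_def)

lemma prim_cmult: "g \<in> borel_measurable hl \<Longrightarrow> prim (\<lambda>s. c * g s) t = c * prim g t"
  unfolding prim_def by (simp add: nn_integral_cmult[symmetric] mult.assoc)

lemma tail_cmult: "g \<in> borel_measurable hl \<Longrightarrow> tail (\<lambda>s. c * g s) t = c * tail g t"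
  unfolding tail_def by (simp add: nn_integral_cmult[symmetric] mult.assoc)

section \<open>Primitives, tails and partial sums as accumulated mass\<close>

lemma nn_integral_SUP_of_bool:
  assumes [measurable]: "g \<in> borel_measurable M" "\<And>n. Measurable.pred M (P n)"
    and inc: "\<And>n s. P n s \<Longrightarrow> P (Suc n) s"
  shows "(\<integral>\<^sup>+s. g s * of_bool (\<exists>n. P n s) \<partial>M) = (SUP n. \<integral>\<^sup>+s. g s * of_bool (P n s) \<partial>M)"
proof -
  have mono: "P m s \<Longrightarrow> m \<le> n \<Longrightarrow> P n s" for m n s
    using lift_Suc_mono_le[of "\<lambda>n. P n s" m n] inc by (auto simp: le_bool_def)
  have "(\<integral>\<^sup>+s. g s * of_bool (\<exists>n. P n s) \<partial>M) = (\<integral>\<^sup>+s. (SUP n. g s * of_bool (P n s)) \<partial>M)"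
  proof (intro nn_integral_cong antisym)
    fix s
    show "g s * of_bool (\<exists>n. P n s) \<le> (SUP n. g s * of_bool (P n s))"
      by (auto simp: of_bool_def intro: SUP_upper2)
    show "(SUP n. g s * of_bool (P n s)) \<le> g s * of_bool (\<exists>n. P n s)"
      by (intro SUP_least) (auto simp: of_bool_def)
  qed
  also have "\<dots> = (SUP n. \<integral>\<^sup>+s. g s * of_bool (P n s) \<partial>M)"
    by (intro nn_integral_monotone_convergence_SUP)
      (auto simp: incseq_def le_fun_def of_bool_def mono)
  finally show ?thesis .
qed

text \<open>The set \<open>prim g \<le> c\<close> is an initial interval. Its mass is approached by
  the mass of shorter initial intervals, which are values of \<open>prim g\<close> at points of the
  set and thus at most \<open>c\<close>. The end point is a null set, so it does not matter whether
  it belongs to the interval.\<close>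

lemma accumulates_prim:
  assumes [measurable]: "g \<in> borel_measurable hl"
  shows "accumulates hl g (prim g)"
  unfolding accumulates_def
proof (intro conjI allI)
  fix c
  define A where "A = {s. 0 < s \<and> prim g s \<le> c}"
  have down: "s \<in> A" if "t \<in> A" "0 < s" "s \<le> t" for s t
    using that prim_mono[of s t g] by (auto simp: A_def)
  show "(\<integral>\<^sup>+s. g s * of_bool (prim g s \<le> c) \<partial>hl) \<le> c"
  proof (cases "A = {}")
    case True
    then have "(\<integral>\<^sup>+s. g s * of_bool (prim g s \<le> c) \<partial>hl) = (\<integral>\<^sup>+s. 0 \<partial>hl)"
      by (intro nn_integral_cong) (auto simp: A_def space_hl)
    then show ?thesis by simp
  next
    case ne: False
    show ?thesis
    proof (cases "bdd_above A")
      case True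
      define x where "x = Sup A"
      define P where "P n s \<longleftrightarrow> s < x - 1 / real (Suc n)" for n s
      have P: "s < x \<longleftrightarrow> (\<exists>n. P n s)" for s
      proof
        assume "s < x"
        then obtain n where "inverse (real (Suc n)) < x - s" using reals_Archimedean[of "x - s"] by auto
        then show "\<exists>n. P n s" by (auto simp: P_def inverse_eq_divide algebra_simps intro!: exI[of _ n])
      next
        assume "\<exists>n. P n s"
        then show "s < x" by (auto simp: P_def intro: less_le_trans)
      qed
      have "AE s in hl. g s * of_bool (prim g s \<le> c) \<le> g s * of_bool (\<exists>n. P n s)"
        using AE_hl_neq[of x] AE_space
      proof eventually_elim
        case (elim s)
        have "s < x" if "prim g s \<le> c"
          using cSup_upper[OF _ True, of s] that elim by (simp add: A_def space_hl x_def)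
        then show ?case by (auto simp: of_bool_def P)
      qed
      then have "(\<integral>\<^sup>+s. g s * of_bool (prim g s \<le> c) \<partial>hl) \<le> (\<integral>\<^sup>+s. g s * of_bool (\<exists>n. P n s) \<partial>hl)"
        by (rule nn_integral_mono_AE)
      also have "\<dots> = (SUP n. \<integral>\<^sup>+s. g s * of_bool (P n s) \<partial>hl)"
      proof (rule nn_integral_SUP_of_bool)
        fix n s assume "P n s"
        moreover have "1 / real (Suc (Suc n)) \<le> 1 / real (Suc n)" by (simp add: frac_le)
        ultimately show "P (Suc n) s" unfolding P_def by linarith
      qed (simp_all add: P_def)
      also have "\<dots> \<le> c"
      proof (rule SUP_least)
        fix n
        have "x - 1 / real (Suc n) < x" by simp
        then obtain t where t: "t \<in> A" "x - 1 / real (Suc n) < t"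
          unfolding x_def using less_cSup_iff[OF ne True] by auto
        have "(\<integral>\<^sup>+s. g s * of_bool (P n s) \<partial>hl) = prim g (x - 1 / real (Suc n))"
          by (simp add: prim_def P_def)
        also have "\<dots> \<le> prim g t" using t by (intro prim_mono) simp
        also have "\<dots> \<le> c" using t by (simp add: A_def)
        finally show "(\<integral>\<^sup>+s. g s * of_bool (P n s) \<partial>hl) \<le> c" .
      qed
      finally show ?thesis .
    next
      case False
      have n: "prim g (real n) \<le> c" for n
      proof -
        obtain t where "t \<in> A" "real n \<le> t" using False by (meson bdd_aboveI linear)
        then show ?thesis using prim_mono[of "real n" t g] by (auto simp: A_def)
      qed
      have "(\<integral>\<^sup>+s. g s * of_bool (prim g s \<le> c) \<partial>hl) \<le> (\<integral>\<^sup>+s. g s * of_bool (\<exists>n. s < real n) \<partial>hl)"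
        by (intro nn_integral_mono) (auto simp: of_bool_def reals_Archimedean2)
      also have "\<dots> = (SUP n. \<integral>\<^sup>+s. g s * of_bool (s < real n) \<partial>hl)"
        by (rule nn_integral_SUP_of_bool) auto
      also have "\<dots> \<le> c" using n by (intro SUP_least) (simp add: prim_def)
      finally show ?thesis .
    qed
  qed
qed auto

text \<open>Mirror image of the primitive. The set is now a final interval and bounded below by 0,
  so no unbounded case arises.\<close>

lemma accumulates_tail:
  assumes [measurable]: "g \<in> borel_measurable hl"
  shows "accumulates hl g (tail g)"
  unfolding accumulates_def
proof (intro conjI allI)
  fix c
  define A where "A = {s. 0 < s \<and> tail g s \<le> c}"
  have up: "s \<in> A" if "t \<in> A" "t \<le> s" for s t
    using that tail_mono[of t s g] by (auto simp: A_def)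
  have bdd: "bdd_below A" by (auto simp: A_def bdd_below_def intro!: exI[of _ 0])
  show "(\<integral>\<^sup>+s. g s * of_bool (tail g s \<le> c) \<partial>hl) \<le> c"
  proof (cases "A = {}")
    case True
    then have "(\<integral>\<^sup>+s. g s * of_bool (tail g s \<le> c) \<partial>hl) = (\<integral>\<^sup>+s. 0 \<partial>hl)"
      by (intro nn_integral_cong) (auto simp: A_def space_hl)
    then show ?thesis by simp
  next
    case ne: False
    define x where "x = Inf A"
    define P where "P n s \<longleftrightarrow> x + 1 / real (Suc n) < s" for n s
    have P: "x < s \<longleftrightarrow> (\<exists>n. P n s)" for s
    proof
      assume "x < s"
      then obtain n where "inverse (real (Suc n)) < s - x" using reals_Archimedean[of "s - x"] by auto
      then show "\<exists>n. P n s" by (auto simp: P_def inverse_eq_divide algebra_simps intro!: exI[of _ n])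
    next
      assume "\<exists>n. P n s"
      then obtain n where "x + 1 / real (Suc n) < s" by (auto simp: P_def)
      moreover have "0 < 1 / real (Suc n)" by simp
      ultimately show "x < s" by linarith
    qed
    have "AE s in hl. g s * of_bool (tail g s \<le> c) \<le> g s * of_bool (\<exists>n. P n s)"
      using AE_hl_neq[of x] AE_space
    proof eventually_elim
      case (elim s)
      have "x < s" if "tail g s \<le> c"
        using cInf_lower[OF _ bdd, of s] that elim by (simp add: A_def space_hl x_def)
      then show ?case by (auto simp: of_bool_def P)
    qed
    then have "(\<integral>\<^sup>+s. g s * of_bool (tail g s \<le> c) \<partial>hl) \<le> (\<integral>\<^sup>+s. g s * of_bool (\<exists>n. P n s) \<partial>hl)"
      by (rule nn_integral_mono_AE)
    also have "\<dots> = (SUP n. \<integral>\<^sup>+s. g s * of_bool (P n s) \<partial>hl)"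
    proof (rule nn_integral_SUP_of_bool)
      fix n s assume "P n s"
      moreover have "1 / real (Suc (Suc n)) \<le> 1 / real (Suc n)" by (simp add: frac_le)
      ultimately show "P (Suc n) s" unfolding P_def by linarith
    qed (simp_all add: P_def)
    also have "\<dots> \<le> c"
    proof (rule SUP_least)
      fix n
      have "x < x + 1 / real (Suc n)" by simp
      then obtain t where t: "t \<in> A" "t < x + 1 / real (Suc n)"
        using cInf_less_iff[OF ne bdd, of "x + 1 / real (Suc n)"] unfolding x_def by blast
      have "(\<integral>\<^sup>+s. g s * of_bool (P n s) \<partial>hl) = tail g (x + 1 / real (Suc n))"
        by (simp add: tail_def P_def)
      also have "\<dots> \<le> tail g t" using t by (intro tail_mono) simp
      also have "\<dots> \<le> c" using t by (simp add: A_def)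
      finally show "(\<integral>\<^sup>+s. g s * of_bool (P n s) \<partial>hl) \<le> c" .
    qed
    finally show ?thesis .
  qed
qed auto

text \<open>A set of small partial sums, if nonempty and bounded above, has a largest index
  \<open>m\<close>; the partial sum at \<open>m\<close> includes its own term and therefore covers
  the whole set.\<close>

lemma accumulates_int: "accumulates zint g (\<lambda>j. \<integral>\<^sup>+i. g i * of_bool (i \<le> j) \<partial>zint)" (is "accumulates _ _ ?G")
  unfolding accumulates_def
proof (intro conjI allI)
  fix c
  define A where "A = {j. ?G j \<le> c}"
  have mono: "?G i \<le> ?G j" if "i \<le> j" for i j
    using that by (intro nn_integral_mono) (auto simp: of_bool_def)
  show "(\<integral>\<^sup>+j. g j * of_bool (?G j \<le> c) \<partial>zint) \<le> c"
  proof (cases "bdd_above A")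
    case False
    have n: "?G (int n) \<le> c" for n
    proof -
      obtain t where "t \<in> A" "int n \<le> t" using False by (meson bdd_aboveI linear)
      then show ?thesis using mono[of "int n" t] by (auto simp: A_def)
    qed
    have "(\<integral>\<^sup>+j. g j * of_bool (?G j \<le> c) \<partial>zint) \<le> (\<integral>\<^sup>+j. g j * of_bool (\<exists>n. j \<le> int n) \<partial>zint)"
    proof (intro nn_integral_mono mult_left_mono)
      fix j
      have "\<exists>n. j \<le> int n" by (rule exI[of _ "nat j"]) simp
      then show "of_bool (?G j \<le> c) \<le> (of_bool (\<exists>n. j \<le> int n) :: ennreal)" by (simp add: of_bool_def)
    qed simp
    also have "\<dots> = (SUP n. ?G (int n))"
      by (rule nn_integral_SUP_of_bool) auto
    also have "\<dots> \<le> c" using n by (intro SUP_least)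
    finally show ?thesis .
  next
    case True
    show ?thesis
    proof (cases "A = {}")
      case False
      then obtain a where a: "a \<in> A" by blast
      obtain B where B: "\<And>j. j \<in> A \<Longrightarrow> j \<le> B" using True by (auto simp: bdd_above_def)
      define m where "m = Max (A \<inter> {a..B})"
      have fin: "finite (A \<inter> {a..B})" by simp
      have "m \<in> A \<inter> {a..B}" unfolding m_def by (rule Max_in[OF fin]) (use a B in auto)
      then have m: "m \<in> A" by simp
      have le: "j \<le> m" if "j \<in> A" for j
      proof (cases "a \<le> j")
        case True
        then show ?thesis unfolding m_def using that B by (intro Max_ge[OF fin]) auto
      next
        case False
        then show ?thesis using \<open>m \<in> A \<inter> {a..B}\<close> by auto
      qed
      have "?G m \<le> c" using m by (simp add: A_def)
      moreover have "(\<integral>\<^sup>+j. g j * of_bool (?G j \<le> c) \<partial>zint) \<le> ?G m"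
      proof (intro nn_integral_mono mult_left_mono)
        fix j
        show "of_bool (?G j \<le> c) \<le> (of_bool (j \<le> m) :: ennreal)"
          using le[of j] by (cases "?G j \<le> c") (auto simp: A_def)
      qed simp
      ultimately show ?thesis by simp
    qed (auto simp: A_def)
  qed
qed auto

text \<open>The two inequalities replace \<open>(e+1) * \<integral> G^e dG = G^(e+1)\<close>. The
  first is monotonicity of the primitive; the second applies the half-mass argument to
  \<open>g\<close> cut off at \<open>t\<close>.\<close>

lemma prim_power_bounds:
  assumes [measurable]: "g \<in> borel_measurable hl" and e: "e \<ge> 0"
  shows "prim (\<lambda>s. prim g s epowr e * g s) t \<le> prim g t epowr (e + 1)"
    and "prim g t epowr (e + 1) \<le> 2 epowr (e + 1) * prim (\<lambda>s. prim g s epowr e * g s) t"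
proof -
  have "prim (\<lambda>s. prim g s epowr e * g s) t \<le> prim (\<lambda>s. prim g t epowr e * g s) t"
    using e by (intro prim_mono_fun mult_right_mono epowr_mono prim_mono) auto
  also have "\<dots> = prim g t epowr (e + 1)" using e by (simp add: prim_cmult epowr_add)
  finally show "prim (\<lambda>s. prim g s epowr e * g s) t \<le> prim g t epowr (e + 1)" .
  let ?h = "\<lambda>s. g s * of_bool (s < t)"
  have "prim g t epowr (e + 1) \<le> 2 epowr (e + 1) * (\<integral>\<^sup>+s. prim ?h s epowr e * ?h s \<partial>hl)"
    using power_le_accumulated[OF accumulates_prim e, of ?h] by (simp add: prim_def[of g])
  also have "(\<integral>\<^sup>+s. prim ?h s epowr e * ?h s \<partial>hl) \<le> prim (\<lambda>s. prim g s epowr e * g s) t"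
    unfolding prim_def[of "\<lambda>s. prim g s epowr e * g s"] mult.assoc using e
    by (intro nn_integral_mono mult_right_mono epowr_mono prim_mono_fun) (auto simp: of_bool_def)
  finally show "prim g t epowr (e + 1) \<le> 2 epowr (e + 1) * prim (\<lambda>s. prim g s epowr e * g s) t"
    by (simp add: mult_left_mono)
qed

lemma tail_power_bounds:
  assumes [measurable]: "g \<in> borel_measurable hl" and e: "e \<ge> 0"
  shows "tail (\<lambda>s. tail g s epowr e * g s) t \<le> tail g t epowr (e + 1)"
    and "tail g t epowr (e + 1) \<le> 2 epowr (e + 1) * tail (\<lambda>s. tail g s epowr e * g s) t"
proof -
  have "tail (\<lambda>s. tail g s epowr e * g s) t \<le> tail (\<lambda>s. tail g t epowr e * g s) t"
    using e by (intro tail_mono_fun mult_right_mono epowr_mono tail_mono) auto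
  also have "\<dots> = tail g t epowr (e + 1)" using e by (simp add: tail_cmult epowr_add)
  finally show "tail (\<lambda>s. tail g s epowr e * g s) t \<le> tail g t epowr (e + 1)" .
  let ?h = "\<lambda>s. g s * of_bool (t < s)"
  have "tail g t epowr (e + 1) \<le> 2 epowr (e + 1) * (\<integral>\<^sup>+s. tail ?h s epowr e * ?h s \<partial>hl)"
    using power_le_accumulated[OF accumulates_tail e, of ?h] by (simp add: tail_def[of g])
  also have "(\<integral>\<^sup>+s. tail ?h s epowr e * ?h s \<partial>hl) \<le> tail (\<lambda>s. tail g s epowr e * g s) t"
    unfolding tail_def[of "\<lambda>s. tail g s epowr e * g s"] mult.assoc using e
    by (intro nn_integral_mono mult_right_mono epowr_mono tail_mono_fun) (auto simp: of_bool_def)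
  finally show "tail g t epowr (e + 1) \<le> 2 epowr (e + 1) * tail (\<lambda>s. tail g s epowr e * g s) t"
    by (simp add: mult_left_mono)
qed

subsection \<open>Monotone limits\<close>

text \<open>Monotonicity and supremum are bundled so that limits pass through products, powers and
  nested integrals by structural rules.\<close>

definition increases_to :: "(nat \<Rightarrow> ennreal) \<Rightarrow> ennreal \<Rightarrow> bool" where
  "increases_to f F \<longleftrightarrow> incseq f \<and> (SUP n. f n) = F"

lemma increases_to_const: "increases_to (\<lambda>n. c) c"
  by (simp add: increases_to_def incseq_const)

lemma increases_to_mult:
  assumes "increases_to f F" "increases_to g G"
  shows "increases_to (\<lambda>n. f n * g n) (F * G)"
proof -
  from assms have mono: "incseq f" "incseq g" and F: "(SUP n. f n) = F" "(SUP n. g n) = G"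
    by (auto simp: increases_to_def)
  have "F * G = (SUP n. SUP m. f m * g n)"
    by (simp add: F[symmetric] SUP_mult_left_ennreal SUP_mult_right_ennreal)
  also have "\<dots> \<le> (SUP n. f n * g n)"
  proof (intro SUP_least)
    fix n m
    have "f m * g n \<le> f (max m n) * g (max m n)"
      using mono by (intro mult_mono) (auto simp: incseq_def)
    also have "\<dots> \<le> (SUP n. f n * g n)" by (rule SUP_upper) simp
    finally show "f m * g n \<le> (SUP n. f n * g n)" .
  qed
  finally have "F * G \<le> (SUP n. f n * g n)" .
  moreover have "(SUP n. f n * g n) \<le> F * G"
    unfolding F[symmetric] by (intro SUP_least mult_mono SUP_upper) auto
  moreover have "incseq (\<lambda>n. f n * g n)"
    using mono by (auto simp: incseq_def intro!: mult_mono)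
  ultimately show ?thesis by (simp add: increases_to_def)
qed

lemma increases_to_add:
  assumes "increases_to f F" "increases_to g G"
  shows "increases_to (\<lambda>n. f n + g n) (F + G)"
  using assms by (auto simp: increases_to_def ennreal_SUP_add incseq_def intro!: add_mono)

lemma increases_to_epowr: "increases_to f F \<Longrightarrow> a \<ge> 0 \<Longrightarrow> increases_to (\<lambda>n. f n epowr a) (F epowr a)"
  by (cases "a = 0") (auto simp: increases_to_def incseq_def SUP_epowr intro!: epowr_mono)

lemma increases_to_nn_integral:
  assumes "\<And>n. f n \<in> borel_measurable M" "\<And>x. x \<in> space M \<Longrightarrow> increases_to (\<lambda>n. f n x) (F x)"
  shows "increases_to (\<lambda>n. \<integral>\<^sup>+x. f n x \<partial>M) (\<integral>\<^sup>+x. F x \<partial>M)"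
proof -
  have inc: "f m x \<le> f n x" if "x \<in> space M" "m \<le> n" for m n x
    using assms(2)[OF that(1)] that(2) by (auto simp: increases_to_def incseq_def)
  have "(\<integral>\<^sup>+x. F x \<partial>M) = (\<integral>\<^sup>+x. (SUP n. f n x) \<partial>M)"
    using assms(2) by (intro nn_integral_cong) (simp add: increases_to_def)
  also have "\<dots> = (SUP n. \<integral>\<^sup>+x. f n x \<partial>M)"
    by (intro nn_integral_monotone_convergence_SUP_AE assms AE_I2 inc) auto
  finally show ?thesis
    by (auto simp: increases_to_def incseq_def intro!: nn_integral_mono inc)
qed

lemma increases_to_le: "increases_to f F \<Longrightarrow> (\<And>n. f n \<le> c) \<Longrightarrow> F \<le> c"
  by (auto simp: increases_to_def intro: SUP_least)

text \<open>On \<open>(0,\<infinity>)\<close> the truncation \<open>trunc 0 g\<close> vanishes, as \<open>1 / real 0 = 0\<close>.\<close>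

definition trunc :: "nat \<Rightarrow> (real \<Rightarrow> ennreal) \<Rightarrow> real \<Rightarrow> ennreal" where
  "trunc n g s = min (g s) (of_nat n) * of_bool (1 / real n < s \<and> s < real n)"

lemma measurable_trunc [measurable]: "g \<in> borel_measurable hl \<Longrightarrow> trunc n g \<in> borel_measurable hl"
proof -
  assume [measurable]: "g \<in> borel_measurable hl"
  show ?thesis unfolding trunc_def[abs_def] of_bool_conj by measurable
qed

lemma trunc_le: "trunc n g s \<le> g s"
  by (auto simp: trunc_def of_bool_def)

lemma increases_to_trunc:
  assumes "0 < s" shows "increases_to (\<lambda>n. trunc n g s) (g s)"
  unfolding increases_to_def
proof
  have mono: "1 / real n < s \<and> s < real n" if "1 / real m < s \<and> s < real m" "m \<le> n" for m n
  proof -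
    have "m > 0" using that assms by (auto intro: gr0I)
    then have "1 / real n \<le> 1 / real m" using that by (intro divide_left_mono) auto
    then show ?thesis using that by auto
  qed
  show "incseq (\<lambda>n. trunc n g s)"
    using mono by (auto simp: incseq_def trunc_def of_bool_def min_le_iff_disj intro: of_nat_mono)
  obtain N where N: "real N > max s (1 / s)" using reals_Archimedean2 by blast
  then have "N > 0" using assms by (auto intro: gr0I)
  then have "1 / real N < s" using N assms by (simp add: divide_simps mult.commute)
  then have N': "1 / real N < s \<and> s < real N" using N by simp
  show "(SUP n. trunc n g s) = g s"
  proof (rule antisym)
    show "(SUP n. trunc n g s) \<le> g s" by (intro SUP_least trunc_le)
    show "g s \<le> (SUP n. trunc n g s)"
    proof (rule ccontr)
      assume "\<not> ?thesis"
      then have l: "(SUP n. trunc n g s) < g s" by simp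
      then have "(SUP n. trunc n g s) < top" using top_greatest by (rule less_le_trans)
      then obtain m where m: "(SUP n. trunc n g s) < of_nat m"
        using ennreal_Ex_less_of_nat by blast
      let ?n = "max N m"
      have "trunc ?n g s = min (g s) (of_nat ?n)" using mono[OF N', of ?n] by (simp add: trunc_def)
      moreover have "trunc ?n g s \<le> (SUP n. trunc n g s)" by (rule SUP_upper) simp
      moreover have "of_nat m \<le> (of_nat ?n :: ennreal)" by (intro of_nat_mono) simp
      then have "(SUP n. trunc n g s) < min (g s) (of_nat ?n)" using l less_le_trans[OF m] by simp
      ultimately show False by (metis leD)
    qed
  qed
qed

lemma nn_integral_trunc_finite: "(\<integral>\<^sup>+s. trunc n g s \<partial>hl) < top"
proof -
  have "(\<integral>\<^sup>+s. trunc n g s \<partial>hl) \<le> (\<integral>\<^sup>+s. of_nat n * indicator {0<..<real n} s \<partial>hl)"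
    by (intro nn_integral_mono) (auto simp: trunc_def of_bool_def indicator_def space_hl)
  also have "\<dots> = of_nat n * emeasure hl {0<..<real n}"
    by (subst nn_integral_cmult_indicator) (auto simp: sets_restrict_space)
  also have "emeasure hl {0<..<real n} = ennreal (real n)"
    by (subst emeasure_restrict_space) auto
  also have "of_nat n * ennreal (real n) < top" by (simp add: ennreal_mult_less_top ennreal_of_nat_eq_real_of_nat)
  finally show ?thesis .
qed

subsection \<open>The inequality with the norm of integrable functions on the right\<close>

text \<open>Hardy's inequality for averages with respect to the measure \<open>om ds\<close>: with
  \<open>g = (f/om)^r\<close>, the inner primitive divided by \<open>V = prim om\<close> is the mean
  of \<open>g\<close>, and the exponent is \<open>1/r > 1\<close>. A power of \<open>V\<close> is
  inserted before Hoelder's inequality, and Fubini's theorem finishes; \<open>e\<close> is the power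
  that leaves \<open>V^(-1/2) om\<close> in the second Hoelder factor. Integrability of
  \<open>om\<close> permits cancelling powers of \<open>V\<close>.\<close>

lemma weighted_Hardy:
  assumes [measurable]: "f \<in> borel_measurable hl" "om \<in> borel_measurable hl"
    and fin: "(\<integral>\<^sup>+s. om s \<partial>hl) < top" and r: "0 < r" "r < 1"
  defines "e \<equiv> (1 - r) / (2 * r)"
  shows "(\<integral>\<^sup>+t. prim (\<lambda>s. f s epowr r * om s epowr (1 - r)) t epowr (1 / r) * prim om t epowr (- (1 / r)) * om t \<partial>hl)
    \<le> ((2 * ennreal (geo (1 / 2))) epowr ((1 - r) / r) * (2 * ennreal (geo e))) * (\<integral>\<^sup>+s. f s \<partial>hl)"
proof -
  have e: "e > 0" using r by (simp add: e_def)
  let ?V = "prim om"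
  let ?A = "(2 * ennreal (geo (1 / 2))) epowr ((1 - r) / r)"
  have V_fin: "?V t < top" for t using fin prim_le[of om t] by (rule le_less_trans[rotated])
  have V_pos: "AE t in hl. om t \<noteq> 0 \<longrightarrow> ?V t > 0"
    by (rule accumulates_AE_pos[OF accumulates_prim]) measurable
  have H: "prim (\<lambda>s. f s epowr r * om s epowr (1 - r)) t epowr (1 / r)
      \<le> ?A * (prim (\<lambda>s. f s * ?V s epowr e) t * ?V t epowr e)" (is "?H epowr _ \<le> _") for t
  proof -
    let ?B = "\<lambda>s. ?V s epowr (1 / 2 - 1) * of_bool (?V s \<le> ?V t) * om s"
    have "?H \<le> (\<integral>\<^sup>+s. ((f s * ?V s epowr e) * of_bool (s < t)) epowr r * ?B s epowr (1 - r) \<partial>hl)"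
      unfolding prim_def[of "\<lambda>s. f s epowr r * om s epowr (1 - r)"]
    proof (rule nn_integral_mono_AE)
      show "AE s in hl. f s epowr r * om s epowr (1 - r) * of_bool (s < t)
        \<le> ((f s * ?V s epowr e) * of_bool (s < t)) epowr r * ?B s epowr (1 - r)"
        using V_pos
      proof eventually_elim
        case (elim s)
        show ?case
        proof (cases "om s = 0 \<or> \<not> s < t")
          case True
          then show ?thesis using r by (auto simp: zero_epowr)
        next
          case False
          then have pos: "0 < ?V s" and st: "s < t" "?V s \<le> ?V t" using elim by (auto intro: prim_mono)
          have "?V s epowr (e * r) * ?V s epowr ((1 / 2 - 1) * (1 - r)) = ?V s epowr (e * r + (1 / 2 - 1) * (1 - r))"
            by (rule epowr_add_fin[OF pos V_fin, symmetric])
          also have "e * r + (1 / 2 - 1) * (1 - r) = 0" using r by (simp add: e_def field_simps)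
          finally have *: "?V s epowr (e * r) * ?V s epowr ((1 / 2 - 1) * (1 - r)) = 1" by simp
          have "((f s * ?V s epowr e) * of_bool (s < t)) epowr r * ?B s epowr (1 - r)
            = (f s epowr r * om s epowr (1 - r)) * (?V s epowr (e * r) * ?V s epowr ((1 / 2 - 1) * (1 - r)))"
            using r st by (simp add: epowr_mult epowr_epowr ac_simps)
          then show ?thesis using st by (simp only: *) simp
        qed
      qed
    qed
    also have "\<dots> \<le> (\<integral>\<^sup>+s. (f s * ?V s epowr e) * of_bool (s < t) \<partial>hl) epowr r * (\<integral>\<^sup>+s. ?B s \<partial>hl) epowr (1 - r)"
      using r by (intro nn_integral_Hoelder) auto
    also have "\<dots> \<le> prim (\<lambda>s. f s * ?V s epowr e) t epowr r * (2 * ennreal (geo (1 / 2)) * ?V t epowr (1 / 2)) epowr (1 - r)"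
      unfolding prim_def[of "\<lambda>s. f s * ?V s epowr e"] using r
      by (intro mult_left_mono epowr_mono nn_integral_accumulated_power_le accumulates_prim) auto
    finally have "?H epowr (1 / r) \<le> (prim (\<lambda>s. f s * ?V s epowr e) t epowr r
        * (2 * ennreal (geo (1 / 2)) * ?V t epowr (1 / 2)) epowr (1 - r)) epowr (1 / r)"
      using r by (intro epowr_mono) auto
    also have "\<dots> = ?A * (prim (\<lambda>s. f s * ?V s epowr e) t * ?V t epowr e)"
      using r by (simp add: epowr_mult epowr_epowr e_def ac_simps)
    finally show ?thesis .
  qed
  have "(\<integral>\<^sup>+t. prim (\<lambda>s. f s epowr r * om s epowr (1 - r)) t epowr (1 / r) * ?V t epowr (- (1 / r)) * om t \<partial>hl)
    \<le> (\<integral>\<^sup>+t. ?A * (prim (\<lambda>s. f s * ?V s epowr e) t * (?V t epowr (- e - 1) * om t)) \<partial>hl)"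
  proof (rule nn_integral_mono_AE)
    show "AE t in hl. prim (\<lambda>s. f s epowr r * om s epowr (1 - r)) t epowr (1 / r) * ?V t epowr (- (1 / r)) * om t
      \<le> ?A * (prim (\<lambda>s. f s * ?V s epowr e) t * (?V t epowr (- e - 1) * om t))"
      using V_pos
    proof eventually_elim
      case (elim t)
      show ?case
      proof (cases "om t = 0")
        case False
        then have pos: "0 < ?V t" using elim by simp
        have "?V t epowr e * ?V t epowr (- (1 / r)) = ?V t epowr (e + - (1 / r))"
          by (rule epowr_add_fin[OF pos V_fin, symmetric])
        also have "e + - (1 / r) = - e - 1" using r by (simp add: e_def field_simps)
        finally have *: "?V t epowr e * ?V t epowr (- (1 / r)) = ?V t epowr (- e - 1)" .
        have "prim (\<lambda>s. f s epowr r * om s epowr (1 - r)) t epowr (1 / r) * ?V t epowr (- (1 / r)) * om t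
          \<le> (?A * (prim (\<lambda>s. f s * ?V s epowr e) t * ?V t epowr e)) * ?V t epowr (- (1 / r)) * om t"
          by (intro mult_right_mono H) auto
        also have "\<dots> = ?A * (prim (\<lambda>s. f s * ?V s epowr e) t * ((?V t epowr e * ?V t epowr (- (1 / r))) * om t))"
          by (simp add: ac_simps)
        finally show ?thesis unfolding * .
      qed simp
    qed
  qed
  also have "\<dots> = ?A * (\<integral>\<^sup>+s. (f s * ?V s epowr e) * tail (\<lambda>t. ?V t epowr (- e - 1) * om t) s \<partial>hl)"
    by (simp add: nn_integral_cmult nn_integral_prim_swap)
  also have "\<dots> \<le> ?A * (\<integral>\<^sup>+s. 2 * ennreal (geo e) * f s \<partial>hl)"
  proof (intro mult_left_mono nn_integral_mono)
    fix s
    have "tail (\<lambda>t. ?V t epowr (- e - 1) * om t) s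
        \<le> (\<integral>\<^sup>+t. ?V t epowr (- e - 1) * of_bool (?V s \<le> ?V t) * om t \<partial>hl)"
      unfolding tail_def by (intro nn_integral_mono) (auto simp: of_bool_def prim_mono)
    also have "\<dots> \<le> 2 * ennreal (geo e) * ?V s epowr (- e)"
      by (intro nn_integral_accumulated_neg_power_le accumulates_prim e) measurable
    finally have "(f s * ?V s epowr e) * tail (\<lambda>t. ?V t epowr (- e - 1) * om t) s
      \<le> (f s * ?V s epowr e) * (2 * ennreal (geo e) * ?V s epowr (- e))" by (intro mult_left_mono) auto
    also have "\<dots> = 2 * ennreal (geo e) * f s * (?V s epowr e * ?V s epowr (- e))" by (simp add: ac_simps)
    \<comment> \<open>Only an inequality: where \<open>?V s = 0\<close> the product is
      \<open>0 * top = 0\<close>.\<close>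
    also have "?V s epowr e * ?V s epowr (- e) \<le> 1"
      using epowr_add_fin[of "?V s" e "- e"] e V_fin[of s]
      by (cases "?V s = 0") (auto simp: zero_epowr zero_less_iff_neq_zero)
    finally show "(f s * ?V s epowr e) * tail (\<lambda>t. ?V t epowr (- e - 1) * om t) s \<le> 2 * ennreal (geo e) * f s"
      by (simp add: mult_left_mono)
  qed simp
  also have "\<dots> = ?A * (2 * ennreal (geo e)) * (\<integral>\<^sup>+s. f s \<partial>hl)" by (simp add: nn_integral_cmult mult.assoc)
  finally show ?thesis .
qed

text \<open>With \<open>H\<close> the inner primitive, \<open>H^(q/r)\<close> is recovered from its
  derivative, so that \<open>u\<close> enters through \<open>tail u\<close>. Hoelder's inequality
  with exponents \<open>r\<close>, \<open>q - r\<close>, \<open>1 - q\<close> then separates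
  \<open>\<integral> f\<close>, the integral in Hardy's inequality, and an integral free of
  \<open>f\<close>, which is brought into the stated form by parts. For \<open>q = r\<close> the
  Hardy factor has exponent 0.\<close>

lemma iterated_inequality_L1_finite:
  fixes r q :: real
  assumes [measurable]: "f \<in> borel_measurable hl" "om \<in> borel_measurable hl" "u \<in> borel_measurable hl"
    and fin: "(\<integral>\<^sup>+s. om s \<partial>hl) < top" and rq: "0 < r" "r \<le> q" "q < 1"
  defines "e \<equiv> (1 - r) / (2 * r)"
  defines "A \<equiv> (2 * ennreal (geo (1 / 2))) epowr ((1 - r) / r) * (2 * ennreal (geo e))"
  shows "(\<integral>\<^sup>+t. prim (\<lambda>s. f s epowr r * om s epowr (1 - r)) t epowr (q / r) * u t \<partial>hl)
    \<le> 2 epowr (q / r) * A epowr (q - r) * 2 * (\<integral>\<^sup>+s. f s \<partial>hl) epowr q *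
      (\<integral>\<^sup>+t. tail u t epowr (q / (1 - q)) * u t * prim om t epowr (q * (1 - r) / (r * (1 - q))) \<partial>hl) epowr (1 - q)"
proof -
  let ?V = "prim om" and ?U = "tail u"
  define h where "h = (\<lambda>s. f s epowr r * om s epowr (1 - r))"
  have [measurable]: "h \<in> borel_measurable hl" unfolding h_def by measurable
  \<comment> \<open>The power of \<open>prim om\<close> in the third factor that cancels the power
    \<open>-(q - r)/r\<close> produced by the Hardy factor.\<close>
  define m where "m = (q - r) / (r * (1 - q))"
  have Qm: "(q - r) / r \<ge> 0" "m \<ge> 0" and mm: "q * (1 - r) / (r * (1 - q)) = m + 1"
    and Q: "q / r = (q - r) / r + 1" using rq by (auto simp: m_def field_simps)
  have s: "q / (1 - q) \<ge> 0" "q / (1 - q) + 1 = 1 / (1 - q)" using rq by (auto simp: field_simps)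
  have V_fin: "?V t < top" for t using fin prim_le[of om t] by (rule le_less_trans[rotated])
  have V_pos: "AE t in hl. om t \<noteq> 0 \<longrightarrow> ?V t > 0"
    by (rule accumulates_AE_pos[OF accumulates_prim]) measurable
  let ?B = "\<lambda>t. prim h t epowr (1 / r) * ?V t epowr (- (1 / r)) * om t"
  let ?C = "\<lambda>t. ?V t epowr m * om t * ?U t epowr (1 / (1 - q))"
  have "(\<integral>\<^sup>+t. prim h t epowr (q / r) * u t \<partial>hl)
      \<le> (\<integral>\<^sup>+t. 2 epowr (q / r) * (prim (\<lambda>s. prim h s epowr ((q - r) / r) * h s) t * u t) \<partial>hl)"
    using prim_power_bounds(2)[of h "(q - r) / r"] Qm unfolding mult.assoc[symmetric] Q
    by (intro nn_integral_mono mult_right_mono) auto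
  also have "\<dots> = 2 epowr (q / r) * (\<integral>\<^sup>+s. prim h s epowr ((q - r) / r) * h s * ?U s \<partial>hl)"
    by (simp add: nn_integral_cmult nn_integral_prim_swap)
  also have "\<dots> \<le> 2 epowr (q / r) * (\<integral>\<^sup>+s. f s epowr r * (?B s epowr (q - r) * ?C s epowr (1 - q)) \<partial>hl)"
  proof (intro mult_left_mono nn_integral_mono_AE)
    show "AE s in hl. prim h s epowr ((q - r) / r) * h s * ?U s \<le> f s epowr r * (?B s epowr (q - r) * ?C s epowr (1 - q))"
      using V_pos
    proof eventually_elim
      case (elim s)
      show ?case
      proof (cases "om s = 0")
        case True
        then show ?thesis using rq by (simp add: h_def zero_epowr)
      next
        case False
        then have pos: "0 < ?V s" using elim by simp
        have "- (1 / r) * (q - r) + m * (1 - q) = 0" using rq by (simp add: m_def field_simps)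
        then have *: "?V s epowr (- (1 / r) * (q - r)) * ?V s epowr (m * (1 - q)) = 1"
          using epowr_add_fin[OF pos V_fin, of "- (1 / r) * (q - r)" "m * (1 - q)"] by simp
        have **: "om s epowr (q - r) * om s epowr (1 - q) = om s epowr (1 - r)"
          using epowr_add[of "q - r" "1 - q" "om s"] rq by simp
        have "f s epowr r * (?B s epowr (q - r) * ?C s epowr (1 - q)) =
          prim h s epowr ((q - r) / r) * (f s epowr r * (om s epowr (q - r) * om s epowr (1 - q))) * ?U s *
          (?V s epowr (- (1 / r) * (q - r)) * ?V s epowr (m * (1 - q)))"
          using rq by (simp add: epowr_mult epowr_epowr ac_simps)
        then show ?thesis unfolding * ** by (simp add: h_def)
      qed
    qed
  qed simp
  also have "\<dots> \<le> 2 epowr (q / r) * ((\<integral>\<^sup>+s. f s \<partial>hl) epowr r * ((\<integral>\<^sup>+s. ?B s \<partial>hl) epowr (q - r) * (\<integral>\<^sup>+s. ?C s \<partial>hl) epowr (1 - q)))"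
    using rq by (intro mult_left_mono nn_integral_Hoelder3) auto
  also have "\<dots> \<le> 2 epowr (q / r) * ((\<integral>\<^sup>+s. f s \<partial>hl) epowr r * ((A * (\<integral>\<^sup>+s. f s \<partial>hl)) epowr (q - r) *
    (2 epowr (1 / (1 - q)) * (\<integral>\<^sup>+t. ?U t epowr (q / (1 - q)) * u t * ?V t epowr (q * (1 - r) / (r * (1 - q))) \<partial>hl)) epowr (1 - q)))"
  proof (intro mult_left_mono mult_mono epowr_mono)
    show "(\<integral>\<^sup>+s. ?B s \<partial>hl) \<le> A * (\<integral>\<^sup>+s. f s \<partial>hl)"
      unfolding A_def e_def h_def using rq fin by (intro weighted_Hardy) auto
    have "(\<integral>\<^sup>+s. ?C s \<partial>hl) \<le> (\<integral>\<^sup>+s. 2 epowr (1 / (1 - q)) *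
        ((?V s epowr m * om s) * tail (\<lambda>t. ?U t epowr (q / (1 - q)) * u t) s) \<partial>hl)"
    proof (rule nn_integral_mono)
      fix t
      have "?C t \<le> ?V t epowr m * om t * (2 epowr (1 / (1 - q)) * tail (\<lambda>t. ?U t epowr (q / (1 - q)) * u t) t)"
        using tail_power_bounds(2)[of u "q / (1 - q)" t] s by (intro mult_left_mono) auto
      then show "?C t \<le> 2 epowr (1 / (1 - q)) * ((?V t epowr m * om t) * tail (\<lambda>t. ?U t epowr (q / (1 - q)) * u t) t)"
        by (simp add: ac_simps)
    qed
    also have "\<dots> = 2 epowr (1 / (1 - q)) * (\<integral>\<^sup>+t. prim (\<lambda>s. ?V s epowr m * om s) t * (?U t epowr (q / (1 - q)) * u t) \<partial>hl)"
      by (simp add: nn_integral_cmult nn_integral_prim_swap)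
    also have "\<dots> \<le> 2 epowr (1 / (1 - q)) * (\<integral>\<^sup>+t. ?V t epowr (m + 1) * (?U t epowr (q / (1 - q)) * u t) \<partial>hl)"
      using Qm by (intro mult_left_mono nn_integral_mono mult_right_mono prim_power_bounds) auto
    finally show "(\<integral>\<^sup>+s. ?C s \<partial>hl) \<le> 2 epowr (1 / (1 - q)) *
        (\<integral>\<^sup>+t. ?U t epowr (q / (1 - q)) * u t * ?V t epowr (q * (1 - r) / (r * (1 - q))) \<partial>hl)"
      unfolding mm by (simp add: ac_simps)
  qed (use rq in auto)
  also have "\<dots> = 2 epowr (q / r) * A epowr (q - r) * 2 * ((\<integral>\<^sup>+s. f s \<partial>hl) epowr r * (\<integral>\<^sup>+s. f s \<partial>hl) epowr (q - r)) *
      (\<integral>\<^sup>+t. ?U t epowr (q / (1 - q)) * u t * ?V t epowr (q * (1 - r) / (r * (1 - q))) \<partial>hl) epowr (1 - q)"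
    using rq by (simp add: epowr_mult epowr_epowr ac_simps)
  also have "(\<integral>\<^sup>+s. f s \<partial>hl) epowr r * (\<integral>\<^sup>+s. f s \<partial>hl) epowr (q - r) = (\<integral>\<^sup>+s. f s \<partial>hl) epowr q"
    using epowr_add[of r "q - r" "\<integral>\<^sup>+s. f s \<partial>hl"] rq by simp
  finally show ?thesis by (simp add: h_def)
qed

text \<open>Truncating \<open>om\<close> provides the integrability used above at no cost in the
  constant. The constant is fixed before the functions are chosen, and the exponents are general,
  because the inequality is used both for \<open>r\<close>, \<open>q\<close> and for
  \<open>r/p\<close>, \<open>q/p\<close>.\<close>

lemma iterated_inequality_L1:
  fixes r q :: real
  assumes rq: "0 < r" "r \<le> q" "q < 1"
  obtains c :: real where "0 < c" and
    "\<And>f om u. f \<in> borel_measurable hl \<Longrightarrow> om \<in> borel_measurable hl \<Longrightarrow> u \<in> borel_measurable hl \<Longrightarrow>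
      (\<integral>\<^sup>+t. prim (\<lambda>s. f s epowr r * om s epowr (1 - r)) t epowr (q / r) * u t \<partial>hl)
      \<le> ennreal c * (\<integral>\<^sup>+s. f s \<partial>hl) epowr q *
        (\<integral>\<^sup>+t. tail u t epowr (q / (1 - q)) * u t * prim om t epowr (q * (1 - r) / (r * (1 - q))) \<partial>hl) epowr (1 - q)"
proof -
  define e where "e = (1 - r) / (2 * r)"
  define A where "A = (2 * ennreal (geo (1 / 2))) epowr ((1 - r) / r) * (2 * ennreal (geo e))"
  define C where "C = 2 epowr (q / r) * A epowr (q - r) * 2"
  have e: "e > 0" using rq by (simp add: e_def)
  have "A < top" "A \<noteq> 0" using geo_pos[OF e] geo_pos[of "1 / 2"] rq
    by (auto simp: A_def ennreal_mult_less_top epowr_eq_0_iff intro!: epowr_less_top)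
  then have C: "C < top" "C \<noteq> 0" using rq
    by (auto simp: C_def ennreal_mult_less_top two_epowr zero_less_iff_neq_zero[symmetric] intro!: epowr_less_top epowr_pos)
  then obtain c where c: "C = ennreal c" "0 < c" by (metis ennreal_cases3 less_irrefl)
  show ?thesis
  proof (rule that[OF c(2)])
    fix f om u :: "real \<Rightarrow> ennreal"
    assume [measurable]: "f \<in> borel_measurable hl" "om \<in> borel_measurable hl" "u \<in> borel_measurable hl"
    let ?R = "\<lambda>om. (\<integral>\<^sup>+t. tail u t epowr (q / (1 - q)) * u t * prim om t epowr (q * (1 - r) / (r * (1 - q))) \<partial>hl)"
    have "increases_to (\<lambda>n. \<integral>\<^sup>+t. prim (\<lambda>s. f s epowr r * trunc n om s epowr (1 - r)) t epowr (q / r) * u t \<partial>hl)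
      (\<integral>\<^sup>+t. prim (\<lambda>s. f s epowr r * om s epowr (1 - r)) t epowr (q / r) * u t \<partial>hl)"
      unfolding prim_def using rq
      by (intro increases_to_nn_integral increases_to_mult increases_to_epowr increases_to_const increases_to_trunc)
        (auto simp: space_hl)
    then show "(\<integral>\<^sup>+t. prim (\<lambda>s. f s epowr r * om s epowr (1 - r)) t epowr (q / r) * u t \<partial>hl)
      \<le> ennreal c * (\<integral>\<^sup>+s. f s \<partial>hl) epowr q * ?R om epowr (1 - q)"
    proof (rule increases_to_le)
      fix n
      have "(\<integral>\<^sup>+t. prim (\<lambda>s. f s epowr r * trunc n om s epowr (1 - r)) t epowr (q / r) * u t \<partial>hl)
        \<le> C * (\<integral>\<^sup>+s. f s \<partial>hl) epowr q * ?R (trunc n om) epowr (1 - q)"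
        unfolding C_def A_def e_def using rq by (intro iterated_inequality_L1_finite nn_integral_trunc_finite) auto
      also have "?R (trunc n om) epowr (1 - q) \<le> ?R om epowr (1 - q)"
        using rq by (intro epowr_mono nn_integral_mono mult_left_mono prim_mono_fun trunc_le) auto
      finally show "(\<integral>\<^sup>+t. prim (\<lambda>s. f s epowr r * trunc n om s epowr (1 - r)) t epowr (q / r) * u t \<partial>hl)
        \<le> ennreal c * (\<integral>\<^sup>+s. f s \<partial>hl) epowr q * ?R om epowr (1 - q)"
        unfolding c by (simp add: mult_left_mono)
    qed
  qed
qed

subsection \<open>Level sets of the primitive of a weight\<close>

text \<open>The last condition makes \<open>W\<close> take every value below its supremum; this fails only if \<open>W\<close> jumps to
  \<open>\<infinity>\<close>.\<close>

definition regular :: "(real \<Rightarrow> ennreal) \<Rightarrow> bool" where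
  "regular w \<longleftrightarrow> w \<in> borel_measurable hl \<and> (\<forall>t>0. 0 < prim w t) \<and> (\<exists>s>0. prim w s < top) \<and>
    (\<forall>t>0. prim w t < top \<longrightarrow> (\<exists>x>t. prim w x < top))"

lemma prim_less_imp_less: "prim w s < prim w t \<Longrightarrow> s < t"
  using prim_mono[of t s w] by (meson not_le)

text \<open>A substitute for the intermediate value theorem. With \<open>W = prim w\<close> and
  \<open>x\<close> the supremum of the points where \<open>W \<le> b\<close>, it suffices that
  \<open>b \<le> W x\<close>. This is right-continuity of \<open>W\<close> at \<open>x\<close>,
  obtained by monotone convergence of tails inside an interval \<open>(x,y)\<close> on which
  \<open>W\<close> stays finite; such a \<open>y\<close> exists because \<open>W\<close> does not
  jump to infinity.\<close>

lemma regular_mass_ge: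
  assumes w: "regular w" and t: "b \<le> prim w t" "0 < t"
  shows "b \<le> (\<integral>\<^sup>+s. w s * of_bool (prim w s \<le> b) \<partial>hl)"
proof -
  have [measurable]: "w \<in> borel_measurable hl" using w by (simp add: regular_def)
  have ge: "prim w x \<le> (\<integral>\<^sup>+s. w s * of_bool (prim w s \<le> b) \<partial>hl)" if "\<And>s. 0 < s \<Longrightarrow> s < x \<Longrightarrow> prim w s \<le> b" for x
    unfolding prim_def[of w x] by (intro nn_integral_mono mult_left_mono) (use that in \<open>auto simp: of_bool_def space_hl\<close>)
  show ?thesis
  proof (cases "prim w t = b")
    case True
    then have "prim w s \<le> b" if "s < t" for s using prim_mono[of s t w] that by simp
    then show ?thesis using ge[of t] True by simp
  next
    case False
    then have tb: "b < prim w t" using t by simp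
    \<comment> \<open>The point 0 is added so that the supremum makes sense when
      \<open>W > b\<close> everywhere.\<close>
    define A where "A = insert 0 {s. 0 < s \<and> prim w s \<le> b}"
    have bdd: "bdd_above A"
    proof -
      have "s \<le> t" if "prim w s \<le> b" for s
        using prim_less_imp_less[OF le_less_trans[OF that tb]] by simp
      then show ?thesis using t by (auto simp: A_def bdd_above_def intro!: exI[of _ t])
    qed
    define x where "x = Sup A"
    have x0: "0 \<le> x" unfolding x_def by (rule cSup_upper[OF _ bdd]) (simp add: A_def)
    have below: "prim w s \<le> b" if sx: "0 < s" "s < x" for s
    proof -
      have "A \<noteq> {}" by (simp add: A_def)
      then obtain a where "a \<in> A" "s < a" using less_cSup_iff[OF _ bdd, of s] sx(2) unfolding x_def by blast
      then show ?thesis using sx prim_mono[of s a w] by (auto simp: A_def)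
    qed
    have above: "b \<le> prim w z" if "x < z" for z
    proof (rule ccontr)
      assume "\<not> ?thesis"
      then have "z \<in> A" using that x0 by (simp add: A_def)
      then have "z \<le> x" unfolding x_def by (rule cSup_upper[OF _ bdd])
      then show False using that by simp
    qed
    \<comment> \<open>The jump condition speaks of positive points only; for \<open>x = 0\<close>
      the existence of one finite value of \<open>prim w\<close> is used instead.\<close>
    have ex: "\<exists>y>x. prim w y < top" if "prim w x < top"
      using w that x0 by (cases "x = 0") (auto simp: regular_def)
    have "b \<le> prim w x"
    proof (cases "prim w x < top")
      case True
      then obtain y where y: "x < y" "prim w y < top" using ex by blast
      let ?g = "\<lambda>s. w s * of_bool (s < y)"
      have [measurable]: "?g \<in> borel_measurable hl" by measurable
      have split: "prim w y = prim w z + tail ?g z" if "z < y" for z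
      proof -
        have "prim w y = (\<integral>\<^sup>+s. w s * of_bool (s < z) + ?g s * of_bool (z < s) \<partial>hl)"
          unfolding prim_def[of w y]
          by (rule nn_integral_cong_AE, use AE_hl_neq[of z] in eventually_elim) (use that in \<open>auto simp: of_bool_def\<close>)
        also have "\<dots> = prim w z + tail ?g z" unfolding prim_def tail_def by (rule nn_integral_add) auto
        finally show ?thesis .
      qed
      have lim: "tail ?g x \<le> (SUP n. tail ?g (x + (y - x) / real (n + 2)))"
      proof -
        have ex: "\<exists>n. x + (y - x) / real (n + 2) < s" if "x < s" for s
        proof -
          obtain n where n: "(y - x) / (s - x) < real n" using reals_Archimedean2 by blast
          then have "(y - x) < real n * (s - x)" using that by (simp add: divide_less_eq)
          also have "\<dots> \<le> real (n + 2) * (s - x)" using that by (intro mult_right_mono) auto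
          finally have "(y - x) / real (n + 2) < s - x" by (simp add: divide_less_eq mult.commute)
          then show ?thesis by (intro exI[of _ n]) linarith
        qed
        have "tail ?g x \<le> (\<integral>\<^sup>+s. ?g s * of_bool (\<exists>n. x + (y - x) / real (n + 2) < s) \<partial>hl)"
          unfolding tail_def by (intro nn_integral_mono mult_left_mono) (use ex in auto)
        also have "\<dots> = (SUP n. \<integral>\<^sup>+s. ?g s * of_bool (x + (y - x) / real (n + 2) < s) \<partial>hl)"
        proof (rule nn_integral_SUP_of_bool)
          fix n s assume "x + (y - x) / real (n + 2) < s"
          moreover have "(y - x) / real (Suc n + 2) \<le> (y - x) / real (n + 2)"
            using y by (intro divide_left_mono) auto
          ultimately show "x + (y - x) / real (Suc n + 2) < s" by linarith
        qed auto
        finally show ?thesis by (simp add: tail_def)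
      qed
      have "b + tail ?g x \<le> (SUP n. b + tail ?g (x + (y - x) / real (n + 2)))"
        unfolding add.commute[of b] using lim by (subst ennreal_SUP_add_left) (auto intro: add_right_mono)
      also have "\<dots> \<le> prim w y"
      proof (rule SUP_least)
        fix n
        let ?z = "x + (y - x) / real (n + 2)"
        have "(y - x) / real (n + 2) < y - x" using y by (simp add: divide_less_eq)
        then have "x < ?z" "?z < y" using y by auto
        then show "b + tail ?g ?z \<le> prim w y" using split above by (simp add: add_right_mono)
      qed
      also have "\<dots> = prim w x + tail ?g x" using split y by simp
      finally have "tail ?g x + b \<le> tail ?g x + prim w x" by (simp add: add.commute)
      moreover have "tail ?g x < top" using split[OF y(1)] y(2) by (simp add: ennreal_add_less_top)
      ultimately show ?thesis by (auto simp: ennreal_add_left_cancel_le)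
    qed (simp add: less_top[symmetric])
    then show ?thesis using ge[of x] below by (auto intro: order_trans)
  qed
qed

text \<open>The set \<open>W \<le> 2a\<close> has mass at least \<open>2a\<close>, and its subset
  \<open>W \<le> a\<close> has mass at most \<open>a\<close>.\<close>

lemma regular_mass_between:
  assumes w: "regular w" and t: "2 * a \<le> prim w t" "0 < t" and a: "a < top"
  shows "a \<le> (\<integral>\<^sup>+s. w s * of_bool (a < prim w s \<and> prim w s \<le> 2 * a) \<partial>hl)"
proof -
  have [measurable]: "w \<in> borel_measurable hl" using w by (simp add: regular_def)
  have "a + a \<le> (\<integral>\<^sup>+s. w s * of_bool (prim w s \<le> 2 * a) \<partial>hl)"
    using regular_mass_ge[OF w t] by (simp add: mult_2)
  also have "\<dots> \<le> (\<integral>\<^sup>+s. w s * of_bool (prim w s \<le> a) + w s * of_bool (a < prim w s \<and> prim w s \<le> 2 * a) \<partial>hl)"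
    by (intro nn_integral_mono) (auto simp: of_bool_def)
  also have "\<dots> = (\<integral>\<^sup>+s. w s * of_bool (prim w s \<le> a) \<partial>hl) + (\<integral>\<^sup>+s. w s * of_bool (a < prim w s \<and> prim w s \<le> 2 * a) \<partial>hl)"
    by (rule nn_integral_add) auto
  also have "(\<integral>\<^sup>+s. w s * of_bool (prim w s \<le> a) \<partial>hl) \<le> a"
    using accumulates_prim[of w] by (auto simp: accumulates_def)
  finally have "a + a \<le> a + (\<integral>\<^sup>+s. w s * of_bool (a < prim w s \<and> prim w s \<le> 2 * a) \<partial>hl)" by (simp add: add_right_mono)
  then show ?thesis using a by (auto simp: ennreal_add_left_cancel_le)
qed

section \<open>Dyadic blocks of values of the primitive\<close>

definition block :: "int \<Rightarrow> ennreal \<Rightarrow> bool" where "block k x \<longleftrightarrow> dy k < x \<and> x \<le> dy (k + 1)"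

lemma measurable_block [measurable]: "Measurable.pred borel (block k)"
  unfolding block_def[abs_def] by measurable

lemma measurable_block' [measurable (raw)]: "f \<in> borel_measurable M \<Longrightarrow> Measurable.pred M (\<lambda>x. block k (f x))"
  by (rule measurable_compose[OF _ measurable_block])

lemma block_ex: "0 < x \<Longrightarrow> x < top \<Longrightarrow> \<exists>k. block k x"
  using dy_ex[of x] by (metis block_def)

lemma block_unique: "block j x \<Longrightarrow> block k x \<Longrightarrow> j = k"
  using less_le_trans[of "dy j" x "dy (k + 1)"] less_le_trans[of "dy k" x "dy (j + 1)"]
  by (auto simp: block_def)

lemma sum_block:
  assumes "block k x" shows "(\<integral>\<^sup>+j. h j * of_bool (block j x) \<partial>zint) = h k"
proof -
  have "(\<integral>\<^sup>+j. h j * of_bool (block j x) \<partial>zint) = (\<integral>\<^sup>+j. h j * indicator {k} j \<partial>zint)"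
  proof (rule nn_integral_cong)
    fix j
    have "block j x \<longleftrightarrow> j = k" using block_unique[OF assms, of j] assms by metis
    then show "h j * of_bool (block j x) = h j * indicator {k} j" by (simp add: indicator_def)
  qed
  also have "\<dots> = h k" by (subst nn_integral_indicator_singleton) auto
  finally show ?thesis .
qed

lemma sum_block_le: "(\<integral>\<^sup>+j. h * of_bool (block j x) \<partial>zint) \<le> h"
proof (cases "\<exists>k. block k x")
  case True
  then show ?thesis using sum_block[of _ x "\<lambda>_. h"] by auto
qed simp

lemma sum_shift: "(\<integral>\<^sup>+j. h (j + k) \<partial>zint) = (\<integral>\<^sup>+j. h j \<partial>zint)"
  by (rule nn_integral_bij_count_space, rule bij_betwI[where g = "\<lambda>j. j - k"]) auto

text \<open>The tail of \<open>f\<close> at the point where \<open>W\<close> passes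
  \<open>dy k\<close>, written without naming that point.\<close>

definition level_mass :: "(real \<Rightarrow> ennreal) \<Rightarrow> (real \<Rightarrow> ennreal) \<Rightarrow> int \<Rightarrow> ennreal" where
  "level_mass w f k = (\<integral>\<^sup>+s. f s * of_bool (dy k < prim w s) \<partial>hl)"

text \<open>The tail of \<open>f\<close> on block \<open>k\<close> dominates the mass of
  \<open>f\<close> beyond \<open>dy (k + 1)\<close>, and block \<open>k\<close> has
  \<open>w\<close>-mass at least \<open>dy k\<close> as soon as \<open>W\<close> exceeds
  \<open>dy (k + 1)\<close> somewhere; if it never does, the level mass is 0. The shift by one level
  costs the factor 2.\<close>

lemma sum_level_mass_le:
  assumes w: "regular w" and [measurable]: "f \<in> borel_measurable hl" and p: "p > 0"
  shows "(\<integral>\<^sup>+k. dy k * level_mass w f k epowr p \<partial>zint) \<le> 2 * (\<integral>\<^sup>+t. tail f t epowr p * w t \<partial>hl)"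
proof -
  have [measurable]: "w \<in> borel_measurable hl" using w by (simp add: regular_def)
  have *: "dy k * level_mass w f (k + 1) epowr p \<le> (\<integral>\<^sup>+t. tail f t epowr p * w t * of_bool (block k (prim w t)) \<partial>hl)" for k
  proof (cases "\<exists>t>0. dy (k + 1) < prim w t")
    case False
    then have "level_mass w f (k + 1) = (\<integral>\<^sup>+s. 0 \<partial>hl)"
      unfolding level_mass_def by (intro nn_integral_cong) (auto simp: space_hl)
    then show ?thesis using p by (simp add: zero_epowr)
  next
    case True
    then obtain t where t: "0 < t" "2 * dy k \<le> prim w t" by (auto simp: dy_Suc)
    have "dy k \<le> (\<integral>\<^sup>+t. w t * of_bool (block k (prim w t)) \<partial>hl)"
      using regular_mass_between[OF w t(2,1)] by (simp add: block_def dy_Suc)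
    then have "dy k * level_mass w f (k + 1) epowr p
      \<le> (\<integral>\<^sup>+t. w t * of_bool (block k (prim w t)) \<partial>hl) * level_mass w f (k + 1) epowr p"
      by (rule mult_right_mono) simp
    also have "\<dots> = (\<integral>\<^sup>+t. level_mass w f (k + 1) epowr p * (w t * of_bool (block k (prim w t))) \<partial>hl)"
      by (simp add: nn_integral_cmult mult.commute)
    also have "\<dots> \<le> (\<integral>\<^sup>+t. tail f t epowr p * w t * of_bool (block k (prim w t)) \<partial>hl)"
    proof (rule nn_integral_mono)
      fix t
      have "level_mass w f (k + 1) epowr p \<le> tail f t epowr p" if "block k (prim w t)"
      proof -
        have "t < s" if "dy (k + 1) < prim w s" for s
          using \<open>block k (prim w t)\<close> that unfolding block_def by (meson le_less_trans prim_less_imp_less)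
        then show ?thesis
          unfolding level_mass_def tail_def using p
          by (intro epowr_mono nn_integral_mono mult_left_mono) (auto simp: of_bool_def)
      qed
      then show "level_mass w f (k + 1) epowr p * (w t * of_bool (block k (prim w t)))
          \<le> tail f t epowr p * w t * of_bool (block k (prim w t))"
        by (auto simp: of_bool_def intro!: mult_right_mono)
    qed
    finally show ?thesis .
  qed
  have "(\<integral>\<^sup>+k. dy k * level_mass w f k epowr p \<partial>zint) = (\<integral>\<^sup>+k. 2 * (dy k * level_mass w f (k + 1) epowr p) \<partial>zint)"
    by (subst sum_shift[symmetric, of _ 1]) (simp add: dy_Suc mult.assoc)
  also have "\<dots> \<le> 2 * (\<integral>\<^sup>+k. (\<integral>\<^sup>+t. tail f t epowr p * w t * of_bool (block k (prim w t)) \<partial>hl) \<partial>zint)"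
    by (subst nn_integral_cmult) (auto intro!: mult_left_mono nn_integral_mono *)
  also have "(\<integral>\<^sup>+k. (\<integral>\<^sup>+t. tail f t epowr p * w t * of_bool (block k (prim w t)) \<partial>hl) \<partial>zint)
    = (\<integral>\<^sup>+t. (\<integral>\<^sup>+k. tail f t epowr p * w t * of_bool (block k (prim w t)) \<partial>zint) \<partial>hl)"
    by (rule nn_integral_count_space_nn_integral[symmetric]) auto
  also have "\<dots> \<le> (\<integral>\<^sup>+t. tail f t epowr p * w t \<partial>hl)"
    by (intro nn_integral_mono sum_block_le)
  finally show ?thesis by (simp add: mult_left_mono)
qed

subsection \<open>Sufficiency\<close>

text \<open>If \<open>W t\<close> lies in block \<open>k\<close>, the condition
  \<open>W t \<le> 2 * W s\<close> confines \<open>s\<close> to \<open>W s > dy (k - 1)\<close>. So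
  the inequality with \<open>\<integral> f\<close> applies to \<open>fk\<close> and
  \<open>uk\<close>, and \<open>\<integral> fk\<close> is a level mass. The hypothesis on
  \<open>c\<close> is the conclusion of \<open>iterated_inequality_L1\<close>, passed on with its
  constant.\<close>

lemma local_part_le:
  fixes p q r :: real
  assumes w: "regular w" and [measurable]: "f \<in> borel_measurable hl" "om \<in> borel_measurable hl" "u \<in> borel_measurable hl"
    and f0: "AE s in hl. prim w s = top \<longrightarrow> f s = 0"
    and rq: "0 < r" "r \<le> q" "q < p" "p < 1"
    and c: "\<And>f om u. f \<in> borel_measurable hl \<Longrightarrow> om \<in> borel_measurable hl \<Longrightarrow> u \<in> borel_measurable hl \<Longrightarrow>
      (\<integral>\<^sup>+t. prim (\<lambda>s. f s epowr r * om s epowr (1 - r)) t epowr (q / r) * u t \<partial>hl)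
      \<le> ennreal c * (\<integral>\<^sup>+s. f s \<partial>hl) epowr q *
        (\<integral>\<^sup>+t. tail u t epowr (q / (1 - q)) * u t * prim om t epowr (q * (1 - r) / (r * (1 - q))) \<partial>hl) epowr (1 - q)"
  defines "BB \<equiv> \<lambda>k. \<integral>\<^sup>+t. tail u t epowr (q / (1 - q)) * u t * prim om t epowr (q * (1 - r) / (r * (1 - q))) * of_bool (block k (prim w t)) \<partial>hl"
  shows "(\<integral>\<^sup>+t. (\<integral>\<^sup>+s. f s epowr r * om s epowr (1 - r) * of_bool (s < t \<and> prim w t \<le> 2 * prim w s) \<partial>hl) epowr (q / r) * u t \<partial>hl)
    \<le> ennreal c * ((4 * (\<integral>\<^sup>+t. tail f t epowr p * w t \<partial>hl)) epowr (q / p) *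
      (\<integral>\<^sup>+k. dy k epowr (- (q / (p - q))) * BB k epowr (p * (1 - q) / (p - q)) \<partial>zint) epowr (1 - q / p))"
proof -
  have [measurable]: "w \<in> borel_measurable hl" using w by (simp add: regular_def)
  define fk where "fk k s = f s * of_bool (dy (k - 1) < prim w s)" for k s
  define uk where "uk k t = u t * of_bool (block k (prim w t))" for k t
  have [measurable]: "fk k \<in> borel_measurable hl" "uk k \<in> borel_measurable hl" for k
    unfolding fk_def[abs_def] uk_def[abs_def] by measurable
  let ?h = "\<lambda>s. f s epowr r * om s epowr (1 - r)"
  let ?L = "\<lambda>t. \<integral>\<^sup>+s. ?h s * of_bool (s < t \<and> prim w t \<le> 2 * prim w s) \<partial>hl"
  let ?b = "q / (p - q)" and ?g = "p * (1 - q) / (p - q)"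
  \<comment> \<open>The product \<open>dy k^(q/p) * dy k^(-q/p) = 1\<close> is inserted so that the
    first Hoelder factor becomes the discrete right-hand side.\<close>
  have eq: "level_mass w f (k - 1) epowr q * BB k epowr (1 - q) = (dy k * level_mass w f (k - 1) epowr p) epowr (q / p) *
      (dy k epowr (- ?b) * BB k epowr ?g) epowr (1 - q / p)" for k
  proof -
    have 1: "- ?b * (1 - q / p) = - (q / p)" "?g * (1 - q / p) = 1 - q" using rq by (auto simp: field_simps)
    have A: "(dy k * level_mass w f (k - 1) epowr p) epowr (q / p) = dy k epowr (q / p) * level_mass w f (k - 1) epowr q"
      using rq by (simp add: epowr_mult epowr_epowr)
    have B: "(dy k epowr (- ?b) * BB k epowr ?g) epowr (1 - q / p) = dy k epowr (- (q / p)) * BB k epowr (1 - q)"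
      using rq by (subst epowr_mult, simp) (simp only: epowr_epowr 1)
    have "dy k epowr (q / p) * dy k epowr (- (q / p)) = 1"
      using epowr_add_fin[of "dy k" "q / p" "- (q / p)"] by simp
    then have "level_mass w f (k - 1) epowr q * BB k epowr (1 - q)
      = (dy k epowr (q / p) * dy k epowr (- (q / p))) * (level_mass w f (k - 1) epowr q * BB k epowr (1 - q))" by simp
    also have "\<dots> = (dy k * level_mass w f (k - 1) epowr p) epowr (q / p) *
      (dy k epowr (- ?b) * BB k epowr ?g) epowr (1 - q / p)"
      unfolding A B by (simp add: ac_simps)
    finally show ?thesis .
  qed
  have "(\<integral>\<^sup>+t. ?L t epowr (q / r) * u t \<partial>hl)
    \<le> (\<integral>\<^sup>+t. (\<integral>\<^sup>+k. prim (\<lambda>s. fk k s epowr r * om s epowr (1 - r)) t epowr (q / r) * uk k t \<partial>zint) \<partial>hl)"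
  proof (rule nn_integral_mono)
    fix t assume "t \<in> space hl"
    then have t: "t > 0" by (simp add: space_hl)
    show "?L t epowr (q / r) * u t \<le> (\<integral>\<^sup>+k. prim (\<lambda>s. fk k s epowr r * om s epowr (1 - r)) t epowr (q / r) * uk k t \<partial>zint)"
    proof (cases "prim w t = top")
      case True
      have "?L t = (\<integral>\<^sup>+s. 0 \<partial>hl)"
      proof (rule nn_integral_cong_AE)
        show "AE s in hl. ?h s * of_bool (s < t \<and> prim w t \<le> 2 * prim w s) = 0"
          using f0
        proof eventually_elim
          case (elim s)
          have "f s = 0" if "prim w t \<le> 2 * prim w s"
            using elim that True by (auto simp: top_unique ennreal_mult_eq_top_iff)
          then show ?case using rq by (auto simp: of_bool_def zero_epowr)
        qed
      qed
      then show ?thesis using rq by (simp add: zero_epowr)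
    next
      case False
      then obtain k where k: "block k (prim w t)" using w t block_ex[of "prim w t"] by (auto simp: regular_def less_top)
      have "?L t \<le> prim (\<lambda>s. fk k s epowr r * om s epowr (1 - r)) t"
        unfolding prim_def[of "\<lambda>s. fk k s epowr r * om s epowr (1 - r)"]
      proof (intro nn_integral_mono)
        fix s
        have "dy (k - 1) < prim w s" if "prim w t \<le> 2 * prim w s"
        proof -
          have "2 * dy (k - 1) < prim w t" using k dy_Suc[of "k - 1"] by (simp add: block_def)
          then have "2 * dy (k - 1) < 2 * prim w s" using that by (rule less_le_trans)
          then show ?thesis by (meson mult_left_mono not_le zero_le)
        qed
        then show "?h s * of_bool (s < t \<and> prim w t \<le> 2 * prim w s) \<le> fk k s epowr r * om s epowr (1 - r) * of_bool (s < t)"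
          by (auto simp: of_bool_def fk_def)
      qed
      then have "?L t epowr (q / r) * u t \<le> prim (\<lambda>s. fk k s epowr r * om s epowr (1 - r)) t epowr (q / r) * u t"
        using rq by (intro mult_right_mono epowr_mono) auto
      also have "\<dots> = (\<integral>\<^sup>+k. prim (\<lambda>s. fk k s epowr r * om s epowr (1 - r)) t epowr (q / r) * uk k t \<partial>zint)"
        using sum_block[OF k, of "\<lambda>k. prim (\<lambda>s. fk k s epowr r * om s epowr (1 - r)) t epowr (q / r) * u t"]
        by (simp add: uk_def mult.assoc)
      finally show ?thesis .
    qed
  qed
  also have "\<dots> = (\<integral>\<^sup>+k. (\<integral>\<^sup>+t. prim (\<lambda>s. fk k s epowr r * om s epowr (1 - r)) t epowr (q / r) * uk k t \<partial>hl) \<partial>zint)"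
    by (rule nn_integral_count_space_nn_integral) auto
  also have "\<dots> \<le> (\<integral>\<^sup>+k. ennreal c * (level_mass w f (k - 1) epowr q * BB k epowr (1 - q)) \<partial>zint)"
  proof (rule nn_integral_mono)
    fix k
    have "(\<integral>\<^sup>+t. prim (\<lambda>s. fk k s epowr r * om s epowr (1 - r)) t epowr (q / r) * uk k t \<partial>hl)
      \<le> ennreal c * (\<integral>\<^sup>+s. fk k s \<partial>hl) epowr q *
        (\<integral>\<^sup>+t. tail (uk k) t epowr (q / (1 - q)) * uk k t * prim om t epowr (q * (1 - r) / (r * (1 - q))) \<partial>hl) epowr (1 - q)"
      by (rule c) auto
    also have "\<dots> \<le> ennreal c * level_mass w f (k - 1) epowr q * BB k epowr (1 - q)"
    proof (intro mult_mono order_refl epowr_mono)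
      show "(\<integral>\<^sup>+t. tail (uk k) t epowr (q / (1 - q)) * uk k t * prim om t epowr (q * (1 - r) / (r * (1 - q))) \<partial>hl) \<le> BB k"
        unfolding BB_def
      proof (rule nn_integral_mono)
        fix t
        have "tail (uk k) t epowr (q / (1 - q)) \<le> tail u t epowr (q / (1 - q))"
          using rq by (intro epowr_mono tail_mono_fun) (auto simp: uk_def of_bool_def)
        then have "tail (uk k) t epowr (q / (1 - q)) * (uk k t * prim om t epowr (q * (1 - r) / (r * (1 - q))))
          \<le> tail u t epowr (q / (1 - q)) * (uk k t * prim om t epowr (q * (1 - r) / (r * (1 - q))))"
          by (rule mult_right_mono) simp
        then show "tail (uk k) t epowr (q / (1 - q)) * uk k t * prim om t epowr (q * (1 - r) / (r * (1 - q)))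
          \<le> tail u t epowr (q / (1 - q)) * u t * prim om t epowr (q * (1 - r) / (r * (1 - q))) * of_bool (block k (prim w t))"
          by (simp add: uk_def ac_simps)
      qed
    qed (use rq in \<open>auto simp: fk_def level_mass_def\<close>)
    finally show "(\<integral>\<^sup>+t. prim (\<lambda>s. fk k s epowr r * om s epowr (1 - r)) t epowr (q / r) * uk k t \<partial>hl)
      \<le> ennreal c * (level_mass w f (k - 1) epowr q * BB k epowr (1 - q))" by (simp add: mult.assoc)
  qed
  also have "\<dots> = ennreal c * (\<integral>\<^sup>+k. (dy k * level_mass w f (k - 1) epowr p) epowr (q / p) *
      (dy k epowr (- ?b) * BB k epowr ?g) epowr (1 - q / p) \<partial>zint)"
    unfolding eq by (simp add: nn_integral_cmult)
  also have "\<dots> \<le> ennreal c * ((\<integral>\<^sup>+k. dy k * level_mass w f (k - 1) epowr p \<partial>zint) epowr (q / p) *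
     (\<integral>\<^sup>+k. dy k epowr (- ?b) * BB k epowr ?g \<partial>zint) epowr (1 - q / p))"
    using rq by (intro mult_left_mono nn_integral_Hoelder) auto
  also have "\<dots> \<le> ennreal c * ((4 * (\<integral>\<^sup>+t. tail f t epowr p * w t \<partial>hl)) epowr (q / p) *
     (\<integral>\<^sup>+k. dy k epowr (- ?b) * BB k epowr ?g \<partial>zint) epowr (1 - q / p))"
  proof (intro mult_left_mono mult_right_mono epowr_mono)
    \<comment> \<open>One factor 2 comes from the shift of the index, the other from
      \<open>sum_level_mass_le\<close>.\<close>
    have "(\<integral>\<^sup>+k. dy k * level_mass w f (k - 1) epowr p \<partial>zint) = 2 * (\<integral>\<^sup>+k. dy k * level_mass w f k epowr p \<partial>zint)"
      by (subst sum_shift[symmetric, of _ 1]) (simp add: dy_Suc mult.assoc nn_integral_cmult)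
    also have "\<dots> \<le> 2 * (2 * (\<integral>\<^sup>+t. tail f t epowr p * w t \<partial>hl))"
      using w rq by (intro mult_left_mono sum_level_mass_le) auto
    finally show "(\<integral>\<^sup>+k. dy k * level_mass w f (k - 1) epowr p \<partial>zint) \<le> 4 * (\<integral>\<^sup>+t. tail f t epowr p * w t \<partial>hl)"
      by (simp add: mult.assoc[symmetric])
  qed (use rq in auto)
  finally show ?thesis .
qed

text \<open>If \<open>W\<close> passes \<open>dy (k + 2)\<close>, block \<open>k + 1\<close> has
  \<open>w\<close>-mass at least \<open>dy (k + 1)\<close>, and there \<open>prim h\<close>
  dominates the \<open>h\<close>-mass of block \<open>k\<close>; so the integral sees the term. The
  remaining \<open>k\<close> satisfy \<open>\<integral> w \<le> dy (k + 2)\<close>, and their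
  weights form a geometric series of size \<open>(\<integral> w)^(-b)\<close>, which gives the
  second term.\<close>

lemma sum_block_mass_le:
  assumes w: "regular w" and [measurable]: "h \<in> borel_measurable hl" and b: "b > 0" and g: "g > 0"
  shows "(\<integral>\<^sup>+k. dy k epowr (- b) * (\<integral>\<^sup>+t. h t * of_bool (block k (prim w t)) \<partial>hl) epowr g \<partial>zint)
    \<le> ennreal (2 powr (2 * b + 1) + 2 powr b * geo b) *
      ((\<integral>\<^sup>+x. prim w x epowr (- (b + 1)) * w x * prim h x epowr g \<partial>hl) + (\<integral>\<^sup>+x. w x \<partial>hl) epowr (- b) * (\<integral>\<^sup>+x. h x \<partial>hl) epowr g)"
    (is "(\<integral>\<^sup>+k. dy k epowr (- b) * ?B k epowr g \<partial>zint) \<le> _ * (?D + ?M epowr (- b) * ?H)")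
proof -
  have [measurable]: "w \<in> borel_measurable hl" using w by (simp add: regular_def)
  let ?d = "\<lambda>x. prim w x epowr (- (b + 1)) * w x * prim h x epowr g"
  have *: "dy k epowr (- b) * ?B k epowr g \<le> ennreal (2 powr (2 * b + 1)) * (\<integral>\<^sup>+x. ?d x * of_bool (block (k + 1) (prim w x)) \<partial>hl)
      + ?H * (dy k epowr (- b) * of_bool (?M \<le> dy (k + 2)))" for k
  proof (cases "?M \<le> dy (k + 2)")
    case True
    have "dy k epowr (- b) * ?B k epowr g \<le> dy k epowr (- b) * ?H"
      using g by (intro mult_left_mono epowr_mono nn_integral_mono) (auto simp: of_bool_def)
    then show ?thesis using True by (auto intro: order_trans simp: mult.commute)
  next
    case False
    have "(\<integral>\<^sup>+x. w x \<partial>hl) \<le> (\<integral>\<^sup>+x. w x * of_bool (\<exists>n. x < real n) \<partial>hl)"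
      by (intro nn_integral_mono) (auto simp: of_bool_def reals_Archimedean2)
    also have "\<dots> = (SUP n. \<integral>\<^sup>+x. w x * of_bool (x < real n) \<partial>hl)"
      by (rule nn_integral_SUP_of_bool) auto
    finally have "dy (k + 2) < (SUP n. prim w (real n))" using False by (simp add: prim_def not_le)
    then obtain n where n: "dy (k + 2) < prim w (real n)" by (auto simp: less_SUP_iff)
    have "dy (k + 2) = 2 * dy (k + 1)" using dy_Suc[of "k + 1"] by (simp add: add.assoc)
    then have n': "2 * dy (k + 1) \<le> prim w (real n)" using n by simp
    have "real n > 0"
    proof (rule ccontr)
      assume "\<not> real n > 0"
      then have "prim w (real n) = (\<integral>\<^sup>+x. 0 \<partial>hl)"
        unfolding prim_def by (intro nn_integral_cong) (auto simp: space_hl)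
      then show False using n by simp
    qed
    from regular_mass_between[OF w n' this]
    have mass: "dy (k + 1) \<le> (\<integral>\<^sup>+s. w s * of_bool (block (k + 1) (prim w s)) \<partial>hl)"
      using dy_Suc[of "k + 1"] by (simp add: block_def)
    have pw: "dy (k + 2) epowr (- (b + 1)) * dy (k + 1) * ennreal (2 powr (2 * b + 1)) = dy k epowr (- b)"
    proof -
      have "dy (k + 1) = dy (k + 1) epowr 1" by simp
      then show ?thesis
        unfolding dy_epowr by (simp add: dy_epowr ennreal_mult[symmetric] powr_add[symmetric] algebra_simps)
    qed
    have "dy k epowr (- b) * ?B k epowr g
      = ennreal (2 powr (2 * b + 1)) * (dy (k + 2) epowr (- (b + 1)) * ?B k epowr g * dy (k + 1))"
      unfolding pw[symmetric] by (simp add: ac_simps)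
    also have "\<dots> \<le> ennreal (2 powr (2 * b + 1)) * (dy (k + 2) epowr (- (b + 1)) * ?B k epowr g *
        (\<integral>\<^sup>+s. w s * of_bool (block (k + 1) (prim w s)) \<partial>hl))"
      by (intro mult_left_mono mass) auto
    also have "\<dots> = ennreal (2 powr (2 * b + 1)) * (\<integral>\<^sup>+s. dy (k + 2) epowr (- (b + 1)) * ?B k epowr g *
        (w s * of_bool (block (k + 1) (prim w s))) \<partial>hl)"
      by (simp add: nn_integral_cmult)
    also have "\<dots> \<le> ennreal (2 powr (2 * b + 1)) * (\<integral>\<^sup>+x. ?d x * of_bool (block (k + 1) (prim w x)) \<partial>hl)"
    proof (intro mult_left_mono nn_integral_mono)
      fix x
      show "dy (k + 2) epowr (- (b + 1)) * ?B k epowr g * (w x * of_bool (block (k + 1) (prim w x)))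
        \<le> ?d x * of_bool (block (k + 1) (prim w x))"
      proof (cases "block (k + 1) (prim w x)")
        case True
        then have x: "dy (k + 1) < prim w x" "prim w x \<le> dy (k + 2)" by (auto simp: block_def add.assoc)
        have lt: "t < x" if "block k (prim w t)" for t
          using that x unfolding block_def by (meson le_less_trans prim_less_imp_less)
        have "?B k \<le> prim h x"
          unfolding prim_def[of h] using lt by (intro nn_integral_mono mult_left_mono) (auto simp: of_bool_def)
        then have "dy (k + 2) epowr (- (b + 1)) * ?B k epowr g \<le> prim w x epowr (- (b + 1)) * prim h x epowr g"
          using x b g by (intro mult_mono epowr_antimono epowr_mono) auto
        then have "dy (k + 2) epowr (- (b + 1)) * ?B k epowr g * w x \<le> prim w x epowr (- (b + 1)) * prim h x epowr g * w x"
          by (rule mult_right_mono) simp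
        then show ?thesis using True by (simp add: ac_simps)
      qed simp
    qed simp
    finally show ?thesis using False by simp
  qed
  have "(\<integral>\<^sup>+k. dy k epowr (- b) * ?B k epowr g \<partial>zint)
    \<le> (\<integral>\<^sup>+k. ennreal (2 powr (2 * b + 1)) * (\<integral>\<^sup>+x. ?d x * of_bool (block (k + 1) (prim w x)) \<partial>hl)
      + ?H * (dy k epowr (- b) * of_bool (?M \<le> dy (k + 2))) \<partial>zint)"
    by (intro nn_integral_mono *)
  also have "\<dots> = ennreal (2 powr (2 * b + 1)) * (\<integral>\<^sup>+k. (\<integral>\<^sup>+x. ?d x * of_bool (block (k + 1) (prim w x)) \<partial>hl) \<partial>zint)
      + ?H * (\<integral>\<^sup>+k. dy k epowr (- b) * of_bool (?M \<le> dy (k + 2)) \<partial>zint)"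
    by (simp add: nn_integral_add nn_integral_cmult)
  also have "\<dots> \<le> ennreal (2 powr (2 * b + 1)) * ?D + ?H * (ennreal (2 powr b * geo b) * ?M epowr (- b))"
  proof (intro add_mono mult_left_mono)
    have "(\<integral>\<^sup>+k. (\<integral>\<^sup>+x. ?d x * of_bool (block (k + 1) (prim w x)) \<partial>hl) \<partial>zint)
      = (\<integral>\<^sup>+k. (\<integral>\<^sup>+x. ?d x * of_bool (block k (prim w x)) \<partial>hl) \<partial>zint)"
      by (rule sum_shift[of "\<lambda>k. \<integral>\<^sup>+x. ?d x * of_bool (block k (prim w x)) \<partial>hl" 1])
    also have "\<dots> = (\<integral>\<^sup>+x. (\<integral>\<^sup>+k. ?d x * of_bool (block k (prim w x)) \<partial>zint) \<partial>hl)"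
      by (rule nn_integral_count_space_nn_integral[symmetric]) auto
    also have "\<dots> \<le> ?D" by (intro nn_integral_mono sum_block_le)
    finally show "(\<integral>\<^sup>+k. (\<integral>\<^sup>+x. ?d x * of_bool (block (k + 1) (prim w x)) \<partial>hl) \<partial>zint) \<le> ?D" .
    have "(\<integral>\<^sup>+k. dy k epowr (- b) * of_bool (?M \<le> dy (k + 2)) \<partial>zint)
      = (\<integral>\<^sup>+k. dy (k - 1) epowr (- b) * of_bool (?M \<le> dy (k + 1)) \<partial>zint)"
      by (subst sum_shift[symmetric, of _ 1]) (simp add: add.assoc)
    also have "\<dots> = (\<integral>\<^sup>+k. ennreal (2 powr b) * (dy k epowr (- b) * of_bool (?M \<le> dy (k + 1))) \<partial>zint)"
    proof (intro nn_integral_cong)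
      fix k
      have "dy (k - 1) epowr (- b) = ennreal (2 powr b) * dy k epowr (- b)"
        by (simp add: dy_epowr ennreal_mult[symmetric] powr_add[symmetric] algebra_simps)
      then show "dy (k - 1) epowr (- b) * of_bool (?M \<le> dy (k + 1))
        = ennreal (2 powr b) * (dy k epowr (- b) * of_bool (?M \<le> dy (k + 1)))" by (simp add: mult.assoc)
    qed
    also have "\<dots> \<le> ennreal (2 powr b) * (ennreal (geo b) * ?M epowr (- b))"
      by (simp add: nn_integral_cmult) (intro mult_left_mono dy_sum_ge b, simp)
    finally show "(\<integral>\<^sup>+k. dy k epowr (- b) * of_bool (?M \<le> dy (k + 2)) \<partial>zint) \<le> ennreal (2 powr b * geo b) * ?M epowr (- b)"
      using geo_pos[OF b] by (simp add: ennreal_mult mult.assoc)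
  qed auto
  also have "\<dots> \<le> ennreal (2 powr (2 * b + 1) + 2 powr b * geo b) * (?D + ?M epowr (- b) * ?H)"
  proof -
    have "ennreal (2 powr (2 * b + 1)) \<le> ennreal (2 powr (2 * b + 1) + 2 powr b * geo b)"
      "ennreal (2 powr b * geo b) \<le> ennreal (2 powr (2 * b + 1) + 2 powr b * geo b)"
      using geo_pos[OF b] by (auto intro!: ennreal_leI)
    moreover have "?H * (ennreal (2 powr b * geo b) * ?M epowr (- b)) = ennreal (2 powr b * geo b) * (?M epowr (- b) * ?H)"
      by (simp only: ac_simps)
    ultimately show ?thesis
      unfolding distrib_left by (simp only:) (intro add_mono mult_right_mono; simp)
  qed
  finally show ?thesis .
qed

text \<open>The points \<open>y\<close> with \<open>W s < W y \<le> 2 * W s\<close> lie between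
  \<open>s\<close> and \<open>t\<close> and carry \<open>w\<close>-mass at least \<open>W s\<close>,
  so averaging over them with density \<open>w/W\<close> loses only a factor 2. After Fubini's
  theorem and Hoelder's inequality in \<open>s\<close>, the integrand in \<open>y\<close> has the
  form \<open>phi^(r/p) * ?om^(1 - r/p)\<close>, to which the inequality with
  \<open>\<integral> phi\<close> on the right applies; \<open>\<integral> phi\<close> is at most a
  multiple of the original right-hand side.\<close>

lemma global_part_le:
  fixes p q r :: real
  assumes w: "regular w" and [measurable]: "f \<in> borel_measurable hl" "om \<in> borel_measurable hl" "u \<in> borel_measurable hl"
    and f0: "AE s in hl. prim w s = top \<longrightarrow> f s = 0"
    and rq: "0 < r" "r \<le> q" "q < p" "p < 1"
    and c: "\<And>f om u. f \<in> borel_measurable hl \<Longrightarrow> om \<in> borel_measurable hl \<Longrightarrow> u \<in> borel_measurable hl \<Longrightarrow>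
      (\<integral>\<^sup>+t. prim (\<lambda>s. f s epowr (r / p) * om s epowr (1 - r / p)) t epowr (q / r) * u t \<partial>hl)
      \<le> ennreal c * (\<integral>\<^sup>+s. f s \<partial>hl) epowr (q / p) *
        (\<integral>\<^sup>+t. tail u t epowr (q / (p - q)) * u t * prim om t epowr (q * (p - r) / (r * (p - q))) \<partial>hl) epowr (1 - q / p)"
  shows "(\<integral>\<^sup>+t. (\<integral>\<^sup>+s. f s epowr r * om s epowr (1 - r) * of_bool (s < t \<and> 2 * prim w s < prim w t) \<partial>hl) epowr (q / r) * u t \<partial>hl)
    \<le> 2 epowr (q / r) * (ennreal c * (8 * (\<integral>\<^sup>+t. tail f t epowr p * w t \<partial>hl)) epowr (q / p) *
      (\<integral>\<^sup>+t. tail u t epowr (q / (p - q)) * u t * prim (\<lambda>s. prim w s epowr (- (p / (p - r))) * w s *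
        prim om s epowr (p * (1 - r) / (p - r))) t epowr (q * (p - r) / (r * (p - q))) \<partial>hl) epowr (1 - q / p))"
proof -
  have [measurable]: "w \<in> borel_measurable hl" using w by (simp add: regular_def)
  let ?h = "\<lambda>s. f s epowr r * om s epowr (1 - r)"
  let ?W = "prim w"
  let ?om = "\<lambda>s. ?W s epowr (- (p / (p - r))) * w s * prim om s epowr (p * (1 - r) / (p - r))"
  let ?G = "\<lambda>t. \<integral>\<^sup>+s. ?h s * of_bool (s < t \<and> 2 * ?W s < ?W t) \<partial>hl"
  \<comment> \<open>The mass of \<open>f\<close> that can contribute at \<open>y\<close>; if
    \<open>W y\<close> is in block \<open>k\<close>, it is at most the level mass at
    \<open>k - 1\<close>.\<close>
  define F where "F y = (\<integral>\<^sup>+s. f s * of_bool (?W y \<le> 2 * ?W s) \<partial>hl)" for y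
  have [measurable]: "F \<in> borel_measurable hl" unfolding F_def[abs_def] by measurable
  define phi where "phi y = F y epowr p * w y" for y
  have [measurable]: "phi \<in> borel_measurable hl" unfolding phi_def[abs_def] by measurable
  have wpos: "0 < ?W y" if "y > 0" for y using w that by (simp add: regular_def)
  \<comment> \<open>The exponents in \<open>?om\<close> are those that become \<open>-1\<close> and
    \<open>1 - r\<close> under the power \<open>1 - r/p\<close>.\<close>
  have e: "p / (p - r) * (1 - r / p) = 1" "p * (1 - r) / (p - r) * (1 - r / p) = 1 - r" "p * (r / p) = r"
    using rq by (auto simp: field_simps)
  have 1: "?G t \<le> 2 * prim (\<lambda>s. phi s epowr (r / p) * ?om s epowr (1 - r / p)) t" if t: "0 < t" for t
  proof -
    have "?G t \<le> (\<integral>\<^sup>+s. (\<integral>\<^sup>+y. 2 * (?W y epowr (- 1) * w y * of_bool (y < t) *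
        (?h s * of_bool (s < y \<and> ?W y \<le> 2 * ?W s))) \<partial>hl) \<partial>hl)"
    proof (rule nn_integral_mono)
      fix s assume "s \<in> space hl"
      then have s: "0 < s" by (simp add: space_hl)
      show "?h s * of_bool (s < t \<and> 2 * ?W s < ?W t) \<le> (\<integral>\<^sup>+y. 2 * (?W y epowr (- 1) * w y * of_bool (y < t) *
        (?h s * of_bool (s < y \<and> ?W y \<le> 2 * ?W s))) \<partial>hl)"
      proof (cases "s < t \<and> 2 * ?W s < ?W t")
        case True
        then have "2 * ?W s < top" using less_le_trans[of "2 * ?W s" "?W t" top] by auto
        then have fin: "?W s < top" by (rule le_less_trans[rotated]) (simp add: mult_2)
        have "?W s * (2 * ?W s) epowr (- 1) * 2 = (2 * ?W s) epowr (1 + - 1)"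
          using wpos[OF s] fin by (subst epowr_add_fin) (auto simp: ennreal_zero_less_mult_iff ennreal_mult_less_top ac_simps)
        then have "?h s = ?W s * ((2 * ?W s) epowr (- 1) * 2 * ?h s)" by (simp add: mult.assoc[symmetric])
        also have "\<dots> \<le> (\<integral>\<^sup>+y. w y * of_bool (?W s < ?W y \<and> ?W y \<le> 2 * ?W s) \<partial>hl) * ((2 * ?W s) epowr (- 1) * 2 * ?h s)"
          using regular_mass_between[OF w _ t fin] True by (intro mult_right_mono) auto
        also have "\<dots> = (\<integral>\<^sup>+y. w y * of_bool (?W s < ?W y \<and> ?W y \<le> 2 * ?W s) * ((2 * ?W s) epowr (- 1) * 2 * ?h s) \<partial>hl)"
          by (simp add: nn_integral_multc)
        also have "\<dots> \<le> (\<integral>\<^sup>+y. 2 * (?W y epowr (- 1) * w y * of_bool (y < t) *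
          (?h s * of_bool (s < y \<and> ?W y \<le> 2 * ?W s))) \<partial>hl)"
        proof (rule nn_integral_mono)
          fix y
          show "w y * of_bool (?W s < ?W y \<and> ?W y \<le> 2 * ?W s) * ((2 * ?W s) epowr (- 1) * 2 * ?h s)
            \<le> 2 * (?W y epowr (- 1) * w y * of_bool (y < t) * (?h s * of_bool (s < y \<and> ?W y \<le> 2 * ?W s)))"
          proof (cases "?W s < ?W y \<and> ?W y \<le> 2 * ?W s")
            case c: True
            then have "s < y" "y < t"
              using True by (auto intro: prim_less_imp_less le_less_trans)
            moreover have "(2 * ?W s) epowr (- 1) \<le> ?W y epowr (- 1)"
              using c by (intro epowr_antimono) auto
            then have "(2 * ?W s) epowr (- 1) * (w y * 2 * ?h s) \<le> ?W y epowr (- 1) * (w y * 2 * ?h s)"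
              by (rule mult_right_mono) simp
            ultimately show ?thesis using c by (simp add: ac_simps)
          next
            case False
            then have "of_bool (?W s < ?W y \<and> ?W y \<le> 2 * ?W s) = (0::ennreal)" by (simp only: of_bool_eq_0_iff simp_thms)
            then show ?thesis by (simp only: mult_zero_left mult_zero_right zero_le)
          qed
        qed
        finally show ?thesis using True by simp
      next
        case False
        then have "of_bool (s < t \<and> 2 * ?W s < ?W t) = (0::ennreal)" by (simp only: of_bool_eq_0_iff simp_thms)
        then show ?thesis by (simp only: mult_zero_right zero_le)
      qed
    qed
    also have "\<dots> = (\<integral>\<^sup>+y. (\<integral>\<^sup>+s. 2 * (?W y epowr (- 1) * w y * of_bool (y < t) *
        (?h s * of_bool (s < y \<and> ?W y \<le> 2 * ?W s))) \<partial>hl) \<partial>hl)"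
      by (rule hl2.Fubini'[symmetric]) measurable
    also have "\<dots> = (\<integral>\<^sup>+y. 2 * (?W y epowr (- 1) * w y * of_bool (y < t) *
        (\<integral>\<^sup>+s. ?h s * of_bool (s < y \<and> ?W y \<le> 2 * ?W s) \<partial>hl)) \<partial>hl)"
      by (simp add: nn_integral_cmult)
    also have "\<dots> \<le> (\<integral>\<^sup>+y. 2 * (phi y epowr (r / p) * ?om y epowr (1 - r / p) * of_bool (y < t)) \<partial>hl)"
    proof (rule nn_integral_mono)
      fix y
      have "(\<integral>\<^sup>+s. ?h s * of_bool (s < y \<and> ?W y \<le> 2 * ?W s) \<partial>hl)
        \<le> (\<integral>\<^sup>+s. (f s * of_bool (?W y \<le> 2 * ?W s)) epowr r * (om s * of_bool (s < y)) epowr (1 - r) \<partial>hl)"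
        by (intro nn_integral_mono) (auto simp: of_bool_def)
      also have "\<dots> \<le> F y epowr r * prim om y epowr (1 - r)"
        unfolding F_def prim_def[of om] using rq by (intro nn_integral_Hoelder) auto
      finally have "?W y epowr (- 1) * w y * (\<integral>\<^sup>+s. ?h s * of_bool (s < y \<and> ?W y \<le> 2 * ?W s) \<partial>hl)
        \<le> ?W y epowr (- 1) * w y * (F y epowr r * prim om y epowr (1 - r))" by (rule mult_left_mono) simp
      also have "\<dots> = phi y epowr (r / p) * ?om y epowr (1 - r / p)"
      proof -
        have 1: "w y = w y epowr (r / p) * w y epowr (1 - r / p)"
          using epowr_add[of "r / p" "1 - r / p" "w y"] rq by simp
        have 2: "phi y epowr (r / p) = F y epowr r * w y epowr (r / p)"
          unfolding phi_def using rq by (simp add: epowr_mult epowr_epowr)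
        have "- (p / (p - r)) * (1 - r / p) = - 1" by (simp only: mult_minus_left e(1))
        then have 3: "?om y epowr (1 - r / p) = ?W y epowr (- 1) * w y epowr (1 - r / p) * prim om y epowr (1 - r)"
          using rq by (subst epowr_mult, simp, subst epowr_mult, simp) (simp only: epowr_epowr e)
        show ?thesis unfolding 2 3 by (subst (1) 1) (simp only: ac_simps)
      qed
      finally have "2 * of_bool (y < t) * (?W y epowr (- 1) * w y * (\<integral>\<^sup>+s. ?h s * of_bool (s < y \<and> ?W y \<le> 2 * ?W s) \<partial>hl))
        \<le> 2 * of_bool (y < t) * (phi y epowr (r / p) * ?om y epowr (1 - r / p))" by (rule mult_left_mono) simp
      then show "2 * (?W y epowr (- 1) * w y * of_bool (y < t) * (\<integral>\<^sup>+s. ?h s * of_bool (s < y \<and> ?W y \<le> 2 * ?W s) \<partial>hl))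
        \<le> 2 * (phi y epowr (r / p) * ?om y epowr (1 - r / p) * of_bool (y < t))" by (auto simp: of_bool_def)
    qed
    also have "\<dots> = 2 * prim (\<lambda>s. phi s epowr (r / p) * ?om s epowr (1 - r / p)) t"
      unfolding prim_def[of "\<lambda>s. phi s epowr (r / p) * ?om s epowr (1 - r / p)"] by (rule nn_integral_cmult) measurable
    finally show ?thesis .
  qed
  \<comment> \<open>A factor 4 for passing from level \<open>k - 1\<close> to the bound
    \<open>dy (k + 1)\<close> of the block mass, and 2 from
    \<open>sum_level_mass_le\<close>.\<close>
  have phi: "(\<integral>\<^sup>+y. phi y \<partial>hl) \<le> 8 * (\<integral>\<^sup>+t. tail f t epowr p * w t \<partial>hl)"
  proof -
    have "(\<integral>\<^sup>+y. phi y \<partial>hl) \<le> (\<integral>\<^sup>+y. (\<integral>\<^sup>+k. level_mass w f (k - 1) epowr p * (w y * of_bool (block k (?W y))) \<partial>zint) \<partial>hl)"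
    proof (rule nn_integral_mono)
      fix y assume "y \<in> space hl"
      then have y: "0 < y" by (simp add: space_hl)
      show "phi y \<le> (\<integral>\<^sup>+k. level_mass w f (k - 1) epowr p * (w y * of_bool (block k (?W y))) \<partial>zint)"
      proof (cases "?W y = top")
        case True
        have "F y = (\<integral>\<^sup>+s. 0 \<partial>hl)"
          unfolding F_def
        proof (rule nn_integral_cong_AE)
          show "AE s in hl. f s * of_bool (?W y \<le> 2 * ?W s) = 0"
            using f0
          proof eventually_elim
            case (elim s)
            then have "f s = 0" if "?W y \<le> 2 * ?W s" using that True by (auto simp: top_unique ennreal_mult_eq_top_iff)
            then show ?case by (auto simp: of_bool_def)
          qed
        qed
        then show ?thesis using rq by (simp add: phi_def zero_epowr)
      next
        case False
        then obtain k where k: "block k (?W y)" using block_ex[of "?W y"] wpos[OF y] by (auto simp: less_top)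
        have "dy (k - 1) < ?W s" if "?W y \<le> 2 * ?W s" for s
        proof -
          have "2 * dy (k - 1) < ?W y" using k dy_Suc[of "k - 1"] by (simp add: block_def)
          then have "2 * dy (k - 1) < 2 * ?W s" using that by (rule less_le_trans)
          then show ?thesis by (meson mult_left_mono not_le zero_le)
        qed
        then have "F y \<le> level_mass w f (k - 1)"
          unfolding F_def level_mass_def by (intro nn_integral_mono mult_left_mono) (auto simp: of_bool_def)
        then have "phi y \<le> level_mass w f (k - 1) epowr p * w y"
          unfolding phi_def using rq by (intro mult_right_mono epowr_mono) auto
        then show ?thesis using sum_block[OF k, of "\<lambda>k. level_mass w f (k - 1) epowr p * w y"] by (simp add: mult.assoc)
      qed
    qed
    also have "\<dots> = (\<integral>\<^sup>+k. (\<integral>\<^sup>+y. level_mass w f (k - 1) epowr p * (w y * of_bool (block k (?W y))) \<partial>hl) \<partial>zint)"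
      by (rule nn_integral_count_space_nn_integral) auto
    also have "\<dots> \<le> (\<integral>\<^sup>+k. level_mass w f (k - 1) epowr p * dy (k + 1) \<partial>zint)"
    proof (rule nn_integral_mono)
      fix k
      have "(\<integral>\<^sup>+y. w y * of_bool (block k (?W y)) \<partial>hl) \<le> (\<integral>\<^sup>+y. w y * of_bool (?W y \<le> dy (k + 1)) \<partial>hl)"
        by (intro nn_integral_mono mult_left_mono) (auto simp: block_def of_bool_def)
      also have "\<dots> \<le> dy (k + 1)" using accumulates_prim[of w] by (auto simp: accumulates_def)
      finally show "(\<integral>\<^sup>+y. level_mass w f (k - 1) epowr p * (w y * of_bool (block k (?W y))) \<partial>hl)
        \<le> level_mass w f (k - 1) epowr p * dy (k + 1)" by (simp add: nn_integral_cmult mult_left_mono)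
    qed
    also have "\<dots> = (\<integral>\<^sup>+k. 4 * (dy k * level_mass w f k epowr p) \<partial>zint)"
    proof (subst sum_shift[symmetric, of _ 1], intro nn_integral_cong)
      fix k
      have "dy (k + 1 + 1) = 4 * dy k" by (simp only: dy_Suc) (simp add: mult.assoc[symmetric])
      then show "level_mass w f (k + 1 - 1) epowr p * dy (k + 1 + 1) = 4 * (dy k * level_mass w f k epowr p)"
        by (simp add: ac_simps)
    qed
    also have "\<dots> \<le> 4 * (2 * (\<integral>\<^sup>+t. tail f t epowr p * w t \<partial>hl))"
      unfolding nn_integral_cmult[of _ zint, simplified] using w rq by (intro mult_left_mono sum_level_mass_le) auto
    finally show ?thesis by (simp add: mult.assoc[symmetric])
  qed
  have "(\<integral>\<^sup>+t. ?G t epowr (q / r) * u t \<partial>hl)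
    \<le> (\<integral>\<^sup>+t. (2 * prim (\<lambda>s. phi s epowr (r / p) * ?om s epowr (1 - r / p)) t) epowr (q / r) * u t \<partial>hl)"
    using rq 1 by (intro nn_integral_mono mult_right_mono epowr_mono) (auto simp: space_hl)
  also have "\<dots> = 2 epowr (q / r) * (\<integral>\<^sup>+t. prim (\<lambda>s. phi s epowr (r / p) * ?om s epowr (1 - r / p)) t epowr (q / r) * u t \<partial>hl)"
    using rq by (simp add: epowr_mult nn_integral_cmult mult.assoc)
  also have "\<dots> \<le> 2 epowr (q / r) * (ennreal c * (\<integral>\<^sup>+s. phi s \<partial>hl) epowr (q / p) *
        (\<integral>\<^sup>+t. tail u t epowr (q / (p - q)) * u t * prim ?om t epowr (q * (p - r) / (r * (p - q))) \<partial>hl) epowr (1 - q / p))"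
    by (intro mult_left_mono c) auto
  also have "\<dots> \<le> 2 epowr (q / r) * (ennreal c * (8 * (\<integral>\<^sup>+t. tail f t epowr p * w t \<partial>hl)) epowr (q / p) *
        (\<integral>\<^sup>+t. tail u t epowr (q / (p - q)) * u t * prim ?om t epowr (q * (p - r) / (r * (p - q))) \<partial>hl) epowr (1 - q / p))"
    using rq by (intro mult_left_mono mult_right_mono epowr_mono phi) auto
  finally show ?thesis .
qed

text \<open>Stated for \<open>q\<close>-th powers, so that roots are taken only once, at the end.
  Requiring \<open>f\<close> to vanish where \<open>W\<close> is infinite costs nothing: a finite
  right-hand side forces it.\<close>

lemma sufficiency:
  fixes p q r :: real
  assumes rq: "0 < r" "r \<le> q" "q < p" "p < 1"
  obtains C :: real where "0 < C" and
    "\<And>f om u w. regular w \<Longrightarrow> f \<in> borel_measurable hl \<Longrightarrow> om \<in> borel_measurable hl \<Longrightarrow> u \<in> borel_measurable hl \<Longrightarrow>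
      AE s in hl. prim w s = top \<longrightarrow> f s = 0 \<Longrightarrow>
      (\<integral>\<^sup>+t. prim (\<lambda>s. f s epowr r * om s epowr (1 - r)) t epowr (q / r) * u t \<partial>hl)
      \<le> ennreal C * (\<integral>\<^sup>+t. tail f t epowr p * w t \<partial>hl) epowr (q / p) *
        (((\<integral>\<^sup>+x. prim w x epowr (- (q / (p - q) + 1)) * w x *
            prim (\<lambda>t. tail u t epowr (q / (1 - q)) * u t * prim om t epowr (q * (1 - r) / (r * (1 - q)))) x epowr (p * (1 - q) / (p - q)) \<partial>hl)
          + (\<integral>\<^sup>+x. w x \<partial>hl) epowr (- (q / (p - q))) *
            (\<integral>\<^sup>+t. tail u t epowr (q / (1 - q)) * u t * prim om t epowr (q * (1 - r) / (r * (1 - q))) \<partial>hl) epowr (p * (1 - q) / (p - q)))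
            epowr (1 - q / p)
        + (\<integral>\<^sup>+t. tail u t epowr (q / (p - q)) * u t * prim (\<lambda>s. prim w s epowr (- (p / (p - r))) * w s *
            prim om s epowr (p * (1 - r) / (p - r))) t epowr (q * (p - r) / (r * (p - q))) \<partial>hl) epowr (1 - q / p))"
proof -
  obtain c1 :: real where c1: "0 < c1" and L1: "\<And>f om u. f \<in> borel_measurable hl \<Longrightarrow> om \<in> borel_measurable hl \<Longrightarrow> u \<in> borel_measurable hl \<Longrightarrow>
      (\<integral>\<^sup>+t. prim (\<lambda>s. f s epowr r * om s epowr (1 - r)) t epowr (q / r) * u t \<partial>hl)
      \<le> ennreal c1 * (\<integral>\<^sup>+s. f s \<partial>hl) epowr q *
        (\<integral>\<^sup>+t. tail u t epowr (q / (1 - q)) * u t * prim om t epowr (q * (1 - r) / (r * (1 - q))) \<partial>hl) epowr (1 - q)"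
    using iterated_inequality_L1[of r q] rq by auto
  \<comment> \<open>With \<open>r/p\<close> and \<open>q/p\<close> in place of \<open>r\<close> and
    \<open>q\<close>, the exponents of the inequality become those of \<open>C6\<close>.\<close>
  have e: "q / p / (r / p) = q / r" "q / p / (1 - q / p) = q / (p - q)"
    "q / p * (1 - r / p) / (r / p * (1 - q / p)) = q * (p - r) / (r * (p - q))"
    using rq by (auto simp: field_simps)
  have "0 < r / p" "r / p \<le> q / p" "q / p < 1" using rq by (auto simp: divide_simps)
  from iterated_inequality_L1[OF this, unfolded e]
  obtain c2 :: real where c2: "0 < c2" and L2: "\<And>f om u. f \<in> borel_measurable hl \<Longrightarrow> om \<in> borel_measurable hl \<Longrightarrow> u \<in> borel_measurable hl \<Longrightarrow>
      (\<integral>\<^sup>+t. prim (\<lambda>s. f s epowr (r / p) * om s epowr (1 - r / p)) t epowr (q / r) * u t \<partial>hl)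
      \<le> ennreal c2 * (\<integral>\<^sup>+s. f s \<partial>hl) epowr (q / p) *
        (\<integral>\<^sup>+t. tail u t epowr (q / (p - q)) * u t * prim om t epowr (q * (p - r) / (r * (p - q))) \<partial>hl) epowr (1 - q / p)"
    by blast
  define b where "b = q / (p - q)"
  define g where "g = p * (1 - q) / (p - q)"
  have bg: "0 < b" "0 < g" using rq by (auto simp: b_def g_def)
  define K where "K = 2 powr (2 * b + 1) + 2 powr b * geo b"
  have K: "0 < K" using geo_pos[OF bg(1)] by (auto simp: K_def intro: add_pos_pos)
  define A1 where "A1 = c1 * (4 powr (q / p) * K powr (1 - q / p))"
  define A2 where "A2 = 2 powr (q / r) * (c2 * 8 powr (q / p))"
  have A: "0 < A1" "0 < A2" using c1 c2 K by (auto simp: A1_def A2_def)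
  show ?thesis
  proof (rule that[of "2 powr (q / r) * (A1 + A2)"])
    show "0 < 2 powr (q / r) * (A1 + A2)" using A by simp
    fix f om u w :: "real \<Rightarrow> ennreal"
    assume w: "regular w" and [measurable]: "f \<in> borel_measurable hl" "om \<in> borel_measurable hl" "u \<in> borel_measurable hl"
      and f0: "AE s in hl. prim w s = top \<longrightarrow> f s = 0"
    have [measurable]: "w \<in> borel_measurable hl" using w by (simp add: regular_def)
    let ?R = "\<integral>\<^sup>+t. tail f t epowr p * w t \<partial>hl"
    let ?h = "\<lambda>s. f s epowr r * om s epowr (1 - r)"
    let ?k = "\<lambda>t. tail u t epowr (q / (1 - q)) * u t * prim om t epowr (q * (1 - r) / (r * (1 - q)))"
    let ?B = "\<lambda>k. \<integral>\<^sup>+t. ?k t * of_bool (block k (prim w t)) \<partial>hl"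
    let ?L = "\<lambda>t. \<integral>\<^sup>+s. ?h s * of_bool (s < t \<and> prim w t \<le> 2 * prim w s) \<partial>hl"
    let ?G = "\<lambda>t. \<integral>\<^sup>+s. ?h s * of_bool (s < t \<and> 2 * prim w s < prim w t) \<partial>hl"
    define D5 where "D5 = (\<integral>\<^sup>+x. prim w x epowr (- (b + 1)) * w x * prim ?k x epowr g \<partial>hl) + (\<integral>\<^sup>+x. w x \<partial>hl) epowr (- b) * (\<integral>\<^sup>+t. ?k t \<partial>hl) epowr g"
    define D6 where "D6 = (\<integral>\<^sup>+t. tail u t epowr (q / (p - q)) * u t * prim (\<lambda>s. prim w s epowr (- (p / (p - r))) * w s *
            prim om s epowr (p * (1 - r) / (p - r))) t epowr (q * (p - r) / (r * (p - q))) \<partial>hl)"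
    have split: "prim ?h t = ?L t + ?G t" for t
    proof -
      have "prim ?h t = (\<integral>\<^sup>+s. ?h s * of_bool (s < t \<and> prim w t \<le> 2 * prim w s) + ?h s * of_bool (s < t \<and> 2 * prim w s < prim w t) \<partial>hl)"
        unfolding prim_def[of ?h] by (intro nn_integral_cong) (auto simp: of_bool_def not_le)
      also have "\<dots> = ?L t + ?G t" by (rule nn_integral_add) measurable
      finally show ?thesis .
    qed
    have L: "(\<integral>\<^sup>+t. ?L t epowr (q / r) * u t \<partial>hl) \<le> ennreal A1 * (?R epowr (q / p) * D5 epowr (1 - q / p))"
    proof -
      have "(\<integral>\<^sup>+t. ?L t epowr (q / r) * u t \<partial>hl)
        \<le> ennreal c1 * ((4 * ?R) epowr (q / p) * (\<integral>\<^sup>+k. dy k epowr (- b) * ?B k epowr g \<partial>zint) epowr (1 - q / p))"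
        unfolding b_def g_def using w f0 rq L1 by (intro local_part_le) auto
      also have "\<dots> \<le> ennreal c1 * ((4 * ?R) epowr (q / p) * (ennreal K * D5) epowr (1 - q / p))"
        unfolding K_def D5_def using rq bg w by (intro mult_left_mono epowr_mono sum_block_mass_le) auto
      also have "\<dots> = ennreal A1 * (?R epowr (q / p) * D5 epowr (1 - q / p))"
        using rq c1 K ennreal_epowr[of 4 "q / p"]
        by (simp add: A1_def epowr_mult ennreal_mult ennreal_epowr ac_simps)
      finally show ?thesis .
    qed
    have G: "(\<integral>\<^sup>+t. ?G t epowr (q / r) * u t \<partial>hl) \<le> ennreal A2 * (?R epowr (q / p) * D6 epowr (1 - q / p))"
    proof -
      have "(\<integral>\<^sup>+t. ?G t epowr (q / r) * u t \<partial>hl)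
        \<le> 2 epowr (q / r) * (ennreal c2 * (8 * ?R) epowr (q / p) * D6 epowr (1 - q / p))"
        unfolding D6_def using w f0 rq L2 by (intro global_part_le) auto
      also have "\<dots> = ennreal A2 * (?R epowr (q / p) * D6 epowr (1 - q / p))"
        using rq c2 ennreal_epowr[of 8 "q / p"]
        by (simp add: A2_def epowr_mult ennreal_mult two_epowr ac_simps)
      finally show ?thesis .
    qed
    have "(\<integral>\<^sup>+t. prim ?h t epowr (q / r) * u t \<partial>hl)
      \<le> (\<integral>\<^sup>+t. 2 epowr (q / r) * (?L t epowr (q / r) * u t + ?G t epowr (q / r) * u t) \<partial>hl)"
    proof (rule nn_integral_mono)
      fix t
      have "prim ?h t epowr (q / r) * u t \<le> (2 epowr (q / r) * (?L t epowr (q / r) + ?G t epowr (q / r))) * u t"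
        unfolding split using rq by (intro mult_right_mono epowr_add_le) auto
      then show "prim ?h t epowr (q / r) * u t \<le> 2 epowr (q / r) * (?L t epowr (q / r) * u t + ?G t epowr (q / r) * u t)"
        by (simp add: distrib_right mult.assoc)
    qed
    also have "\<dots> = 2 epowr (q / r) * ((\<integral>\<^sup>+t. ?L t epowr (q / r) * u t \<partial>hl) + (\<integral>\<^sup>+t. ?G t epowr (q / r) * u t \<partial>hl))"
      by (subst nn_integral_cmult, measurable) (subst nn_integral_add, measurable)
    also have "\<dots> \<le> 2 epowr (q / r) * (ennreal A1 * (?R epowr (q / p) * D5 epowr (1 - q / p)) + ennreal A2 * (?R epowr (q / p) * D6 epowr (1 - q / p)))"
      by (intro mult_left_mono add_mono L G) auto
    also have "\<dots> \<le> 2 epowr (q / r) * (ennreal (A1 + A2) * (?R epowr (q / p) * D5 epowr (1 - q / p)) + ennreal (A1 + A2) * (?R epowr (q / p) * D6 epowr (1 - q / p)))"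
      using A by (intro mult_left_mono add_mono mult_right_mono ennreal_leI) auto
    also have "\<dots> = ennreal (2 powr (q / r) * (A1 + A2)) * ?R epowr (q / p) * (D5 epowr (1 - q / p) + D6 epowr (1 - q / p))"
      using A by (subst ennreal_mult) (simp_all only: two_epowr distrib_left mult.assoc, simp_all)
    finally show "(\<integral>\<^sup>+t. prim ?h t epowr (q / r) * u t \<partial>hl)
      \<le> ennreal (2 powr (q / r) * (A1 + A2)) * ?R epowr (q / p) *
        (((\<integral>\<^sup>+x. prim w x epowr (- (q / (p - q) + 1)) * w x * prim ?k x epowr (p * (1 - q) / (p - q)) \<partial>hl)
          + (\<integral>\<^sup>+x. w x \<partial>hl) epowr (- (q / (p - q))) * (\<integral>\<^sup>+t. ?k t \<partial>hl) epowr (p * (1 - q) / (p - q))) epowr (1 - q / p)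
        + (\<integral>\<^sup>+t. tail u t epowr (q / (p - q)) * u t * prim (\<lambda>s. prim w s epowr (- (p / (p - r))) * w s *
            prim om s epowr (p * (1 - r) / (p - r))) t epowr (q * (p - r) / (r * (p - q))) \<partial>hl) epowr (1 - q / p))"
      unfolding D5_def D6_def b_def g_def .
  qed
qed

subsection \<open>Test functions\<close>

lemma epowr_sum_subadd:
  assumes a: "0 < a" "a \<le> 1"
  shows "(\<integral>\<^sup>+k. h k \<partial>zint) epowr a \<le> (\<integral>\<^sup>+k. h k epowr a \<partial>zint)"
proof -
  obtain e :: "nat \<Rightarrow> int" where e: "bij e" using int_encode_def bij_int_decode by blast
  have eq: "(\<integral>\<^sup>+k. h k \<partial>zint) = (\<Sum>n. h (e n))" for h :: "int \<Rightarrow> ennreal"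
    using nn_integral_bij_count_space[OF e, of h] by (simp add: nn_integral_count_space_nat)
  have fin: "(\<Sum>i<n. h (e i)) epowr a \<le> (\<Sum>i<n. h (e i) epowr a)" for n
  proof (induction n)
    case 0
    then show ?case using a by (simp add: zero_epowr)
  next
    case (Suc n)
    have "(\<Sum>i<Suc n. h (e i)) epowr a \<le> (\<Sum>i<n. h (e i)) epowr a + h (e n) epowr a"
      using epowr_subadd[OF a, of "\<Sum>i<n. h (e i)" "h (e n)"] by simp
    also have "\<dots> \<le> (\<Sum>i<Suc n. h (e i) epowr a)" using Suc by (simp add: add_right_mono)
    finally show ?case .
  qed
  have "(\<Sum>n. h (e n)) epowr a = (SUP n. (\<Sum>i<n. h (e i)) epowr a)"
    using a by (simp add: suminf_eq_SUP SUP_epowr)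
  also have "\<dots> \<le> (\<Sum>n. h (e n) epowr a)"
    unfolding suminf_eq_SUP using fin by (intro SUP_mono) auto
  finally show ?thesis unfolding eq .
qed

text \<open>Cancels a power of \<open>D\<close> in an estimate of \<open>D\<close> by itself. For
  \<open>D = top\<close> the estimate may hold trivially, which is why finiteness has to be known
  beforehand.\<close>

lemma absorb_power:
  assumes "D \<le> A * D epowr e" "D < top" "0 \<le> e" "e < 1"
  shows "D epowr (1 - e) \<le> A"
proof (cases "D = 0")
  case True
  then show ?thesis using assms by (simp add: zero_epowr)
next
  case False
  then have D: "0 < D" "D < top" using assms by (auto simp: zero_less_iff_neq_zero)
  have "D epowr (1 - e) = D * D epowr (- e)" using epowr_add_fin[OF D, of 1 "- e"] by simp
  also have "\<dots> \<le> (A * D epowr e) * D epowr (- e)" by (intro mult_right_mono assms) simp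
  also have "\<dots> = A" using epowr_add_fin[OF D, of e "- e"] by (simp add: mult.assoc)
  finally show ?thesis .
qed

definition cum :: "(real \<Rightarrow> ennreal) \<Rightarrow> (real \<Rightarrow> ennreal) \<Rightarrow> int \<Rightarrow> ennreal" where
  "cum w X j = (\<integral>\<^sup>+y. X y * of_bool (prim w y \<le> dy (j + 1)) \<partial>hl)"

text \<open>A decreasing majorant of the values \<open>a j\<close>, constant on blocks. An
  \<open>r\<close>-sum takes the place of the supremum because the left-hand side of the inequality
  sees the \<open>r\<close>-th power, which is then a linear combination of cutoffs.\<close>

definition staircase :: "real \<Rightarrow> (real \<Rightarrow> ennreal) \<Rightarrow> (int \<Rightarrow> ennreal) \<Rightarrow> real \<Rightarrow> ennreal" where
  "staircase r w a y = (\<integral>\<^sup>+j. a j epowr r * of_bool (prim w y \<le> dy (j + 1)) \<partial>zint) epowr (1 / r)"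

lemma measurable_sum_int [measurable (raw)]:
  "(\<And>j. h j \<in> borel_measurable M) \<Longrightarrow> (\<lambda>x. \<integral>\<^sup>+j. h j x \<partial>zint) \<in> borel_measurable M"
proof -
  assume h: "\<And>j. h j \<in> borel_measurable M"
  obtain e :: "nat \<Rightarrow> int" where e: "bij e" using int_encode_def bij_int_decode by blast
  have eq: "(\<integral>\<^sup>+j. h j x \<partial>zint) = (\<Sum>n. h (e n) x)" for x
    using nn_integral_bij_count_space[OF e, of "\<lambda>j. h j x"] by (simp add: nn_integral_count_space_nat)
  show ?thesis unfolding eq using h by measurable
qed

lemma measurable_staircase [measurable]:
  "w \<in> borel_measurable hl \<Longrightarrow> staircase r w a \<in> borel_measurable hl"
proof -
  assume [measurable]: "w \<in> borel_measurable hl"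
  show ?thesis unfolding staircase_def[abs_def] by measurable
qed

lemma staircase_antimono: "r > 0 \<Longrightarrow> x \<le> y \<Longrightarrow> staircase r w a y \<le> staircase r w a x"
  unfolding staircase_def using prim_mono[of x y w]
  by (intro epowr_mono nn_integral_mono mult_left_mono) (auto simp: of_bool_def)

lemma staircase_ge:
  assumes "r > 0" "prim w y \<le> dy (j + 1)" shows "a j \<le> staircase r w a y"
proof -
  have "a j = (a j epowr r * of_bool (prim w y \<le> dy (j + 1))) epowr (1 / r)"
    using assms by (simp add: epowr_epowr)
  also have "\<dots> \<le> staircase r w a y"
    unfolding staircase_def using assms by (intro epowr_mono nn_integral_ge_point) auto
  finally show ?thesis .
qed

text \<open>The tail is a sum over levels, to which subadditivity of the \<open>p\<close>-th power
  applies. The value of the staircase on block \<open>k\<close> is compared with the single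
  \<open>a j\<close> by Hoelder's inequality with the geometric weights \<open>dy j^(1/2)\<close>.
  After the sums are exchanged, \<open>dy k^(1/2)\<close> sums over \<open>k \<le> j\<close> to a
  multiple of \<open>dy j^(1/2)\<close>, and the two half powers make up the weight
  \<open>dy j\<close>.\<close>

lemma tail_staircase_le:
  assumes [measurable]: "w \<in> borel_measurable hl" "X \<in> borel_measurable hl"
    and wpos: "\<And>t. 0 < t \<Longrightarrow> 0 < prim w t" and rp: "0 < r" "r < p" "p < 1"
  shows "(\<integral>\<^sup>+t. tail (\<lambda>y. staircase r w a y * X y) t epowr p * w t \<partial>hl)
    \<le> 2 * ennreal (geo (r / (2 * (p - r)))) epowr ((p - r) / r) * ennreal (geo (1 / 2)) *
      (\<integral>\<^sup>+j. dy j * (a j epowr p * cum w X j epowr p) \<partial>zint)"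
proof -
  define T where "T k = (\<integral>\<^sup>+j. a j epowr r * of_bool (k \<le> j) \<partial>zint) epowr (1 / r)" for k
  let ?\<theta> = "staircase r w a"
  \<comment> \<open>Chosen so that \<open>dy j^(1/2)\<close> under the power \<open>r/p\<close>
    cancels against \<open>dy j^(-?e)\<close> under the power \<open>1 - r/p\<close>.\<close>
  let ?e = "r / (2 * (p - r))"
  let ?c = "ennreal (geo ?e) epowr ((p - r) / r)"
  have e: "?e > 0" using rp by simp
  have \<theta>: "?\<theta> y = T k" if "block k (prim w y)" for y k
  proof -
    have "prim w y \<le> dy (j + 1) \<longleftrightarrow> k \<le> j" for j
      using that less_le_trans[of "dy k" "prim w y" "dy (j + 1)"] order_trans[of "prim w y" "dy (k + 1)" "dy (j + 1)"]
      by (auto simp: block_def)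
    then show ?thesis by (simp add: staircase_def T_def)
  qed
  have tail: "tail (\<lambda>y. ?\<theta> y * X y) t \<le> (\<integral>\<^sup>+k. T k * cum w X k * of_bool (prim w t \<le> dy (k + 1)) \<partial>zint)" for t
  proof -
    have "tail (\<lambda>y. ?\<theta> y * X y) t
      \<le> (\<integral>\<^sup>+y. (\<integral>\<^sup>+k. T k * (X y * of_bool (prim w y \<le> dy (k + 1))) * of_bool (prim w t \<le> dy (k + 1)) \<partial>zint) \<partial>hl)"
      unfolding tail_def
    proof (rule nn_integral_mono)
      fix y assume "y \<in> space hl"
      then have y: "0 < prim w y" using wpos by (simp add: space_hl)
      show "?\<theta> y * X y * of_bool (t < y)
        \<le> (\<integral>\<^sup>+k. T k * (X y * of_bool (prim w y \<le> dy (k + 1))) * of_bool (prim w t \<le> dy (k + 1)) \<partial>zint)"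
      proof (cases "prim w y = top \<or> \<not> t < y")
        case True
        \<comment> \<open>Where \<open>W\<close> is infinite no level counts in the staircase, so it
          is 0 there.\<close>
        then show ?thesis using rp by (auto simp: staircase_def zero_epowr top_unique)
      next
        case False
        then obtain k where k: "block k (prim w y)" using block_ex y by (auto simp: less_top)
        have "prim w t \<le> prim w y" using False by (intro prim_mono) simp
        then have "?\<theta> y * X y * of_bool (t < y) = T k * (X y * of_bool (prim w y \<le> dy (k + 1))) * of_bool (prim w t \<le> dy (k + 1))"
          using k False \<theta>[OF k] order_trans[of "prim w t" "prim w y" "dy (k + 1)"] by (simp add: block_def)
        also have "\<dots> \<le> (\<integral>\<^sup>+k. T k * (X y * of_bool (prim w y \<le> dy (k + 1))) * of_bool (prim w t \<le> dy (k + 1)) \<partial>zint)"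
          by (rule nn_integral_ge_point[of k]) simp
        finally show ?thesis .
      qed
    qed
    also have "\<dots> = (\<integral>\<^sup>+k. (\<integral>\<^sup>+y. T k * (X y * of_bool (prim w y \<le> dy (k + 1))) * of_bool (prim w t \<le> dy (k + 1)) \<partial>hl) \<partial>zint)"
      by (rule nn_integral_count_space_nn_integral) auto
    also have "\<dots> = (\<integral>\<^sup>+k. T k * cum w X k * of_bool (prim w t \<le> dy (k + 1)) \<partial>zint)"
      by (simp add: nn_integral_cmult nn_integral_multc cum_def)
    finally show ?thesis .
  qed
  have Tp: "T k epowr p \<le> ?c * (dy k epowr (- (1 / 2)) * (\<integral>\<^sup>+j. a j epowr p * dy j epowr (1 / 2) * of_bool (k \<le> j) \<partial>zint))" for k
  proof -
    let ?A = "\<lambda>j. a j epowr p * dy j epowr (1 / 2) * of_bool (k \<le> j)"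
    let ?B = "\<lambda>j. dy j epowr (- ?e) * of_bool (dy (k + 1) \<le> dy (j + 1))"
    have "a j epowr r * of_bool (k \<le> j) = ?A j epowr (r / p) * ?B j epowr (1 - r / p)" for j
    proof (cases "k \<le> j")
      case True
      have ee: "- ?e * (1 - r / p) = - (1 / 2 * (r / p))" using rp by (simp add: field_simps)
      have "dy j epowr (1 / 2 * (r / p)) * dy j epowr (- (1 / 2 * (r / p))) = 1"
        using epowr_add_fin[of "dy j" "1 / 2 * (r / p)" "- (1 / 2 * (r / p))"] by simp
      then have "?A j epowr (r / p) * ?B j epowr (1 - r / p)
        = a j epowr r * (dy j epowr (1 / 2 * (r / p)) * dy j epowr (- (1 / 2 * (r / p))))"
        using True rp ee by (simp add: epowr_mult epowr_epowr mult.assoc del: dy_epowr)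
      then show ?thesis using True \<open>_ = 1\<close> by simp
    next
      case False
      then show ?thesis using rp by (simp add: zero_epowr)
    qed
    then have "T k = (\<integral>\<^sup>+j. ?A j epowr (r / p) * ?B j epowr (1 - r / p) \<partial>zint) epowr (1 / r)"
      unfolding T_def by simp
    also have "\<dots> \<le> ((\<integral>\<^sup>+j. ?A j \<partial>zint) epowr (r / p) * (\<integral>\<^sup>+j. ?B j \<partial>zint) epowr (1 - r / p)) epowr (1 / r)"
      using rp by (intro epowr_mono nn_integral_Hoelder) auto
    also have "\<dots> \<le> ((\<integral>\<^sup>+j. ?A j \<partial>zint) epowr (r / p) * (ennreal (geo ?e) * dy k epowr (- ?e)) epowr (1 - r / p)) epowr (1 / r)"
    proof (intro epowr_mono mult_left_mono)
      have "(\<integral>\<^sup>+j. ?B j \<partial>zint) \<le> ennreal (geo ?e) * dy (k + 1) epowr (- ?e)" by (rule dy_sum_ge[OF e])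
      also have "\<dots> \<le> ennreal (geo ?e) * dy k epowr (- ?e)"
        using e by (intro mult_left_mono epowr_antimono) auto
      finally show "(\<integral>\<^sup>+j. ?B j \<partial>zint) \<le> ennreal (geo ?e) * dy k epowr (- ?e)" .
    qed (use rp in auto)
    finally have "T k epowr p \<le> (((\<integral>\<^sup>+j. ?A j \<partial>zint) epowr (r / p) * (ennreal (geo ?e) * dy k epowr (- ?e)) epowr (1 - r / p)) epowr (1 / r)) epowr p"
      using rp by (intro epowr_mono) auto
    also have "\<dots> = ?c * (dy k epowr (- (1 / 2)) * (\<integral>\<^sup>+j. ?A j \<partial>zint))"
    proof -
      have e1: "(1 - r / p) * (1 / r * p) = (p - r) / r" "r / p * (1 / r * p) = 1" using rp by (auto simp: field_simps)
      have e2: "- ?e * ((p - r) / r) = - (1 / 2)" using rp by (simp add: field_simps)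
      show ?thesis using rp
        by (simp only: epowr_epowr, subst epowr_mult, simp, subst epowr_epowr, subst epowr_epowr, subst e1(1), subst e1(2),
            subst epowr_mult, simp, subst epowr_epowr, subst e2) (simp add: ac_simps)
    qed
    finally show ?thesis .
  qed
  have "(\<integral>\<^sup>+t. tail (\<lambda>y. ?\<theta> y * X y) t epowr p * w t \<partial>hl)
    \<le> (\<integral>\<^sup>+t. (\<integral>\<^sup>+k. (T k * cum w X k) epowr p * (w t * of_bool (prim w t \<le> dy (k + 1))) \<partial>zint) \<partial>hl)"
  proof (rule nn_integral_mono)
    fix t
    have "tail (\<lambda>y. ?\<theta> y * X y) t epowr p \<le> (\<integral>\<^sup>+k. T k * cum w X k * of_bool (prim w t \<le> dy (k + 1)) \<partial>zint) epowr p"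
      using rp by (intro epowr_mono tail) auto
    also have "\<dots> \<le> (\<integral>\<^sup>+k. (T k * cum w X k * of_bool (prim w t \<le> dy (k + 1))) epowr p \<partial>zint)"
      using rp by (intro epowr_sum_subadd) auto
    also have "\<dots> = (\<integral>\<^sup>+k. (T k * cum w X k) epowr p * of_bool (prim w t \<le> dy (k + 1)) \<partial>zint)"
      using rp by (intro nn_integral_cong) (auto simp: of_bool_def zero_epowr)
    finally have "tail (\<lambda>y. ?\<theta> y * X y) t epowr p * w t
      \<le> (\<integral>\<^sup>+k. (T k * cum w X k) epowr p * of_bool (prim w t \<le> dy (k + 1)) \<partial>zint) * w t" by (rule mult_right_mono) simp
    then show "tail (\<lambda>y. ?\<theta> y * X y) t epowr p * w t
      \<le> (\<integral>\<^sup>+k. (T k * cum w X k) epowr p * (w t * of_bool (prim w t \<le> dy (k + 1))) \<partial>zint)"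
      unfolding mult.commute[of "w t" "of_bool _"] mult.assoc[symmetric] by (simp add: nn_integral_multc)
  qed
  also have "\<dots> = (\<integral>\<^sup>+k. (T k * cum w X k) epowr p * (\<integral>\<^sup>+t. w t * of_bool (prim w t \<le> dy (k + 1)) \<partial>hl) \<partial>zint)"
    by (subst nn_integral_count_space_nn_integral) (auto simp: nn_integral_cmult)
  also have "\<dots> \<le> (\<integral>\<^sup>+k. (T k * cum w X k) epowr p * dy (k + 1) \<partial>zint)"
    using accumulates_prim[of w] by (intro nn_integral_mono mult_left_mono) (auto simp: accumulates_def)
  also have "\<dots> \<le> (\<integral>\<^sup>+k. (\<integral>\<^sup>+j. 2 * ?c * (a j epowr p * dy j epowr (1 / 2) * (cum w X j epowr p * (dy k epowr (1 / 2) * of_bool (dy k \<le> dy j)))) \<partial>zint) \<partial>zint)"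
  proof (rule nn_integral_mono)
    fix k
    have d: "dy (k + 1) * dy k epowr (- (1 / 2)) = 2 * dy k epowr (1 / 2)"
      using epowr_add_fin[of "dy k" 1 "- (1 / 2)"] by (simp add: dy_Suc mult.assoc)
    have "(T k * cum w X k) epowr p * dy (k + 1) = T k epowr p * (cum w X k epowr p * dy (k + 1))"
      using rp by (simp add: epowr_mult mult.assoc)
    also have "\<dots> \<le> ?c * (dy k epowr (- (1 / 2)) * (\<integral>\<^sup>+j. a j epowr p * dy j epowr (1 / 2) * of_bool (k \<le> j) \<partial>zint))
        * (cum w X k epowr p * dy (k + 1))"
      by (intro mult_right_mono Tp) simp
    also have "\<dots> = ?c * (dy (k + 1) * dy k epowr (- (1 / 2))) * cum w X k epowr p *
        (\<integral>\<^sup>+j. a j epowr p * dy j epowr (1 / 2) * of_bool (k \<le> j) \<partial>zint)" by (simp only: ac_simps)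
    also have "\<dots> = (\<integral>\<^sup>+j. ?c * (2 * dy k epowr (1 / 2)) * cum w X k epowr p * (a j epowr p * dy j epowr (1 / 2) * of_bool (k \<le> j)) \<partial>zint)"
      unfolding d by (rule nn_integral_cmult[symmetric]) simp
    also have "\<dots> \<le> (\<integral>\<^sup>+j. 2 * ?c * (a j epowr p * dy j epowr (1 / 2) * (cum w X j epowr p * (dy k epowr (1 / 2) * of_bool (dy k \<le> dy j)))) \<partial>zint)"
    proof (rule nn_integral_mono)
      fix j
      show "?c * (2 * dy k epowr (1 / 2)) * cum w X k epowr p * (a j epowr p * dy j epowr (1 / 2) * of_bool (k \<le> j))
        \<le> 2 * ?c * (a j epowr p * dy j epowr (1 / 2) * (cum w X j epowr p * (dy k epowr (1 / 2) * of_bool (dy k \<le> dy j))))"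
      proof (cases "k \<le> j")
        case True
        then have "dy (k + 1) \<le> dy (j + 1)" by simp
        then have "prim w x \<le> dy (j + 1)" if "prim w x \<le> dy (k + 1)" for x
          using that by (rule order_trans[rotated])
        then have "cum w X k \<le> cum w X j"
          unfolding cum_def by (intro nn_integral_mono mult_left_mono) (auto simp: of_bool_def)
        then have "cum w X k epowr p \<le> cum w X j epowr p" using rp by (intro epowr_mono) auto
        then have "(2 * ?c * (a j epowr p * dy j epowr (1 / 2) * dy k epowr (1 / 2))) * cum w X k epowr p
          \<le> (2 * ?c * (a j epowr p * dy j epowr (1 / 2) * dy k epowr (1 / 2))) * cum w X j epowr p"
          by (rule mult_left_mono) simp
        then show ?thesis using True by (simp add: ac_simps)
      qed simp
    qed
    finally show "(T k * cum w X k) epowr p * dy (k + 1)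
      \<le> (\<integral>\<^sup>+j. 2 * ?c * (a j epowr p * dy j epowr (1 / 2) * (cum w X j epowr p * (dy k epowr (1 / 2) * of_bool (dy k \<le> dy j)))) \<partial>zint)" .
  qed
  also have "\<dots> = (\<integral>\<^sup>+j. 2 * ?c * (a j epowr p * dy j epowr (1 / 2) * (cum w X j epowr p *
      (\<integral>\<^sup>+k. dy k epowr (1 / 2) * of_bool (dy k \<le> dy j) \<partial>zint))) \<partial>zint)"
    by (subst nn_integral_count_space_nn_integral) (auto simp: nn_integral_cmult)
  also have "\<dots> \<le> (\<integral>\<^sup>+j. 2 * ?c * (a j epowr p * dy j epowr (1 / 2) * (cum w X j epowr p *
      (ennreal (geo (1 / 2)) * dy j epowr (1 / 2)))) \<partial>zint)"
    by (intro nn_integral_mono mult_left_mono dy_sum_le) auto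
  also have "\<dots> = (\<integral>\<^sup>+j. 2 * ?c * ennreal (geo (1 / 2)) * (dy j * (a j epowr p * cum w X j epowr p)) \<partial>zint)"
  proof (rule nn_integral_cong)
    fix j
    have "dy j epowr (1 / 2) * dy j epowr (1 / 2) = dy j" using epowr_add_fin[of "dy j" "1 / 2" "1 / 2"] by simp
    then have "2 * ?c * ennreal (geo (1 / 2)) * (dy j * (a j epowr p * cum w X j epowr p))
      = 2 * ?c * ennreal (geo (1 / 2)) * ((dy j epowr (1 / 2) * dy j epowr (1 / 2)) * (a j epowr p * cum w X j epowr p))"
      by simp
    then show "2 * ?c * (a j epowr p * dy j epowr (1 / 2) * (cum w X j epowr p * (ennreal (geo (1 / 2)) * dy j epowr (1 / 2))))
      = 2 * ?c * ennreal (geo (1 / 2)) * (dy j * (a j epowr p * cum w X j epowr p))"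
      by (simp only: ac_simps)
  qed
  also have "\<dots> = 2 * ?c * ennreal (geo (1 / 2)) * (\<integral>\<^sup>+j. dy j * (a j epowr p * cum w X j epowr p) \<partial>zint)"
    by (rule nn_integral_cmult) simp
  finally show ?thesis .
qed

subsection \<open>Necessity for truncated weights\<close>

locale exponents =
  fixes p q r :: real
  assumes rq: "0 < r" "r \<le> q" "q < p" "p < 1"
begin

text \<open>With \<open>VV\<close> the primitive of \<open>om\<close>, the powers of \<open>V\<^sub>r(0,t)\<close> in \<open>C5\<close> and \<open>C6\<close> are \<open>VV\<close> to the
  powers \<open>el\<close> and \<open>ekap\<close>; \<open>eb + 1\<close> and \<open>erho + 1\<close> are the exponents of \<open>1/W\<close>, and \<open>eg\<close>, \<open>edel\<close> those
  of the inner integrals.\<close>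

definition "eb = q / (p - q)"
definition "eg = p * (1 - q) / (p - q)"
definition "em = (q - r) / (r * (1 - q))"
definition "el = q * (1 - r) / (r * (1 - q))"
definition "erho = r / (p - r)"
definition "ekap = p * (1 - r) / (p - r)"
definition "edel = q * (p - r) / (r * (p - q))"

lemma exponent_signs: "0 < eb" "0 < eg - 1" "0 \<le> em" "0 < erho" "0 < ekap" "0 \<le> edel - 1" "p \<noteq> 0" "0 < 1 - q"
proof -
  have "eg - 1 = q * (1 - p) / (p - q)" using rq by (simp add: eg_def field_simps)
  then show "0 < eg - 1" using rq by simp
  have "edel - 1 = p * (q - r) / (r * (p - q))" using rq by (simp add: edel_def field_simps)
  then show "0 \<le> edel - 1" using rq by simp
qed (use rq in \<open>auto simp: eb_def em_def erho_def ekap_def\<close>)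

lemma el_eq: "el = em + 1"
  using rq by (simp add: el_def em_def field_simps)

text \<open>\<open>c_tail\<close> is the constant of \<open>tail_staircase_le\<close>;
  \<open>c_5\<close> and \<open>c_6\<close> are those of the two absorption arguments below.\<close>

definition "c_tail = 2 * ennreal (geo (r / (2 * (p - r)))) epowr ((p - r) / r) * ennreal (geo (1 / 2))"
definition "c_5 = 2 epowr eg * ennreal (geo eb) * (2 epowr ((em * r + 1) * ((q - r) / r)) * c_tail epowr (q / p))"
definition "c_6 = 2 epowr (((edel - 1) * (r / p) + 1) * (q / r)) * (c_tail * 2 epowr (eb + 1)) epowr (q / p)"

lemma c_fin: "c_tail < top" "c_5 < top" "c_6 < top"
proof -
  show 1: "c_tail < top"
    using rq by (auto simp: c_tail_def ennreal_mult_less_top intro!: epowr_less_top)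
  show "c_5 < top"
    using rq 1 by (auto simp: c_5_def ennreal_mult_less_top two_epowr intro!: epowr_less_top)
  show "c_6 < top"
    using rq 1 by (auto simp: c_6_def ennreal_mult_less_top two_epowr intro!: epowr_less_top)
qed

end

text \<open>\<open>K\<close> is the \<open>q\<close>-th power of an admissible constant. Integrable
  \<open>u\<close> and \<open>om\<close>, with \<open>om\<close> vanishing up to
  \<open>a > 0\<close>, make the level sums finite: only levels with
  \<open>W a \<le> dy (j + 1)\<close> count, and there the negative powers of \<open>dy j\<close>
  are summable.\<close>

locale truncated_weights = exponents +
  fixes u om w :: "real \<Rightarrow> ennreal" and a :: real and K :: ennreal
  assumes measurable_weights [measurable]: "u \<in> borel_measurable hl" "om \<in> borel_measurable hl" "w \<in> borel_measurable hl"
    and wpos: "\<And>t. 0 < t \<Longrightarrow> 0 < prim w t"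
    and fin_u: "(\<integral>\<^sup>+s. u s \<partial>hl) < top" and fin_om: "(\<integral>\<^sup>+s. om s \<partial>hl) < top"
    and a: "0 < a" "\<And>s. s \<le> a \<Longrightarrow> om s = 0"
    and K: "\<And>f. f \<in> borel_measurable hl \<Longrightarrow>
      (\<integral>\<^sup>+t. prim (\<lambda>s. f s epowr r * om s epowr (1 - r)) t epowr (q / r) * u t \<partial>hl)
      \<le> K * (\<integral>\<^sup>+t. tail f t epowr p * w t \<partial>hl) epowr (q / p)"
begin

abbreviation "U \<equiv> tail u"
abbreviation "VV \<equiv> prim om"
abbreviation "W \<equiv> prim w"

text \<open>\<open>dB\<close> is the density inside \<open>C5\<close>, with differential
  \<open>u dt\<close>. Integration by parts turns it into \<open>X\<close>, with differential
  \<open>om dy\<close>, which can serve as a factor of a test function.\<close>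

definition X where "X y = U y epowr (1 / (1 - q)) * (VV y epowr em * om y)"
definition dB where "dB t = U t epowr (q / (1 - q)) * u t * VV t epowr el"
text \<open>The level sum that corresponds to \<open>C5\<close>, with \<open>X\<close> in place of
  \<open>dB\<close>.\<close>

definition D where "D = (\<integral>\<^sup>+j. dy j epowr (- eb) * cum w X j epowr eg \<partial>zint)"

lemma measurable_X [measurable]: "X \<in> borel_measurable hl" "dB \<in> borel_measurable hl"
  unfolding X_def[abs_def] dB_def[abs_def] by measurable

lemma cum_eq_0:
  assumes "\<And>s. s \<le> a \<Longrightarrow> Y s = 0" "\<not> W a \<le> dy (j + 1)"
  shows "cum w Y j = 0"
proof -
  have "cum w Y j = (\<integral>\<^sup>+y. 0 \<partial>hl)"
    unfolding cum_def
  proof (rule nn_integral_cong)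
    fix y
    show "Y y * of_bool (W y \<le> dy (j + 1)) = 0"
    proof (cases "y \<le> a")
      case False
      then have "W a \<le> W y" by (intro prim_mono) simp
      then have "\<not> W y \<le> dy (j + 1)" using assms(2) order_trans by blast
      then show ?thesis by simp
    qed (simp add: assms)
  qed
  then show ?thesis by simp
qed

lemma sum_cum_finite:
  assumes [measurable]: "Y \<in> borel_measurable hl" and Y: "\<And>s. s \<le> a \<Longrightarrow> Y s = 0" "(\<integral>\<^sup>+s. Y s \<partial>hl) < top"
    and e: "0 < b" "0 < g"
  shows "(\<integral>\<^sup>+j. dy j epowr (- b) * cum w Y j epowr g \<partial>zint) < top"
proof -
  have "(\<integral>\<^sup>+j. dy j epowr (- b) * cum w Y j epowr g \<partial>zint)
    \<le> (\<integral>\<^sup>+j. (\<integral>\<^sup>+s. Y s \<partial>hl) epowr g * (dy j epowr (- b) * of_bool (W a \<le> dy (j + 1))) \<partial>zint)"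
  proof (rule nn_integral_mono)
    fix j
    show "dy j epowr (- b) * cum w Y j epowr g \<le> (\<integral>\<^sup>+s. Y s \<partial>hl) epowr g * (dy j epowr (- b) * of_bool (W a \<le> dy (j + 1)))"
    proof (cases "W a \<le> dy (j + 1)")
      case True
      have "cum w Y j \<le> (\<integral>\<^sup>+s. Y s \<partial>hl)"
        unfolding cum_def by (intro nn_integral_mono) (auto simp: of_bool_def)
      then have "cum w Y j epowr g \<le> (\<integral>\<^sup>+s. Y s \<partial>hl) epowr g" using e by (intro epowr_mono) auto
      then show ?thesis using True by (simp add: mult.commute mult_left_mono)
    next
      case False
      then show ?thesis using cum_eq_0[OF Y(1) False] e by (simp add: zero_epowr)
    qed
  qed
  also have "\<dots> \<le> (\<integral>\<^sup>+s. Y s \<partial>hl) epowr g * (ennreal (geo b) * W a epowr (- b))"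
    by (simp add: nn_integral_cmult) (intro mult_left_mono dy_sum_ge e, simp)
  also have "\<dots> < top"
  proof -
    have "W a epowr (- b) < top"
    proof (cases "W a = top")
      case True
      then show ?thesis using e by (simp add: top_epowr_neg)
    next
      case False
      then show ?thesis using wpos[OF a(1)] by (intro epowr_less_top) (auto simp: less_top)
    qed
    moreover have "(\<integral>\<^sup>+s. Y s \<partial>hl) epowr g < top" using Y e by (intro epowr_less_top) auto
    ultimately show ?thesis by (auto simp: ennreal_mult_less_top)
  qed
  finally show ?thesis .
qed

lemma D_finite: "D < top"
  unfolding D_def
proof (rule sum_cum_finite)
  show "X s = 0" if "s \<le> a" for s using a(2)[OF that] by (simp add: X_def)
  have "(\<integral>\<^sup>+s. X s \<partial>hl) \<le> (\<integral>\<^sup>+s. (\<integral>\<^sup>+s. u s \<partial>hl) epowr (1 / (1 - q)) * ((\<integral>\<^sup>+s. om s \<partial>hl) epowr em * om s) \<partial>hl)"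
    unfolding X_def using exponent_signs rq
    by (intro nn_integral_mono mult_mono mult_right_mono epowr_mono tail_le prim_le) auto
  also have "\<dots> = (\<integral>\<^sup>+s. u s \<partial>hl) epowr (1 / (1 - q)) * ((\<integral>\<^sup>+s. om s \<partial>hl) epowr em * (\<integral>\<^sup>+s. om s \<partial>hl))"
    by (simp add: nn_integral_cmult)
  also have "\<dots> < top"
    using exponent_signs fin_u fin_om by (auto simp: ennreal_mult_less_top intro!: epowr_less_top)
  finally show "(\<integral>\<^sup>+s. X s \<partial>hl) < top" .
qed (use exponent_signs in auto)

text \<open>The density \<open>X\<close> is extremal for the inequality with \<open>\<integral> f\<close> on the right-hand side; a decreasing
  factor \<open>\<theta>\<close> can be pulled out of primitives.\<close>

lemma lower_bound_X:
  assumes [measurable]: "\<theta> \<in> borel_measurable hl" and anti: "\<And>x y. x \<le> y \<Longrightarrow> \<theta> y \<le> \<theta> x"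
  shows "(\<integral>\<^sup>+y. \<theta> y epowr q * X y \<partial>hl) \<le> 2 epowr ((em * r + 1) * ((q - r) / r)) *
    (\<integral>\<^sup>+t. prim (\<lambda>s. (\<theta> s * X s) epowr r * om s epowr (1 - r)) t epowr (q / r) * u t \<partial>hl)"
proof -
  define h where "h s = (\<theta> s * X s) epowr r * om s epowr (1 - r)" for s
  have [measurable]: "h \<in> borel_measurable hl" unfolding h_def[abs_def] by measurable
  define g where "g s = VV s epowr (em * r) * om s" for s
  have [measurable]: "g \<in> borel_measurable hl" unfolding g_def[abs_def] by measurable
  let ?c = "2 epowr (em * r + 1)"
  let ?Q = "(q - r) / r"
  note signs = exponent_signs rq
  have h: "h s = \<theta> s epowr r * U s epowr (r / (1 - q)) * g s" for s
  proof -
    have "om s = om s epowr r * om s epowr (1 - r)"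
      using epowr_add[of r "1 - r" "om s"] rq by simp
    then show ?thesis
      unfolding h_def X_def g_def using signs
      by (simp add: epowr_mult epowr_epowr mult.assoc)
  qed
  have prim_h: "\<theta> y epowr r * U y epowr (r / (1 - q)) * prim g y \<le> prim h y" for y
  proof -
    have "\<theta> y epowr r * U y epowr (r / (1 - q)) * prim g y = prim (\<lambda>s. \<theta> y epowr r * U y epowr (r / (1 - q)) * g s) y"
      by (simp add: prim_cmult)
    also have "\<dots> \<le> prim h y"
      unfolding h using signs
      by (intro prim_mono_fun mult_right_mono mult_mono epowr_mono anti tail_mono) auto
    finally show ?thesis .
  qed
  have V: "VV y epowr (em * r + 1) \<le> ?c * prim g y" for y
    unfolding g_def using prim_power_bounds(2)[of om "em * r" y] signs by simp
  \<comment> \<open>\<open>\<theta>^q * X\<close> splits into the power \<open>(q - r)/r\<close> of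
    a lower bound for \<open>H = prim h\<close>, times \<open>h * U\<close>; the exponents of
    \<open>\<theta>\<close>, \<open>U\<close> and \<open>VV\<close> add up accordingly. After the
    exchange of integrals, \<open>H^((q-r)/r) * h\<close> integrates to at most
    \<open>H^(q/r)\<close>.\<close>
  have pt: "\<theta> y epowr q * X y \<le> ?c epowr ?Q * (prim h y epowr ?Q * h y * U y)" for y
  proof -
    have Q: "?Q = em * (1 - q)" "r * ?Q = q - r" using rq by (simp_all add: em_def)
    have "(em * r + 1) * ?Q + em * r = em * (r * ?Q) + ?Q + em * r" by (simp add: algebra_simps)
    also have "\<dots> = em * (q - r) + em * (1 - q) + em * r" by (subst Q(2), subst Q(1)) (rule refl)
    also have "\<dots> = em" by (simp add: algebra_simps)
    finally have e1: "(em * r + 1) * ?Q + em * r = em" .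
    have "(r / (1 - q)) * ?Q = (q - r) / (1 - q)" using rq by simp
    then have "1 / (1 - q) = (r / (1 - q)) * ?Q + (r / (1 - q) + 1)"
      using rq by (simp only: add_divide_distrib[symmetric]) (simp add: field_simps)
    then have 1: "U y epowr (1 / (1 - q)) = U y epowr ((r / (1 - q)) * ?Q) * (U y epowr (r / (1 - q)) * U y)"
      using epowr_add[of "(r / (1 - q)) * ?Q" "r / (1 - q) + 1" "U y"] epowr_add[of "r / (1 - q)" 1 "U y"] rq by simp
    have "q = r * ?Q + r" using rq by (simp add: field_simps)
    then have 2: "\<theta> y epowr q = \<theta> y epowr (r * ?Q) * \<theta> y epowr r"
      using epowr_add[of "r * ?Q" r "\<theta> y"] rq by simp
    have 3: "VV y epowr em = VV y epowr ((em * r + 1) * ?Q) * VV y epowr (em * r)"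
      using epowr_add[of "(em * r + 1) * ?Q" "em * r" "VV y"] signs unfolding e1 by simp
    have "\<theta> y epowr q * X y = (\<theta> y epowr (r * ?Q) * U y epowr ((r / (1 - q)) * ?Q) * VV y epowr ((em * r + 1) * ?Q)) *
        (\<theta> y epowr r * U y epowr (r / (1 - q)) * (VV y epowr (em * r) * om y)) * U y"
      unfolding X_def 1 2 3 by (simp only: ac_simps)
    also have "\<dots> = (\<theta> y epowr r * U y epowr (r / (1 - q)) * VV y epowr (em * r + 1)) epowr ?Q * h y * U y"
      using signs by (simp add: h g_def epowr_mult epowr_epowr)
    also have "\<dots> \<le> (\<theta> y epowr r * U y epowr (r / (1 - q)) * (?c * prim g y)) epowr ?Q * h y * U y"
      using signs by (intro mult_right_mono epowr_mono mult_left_mono V) auto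
    also have "\<dots> = (?c * (\<theta> y epowr r * U y epowr (r / (1 - q)) * prim g y)) epowr ?Q * h y * U y"
      by (simp only: ac_simps)
    also have "\<dots> \<le> (?c * prim h y) epowr ?Q * h y * U y"
      using signs by (intro mult_right_mono epowr_mono mult_left_mono prim_h) auto
    also have "\<dots> = ?c epowr ?Q * (prim h y epowr ?Q * h y * U y)"
      using signs by (simp add: epowr_mult mult.assoc)
    finally show ?thesis .
  qed
  have "(\<integral>\<^sup>+y. \<theta> y epowr q * X y \<partial>hl) \<le> (\<integral>\<^sup>+y. ?c epowr ?Q * ((prim h y epowr ?Q * h y) * U y) \<partial>hl)"
    by (intro nn_integral_mono pt)
  also have "\<dots> = ?c epowr ?Q * (\<integral>\<^sup>+t. prim (\<lambda>y. prim h y epowr ?Q * h y) t * u t \<partial>hl)"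
    by (simp add: nn_integral_cmult nn_integral_prim_swap)
  also have "\<dots> \<le> ?c epowr ?Q * (\<integral>\<^sup>+t. prim h t epowr (?Q + 1) * u t \<partial>hl)"
    using signs by (intro mult_left_mono nn_integral_mono mult_right_mono prim_power_bounds(1)) auto
  also have "?Q + 1 = q / r" using rq by (simp add: field_simps)
  finally show ?thesis by (simp add: h_def[abs_def] epowr_epowr)
qed

text \<open>Testing with \<open>\<theta> * X\<close> gives \<open>D \<le> c * K * D^(q/p)\<close>.
  With \<open>cum\<close> short for \<open>cum w X j\<close>, the right-hand side asks that
  \<open>dy j * al j^p * cum^p\<close> be the \<open>j\<close>-th term of \<open>D\<close>, and the
  left-hand side asks the same of \<open>al j^q * cum\<close>. Both hold for one choice of
  \<open>al\<close>, the equality case of Hoelder's inequality over the levels.\<close>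

lemma D_bound: "D epowr (1 - q / p) \<le> c_5 * K"
proof (rule absorb_power)
  note signs = exponent_signs rq
  define al where "al j = dy j epowr (- (1 / (p - q))) * cum w X j epowr ((1 - p) / (p - q))" for j
  define \<theta> where "\<theta> = staircase r w al"
  have [measurable]: "\<theta> \<in> borel_measurable hl" unfolding \<theta>_def by measurable
  have R: "(\<integral>\<^sup>+t. tail (\<lambda>y. \<theta> y * X y) t epowr p * w t \<partial>hl) \<le> c_tail * D"
  proof -
    have "(\<integral>\<^sup>+t. tail (\<lambda>y. \<theta> y * X y) t epowr p * w t \<partial>hl)
      \<le> c_tail * (\<integral>\<^sup>+j. dy j * (al j epowr p * cum w X j epowr p) \<partial>zint)"
      unfolding c_tail_def \<theta>_def using rq wpos by (intro tail_staircase_le) auto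
    also have "(\<lambda>j. dy j * (al j epowr p * cum w X j epowr p)) = (\<lambda>j. dy j epowr (- eb) * cum w X j epowr eg)"
    proof
      fix j
      have e: "1 + - (1 / (p - q)) * p = - eb" "(1 - p) / (p - q) * p + p = eg"
        using rq by (simp_all add: eb_def eg_def field_simps)
      have "dy j * (al j epowr p * cum w X j epowr p)
        = (dy j epowr 1 * dy j epowr (- (1 / (p - q)) * p)) * (cum w X j epowr ((1 - p) / (p - q) * p) * cum w X j epowr p)"
        unfolding al_def using rq by (simp only: epowr_1, subst epowr_mult) (auto simp only: epowr_epowr ac_simps)
      also have "\<dots> = dy j epowr (- eb) * cum w X j epowr eg"
        using epowr_add_fin[of "dy j" 1 "- (1 / (p - q)) * p"] epowr_add[of "(1 - p) / (p - q) * p" p "cum w X j"] rq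
        unfolding e by simp
      finally show "dy j * (al j epowr p * cum w X j epowr p) = dy j epowr (- eb) * cum w X j epowr eg" .
    qed
    finally show ?thesis unfolding D_def .
  qed
  \<comment> \<open>The power \<open>cum^eg\<close> is rewritten as an integral of
    \<open>prim X^(eg-1) * X\<close>, so that after the exchange the sum over the levels acts on
    \<open>dy j^(-eb)\<close> alone. \<open>W_y\<close> and \<open>VX\<close> are abbreviations,
    instantiated right afterwards.\<close>
  have "D \<le> (\<integral>\<^sup>+j. (\<integral>\<^sup>+y. 2 epowr eg * (W_y y * (dy j epowr (- eb) * of_bool (W y \<le> dy (j + 1)))) \<partial>hl) \<partial>zint)"
    if "W_y = (\<lambda>y. VX y epowr (eg - 1) * X y)" and VX: "VX = prim X" for W_y VX
    unfolding D_def
  proof (rule nn_integral_mono)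
    fix j
    let ?X = "\<lambda>y. X y * of_bool (W y \<le> dy (j + 1))"
    have "cum w X j epowr eg \<le> 2 epowr eg * (\<integral>\<^sup>+y. prim ?X y epowr (eg - 1) * ?X y \<partial>hl)"
      using power_le_accumulated[OF accumulates_prim, of ?X "eg - 1"] signs by (simp add: cum_def)
    also have "\<dots> \<le> 2 epowr eg * (\<integral>\<^sup>+y. W_y y * of_bool (W y \<le> dy (j + 1)) \<partial>hl)"
      unfolding that mult.assoc using signs
      by (intro mult_left_mono nn_integral_mono mult_right_mono epowr_mono prim_mono_fun) (auto simp: of_bool_def)
    finally have "dy j epowr (- eb) * cum w X j epowr eg
      \<le> dy j epowr (- eb) * (2 epowr eg * (\<integral>\<^sup>+y. W_y y * of_bool (W y \<le> dy (j + 1)) \<partial>hl))"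
      by (rule mult_left_mono) simp
    also have "\<dots> = (\<integral>\<^sup>+y. dy j epowr (- eb) * (2 epowr eg * (W_y y * of_bool (W y \<le> dy (j + 1)))) \<partial>hl)"
      unfolding that by (simp add: nn_integral_cmult)
    finally show "dy j epowr (- eb) * cum w X j epowr eg
      \<le> (\<integral>\<^sup>+y. 2 epowr eg * (W_y y * (dy j epowr (- eb) * of_bool (W y \<le> dy (j + 1)))) \<partial>hl)"
      by (simp only: ac_simps)
  qed
  from this[OF refl refl]
  have "D \<le> (\<integral>\<^sup>+j. (\<integral>\<^sup>+y. 2 epowr eg * (prim X y epowr (eg - 1) * X y * (dy j epowr (- eb) * of_bool (W y \<le> dy (j + 1)))) \<partial>hl) \<partial>zint)" .
  also have "\<dots> = (\<integral>\<^sup>+y. 2 epowr eg * (prim X y epowr (eg - 1) * X y * (\<integral>\<^sup>+j. dy j epowr (- eb) * of_bool (W y \<le> dy (j + 1)) \<partial>zint)) \<partial>hl)"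
    by (subst nn_integral_count_space_nn_integral[symmetric]) (auto simp: nn_integral_cmult)
  also have "\<dots> \<le> (\<integral>\<^sup>+y. 2 epowr eg * (prim X y epowr (eg - 1) * X y * (ennreal (geo eb) * W y epowr (- eb))) \<partial>hl)"
    using signs by (intro nn_integral_mono mult_left_mono dy_sum_ge) auto
  also have "\<dots> \<le> (\<integral>\<^sup>+y. 2 epowr eg * ennreal (geo eb) * (\<theta> y epowr q * X y) \<partial>hl)"
  proof (rule nn_integral_mono)
    fix y assume "y \<in> space hl"
    then have y: "0 < W y" using wpos by (simp add: space_hl)
    have "prim X y epowr (eg - 1) * W y epowr (- eb) \<le> \<theta> y epowr q"
    proof (cases "W y = top")
      case True
      then show ?thesis using signs by (simp add: top_epowr_neg)
    next
      case False
      then obtain k where k: "block k (W y)" using block_ex[OF y] by (auto simp: less_top)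
      then have k': "dy k \<le> W y" "W y \<le> dy (k + 1)" by (auto simp: block_def)
      have le: "W s \<le> dy (k + 1)" if "s < y" for s
        using prim_mono[of s y w] that k'(2) by (auto intro: order_trans)
      have "prim X y \<le> cum w X k"
        unfolding prim_def[of X] cum_def by (intro nn_integral_mono mult_left_mono) (use le in \<open>auto simp: of_bool_def\<close>)
      then have "prim X y epowr (eg - 1) * W y epowr (- eb) \<le> cum w X k epowr (eg - 1) * dy k epowr (- eb)"
        using signs k' by (intro mult_mono epowr_mono epowr_antimono) auto
      also have "\<dots> = al k epowr q"
      proof -
        have e: "- (1 / (p - q)) * q = - eb" "(1 - p) / (p - q) * q = eg - 1"
          using rq by (simp_all add: eb_def eg_def field_simps)
        show ?thesis unfolding al_def using rq
          by (subst epowr_mult, simp, subst epowr_epowr, subst epowr_epowr, subst e(1), subst e(2)) (rule mult.commute)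
      qed
      also have "\<dots> \<le> \<theta> y epowr q"
        unfolding \<theta>_def using rq k' by (intro epowr_mono staircase_ge) auto
      finally show ?thesis .
    qed
    then have "(2 epowr eg * ennreal (geo eb) * X y) * (prim X y epowr (eg - 1) * W y epowr (- eb))
      \<le> (2 epowr eg * ennreal (geo eb) * X y) * \<theta> y epowr q" by (rule mult_left_mono) simp
    then show "2 epowr eg * (prim X y epowr (eg - 1) * X y * (ennreal (geo eb) * W y epowr (- eb)))
      \<le> 2 epowr eg * ennreal (geo eb) * (\<theta> y epowr q * X y)" by (simp only: ac_simps)
  qed
  also have "\<dots> = 2 epowr eg * ennreal (geo eb) * (\<integral>\<^sup>+y. \<theta> y epowr q * X y \<partial>hl)"
    by (rule nn_integral_cmult) measurable
  also have "\<dots> \<le> 2 epowr eg * ennreal (geo eb) * (2 epowr ((em * r + 1) * ((q - r) / r)) *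
    (\<integral>\<^sup>+t. prim (\<lambda>s. (\<theta> s * X s) epowr r * om s epowr (1 - r)) t epowr (q / r) * u t \<partial>hl))"
    using rq by (intro mult_left_mono lower_bound_X) (auto simp: \<theta>_def intro: staircase_antimono)
  also have "\<dots> \<le> 2 epowr eg * ennreal (geo eb) * (2 epowr ((em * r + 1) * ((q - r) / r)) *
    (K * (\<integral>\<^sup>+t. tail (\<lambda>y. \<theta> y * X y) t epowr p * w t \<partial>hl) epowr (q / p)))"
    by (intro mult_left_mono K) auto
  also have "\<dots> \<le> 2 epowr eg * ennreal (geo eb) * (2 epowr ((em * r + 1) * ((q - r) / r)) * (K * (c_tail * D) epowr (q / p)))"
    using rq by (intro mult_left_mono epowr_mono R) auto
  also have "\<dots> = c_5 * K * D epowr (q / p)"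
    unfolding c_5_def using rq by (subst epowr_mult) (simp_all add: ac_simps)
  finally show "D \<le> c_5 * K * D epowr (q / p)" .
qed (use rq D_finite in auto)

end

section \<open>The level sums that belong to \<open>C6\<close>\<close>

context truncated_weights
begin

definition beta where "beta j = cum w om j"
text \<open>The contribution of block \<open>j\<close> to the inner integral of \<open>C6\<close>,
  as \<open>W^(-(erho+1)) w\<close> integrates over the block to a multiple of
  \<open>dy j^(-erho)\<close> at most.\<close>

definition sj where "sj j = dy j epowr (- erho) * beta j epowr ekap"
definition S where "S j = (\<integral>\<^sup>+i. sj i * of_bool (i \<le> j) \<partial>zint)"
text \<open>Only levels strictly before \<open>t\<close> count, so that the cutoff
  \<open>W s \<le> dy (i + 1)\<close> in a test function implies \<open>s < t\<close>. The block of
  \<open>W t\<close> itself is treated in \<open>local6_le\<close>.\<close>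

definition Sm where "Sm t = (\<integral>\<^sup>+i. sj i * of_bool (dy (i + 1) < W t) \<partial>zint)"
text \<open>The tail \<open>U\<close> at the point where \<open>W\<close> passes
  \<open>dy (j + 1)\<close>.\<close>

definition Up where "Up j = (\<integral>\<^sup>+x. u x * of_bool (dy (j + 1) < W x) \<partial>hl)"
definition X6 where "X6 = (\<integral>\<^sup>+t. U t epowr eb * u t * Sm t epowr edel \<partial>hl)"

lemma measurable_Sm [measurable]: "Sm \<in> borel_measurable hl"
  unfolding Sm_def[abs_def] by measurable

lemma X6_finite: "X6 < top"
proof -
  note signs = exponent_signs rq
  define T where "T = (\<integral>\<^sup>+j. sj j \<partial>zint)"
  have T: "T < top"
    unfolding T_def sj_def beta_def using signs a(2) fin_om by (intro sum_cum_finite) auto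
  have "X6 \<le> (\<integral>\<^sup>+t. (\<integral>\<^sup>+s. u s \<partial>hl) epowr eb * u t * T epowr edel \<partial>hl)"
    unfolding X6_def Sm_def T_def using signs
    by (intro nn_integral_mono mult_mono epowr_mono tail_le) (auto simp: of_bool_def intro!: nn_integral_mono)
  also have "\<dots> = (\<integral>\<^sup>+s. u s \<partial>hl) epowr eb * (\<integral>\<^sup>+s. u s \<partial>hl) * T epowr edel"
    by (simp add: nn_integral_cmult nn_integral_multc)
  also have "\<dots> < top"
    using signs fin_u T by (auto simp: ennreal_mult_less_top intro!: epowr_less_top)
  finally show ?thesis .
qed

lemma S_le_Sm:
  assumes "dy (j + 1) < W t" shows "S j \<le> Sm t"
proof -
  have "dy (i + 1) < W t" if "i \<le> j" for i
    using assms that by (auto intro: le_less_trans[of _ "dy (j + 1)"])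
  then show ?thesis unfolding S_def Sm_def by (intro nn_integral_mono mult_left_mono) (auto simp: of_bool_def)
qed

text \<open>The test function is \<open>\<theta> * om\<close>. Its inner integral up to
  \<open>t\<close> dominates a multiple of \<open>U t^((eb+1) r/p) * Sm t^(e+1)\<close>, since the
  level \<open>j\<close> before \<open>t\<close> contributes
  \<open>Up j^((eb+1) r/p) * S j^e * sj j\<close> and \<open>U t \<le> Up j\<close>; the power
  \<open>q/r\<close> of this is the integrand of \<open>X6\<close> without \<open>u\<close>. The
  right-hand side is governed by the sum of \<open>E j * sj j\<close>, which is at most a multiple
  of \<open>X6\<close>.\<close>

lemma X6_bound: "X6 epowr (1 - q / p) \<le> c_6 * K"
proof (rule absorb_power)
  note signs = exponent_signs rq
  \<comment> \<open>Makes \<open>(e + 1) * (q / r) = edel\<close>, the exponent of \<open>Sm\<close>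
    in \<open>X6\<close>.\<close>
  define e where "e = (edel - 1) * (r / p)"
  have e0: "0 \<le> e" using signs by (simp add: e_def)
  \<comment> \<open>Up to a constant, a lower bound for the derivative of \<open>X6\<close> with
    respect to \<open>sj j\<close>: beyond level \<open>j\<close> there holds
    \<open>S j \<le> Sm t\<close>, and \<open>U^eb * u\<close> integrates there to at least a
    multiple of \<open>Up j^(eb+1)\<close>.\<close>
  define E where "E j = Up j epowr (eb + 1) * S j epowr (edel - 1)" for j
  \<comment> \<open>chosen so that \<open>2\<^sup>j (al j)\<^sup>p (beta j)\<^sup>p = E j * sj j\<close>\<close>
  define al where "al j = E j epowr (1 / p) * (dy j epowr (- ((erho + 1) / p)) * beta j epowr ((ekap - p) / p))" for j
  define \<theta> where "\<theta> = staircase r w al"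
  have [measurable]: "\<theta> \<in> borel_measurable hl" unfolding \<theta>_def by measurable
  have kp: "0 \<le> ekap - p"
  proof -
    have "ekap - p = p * (1 - p) / (p - r)" using rq by (simp add: ekap_def field_simps)
    then show ?thesis using rq by simp
  qed
  have Esum: "(\<integral>\<^sup>+j. E j * sj j \<partial>zint) \<le> 2 epowr (eb + 1) * X6"
  proof -
    have "(\<integral>\<^sup>+j. E j * sj j \<partial>zint)
      \<le> (\<integral>\<^sup>+j. (\<integral>\<^sup>+t. 2 epowr (eb + 1) * (U t epowr eb * u t * (Sm t epowr (edel - 1) * (sj j * of_bool (dy (j + 1) < W t)))) \<partial>hl) \<partial>zint)"
    proof (rule nn_integral_mono)
      fix j
      let ?u = "\<lambda>x. u x * of_bool (dy (j + 1) < W x)"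
      have "Up j epowr (eb + 1) \<le> 2 epowr (eb + 1) * (\<integral>\<^sup>+t. tail ?u t epowr eb * ?u t \<partial>hl)"
        unfolding Up_def using signs by (intro power_le_accumulated accumulates_tail) auto
      also have "\<dots> \<le> 2 epowr (eb + 1) * (\<integral>\<^sup>+t. U t epowr eb * ?u t \<partial>hl)"
        using signs by (intro mult_left_mono nn_integral_mono mult_right_mono epowr_mono tail_mono_fun) (auto simp: of_bool_def)
      finally have "Up j epowr (eb + 1) * (S j epowr (edel - 1) * sj j)
        \<le> 2 epowr (eb + 1) * (\<integral>\<^sup>+t. U t epowr eb * ?u t \<partial>hl) * (S j epowr (edel - 1) * sj j)"
        by (rule mult_right_mono) simp
      also have "\<dots> = (\<integral>\<^sup>+t. 2 epowr (eb + 1) * (U t epowr eb * ?u t) * (S j epowr (edel - 1) * sj j) \<partial>hl)"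
        by (simp add: nn_integral_cmult nn_integral_multc)
      also have "\<dots> \<le> (\<integral>\<^sup>+t. 2 epowr (eb + 1) * (U t epowr eb * u t * (Sm t epowr (edel - 1) * (sj j * of_bool (dy (j + 1) < W t)))) \<partial>hl)"
      proof (rule nn_integral_mono)
        fix t
        show "2 epowr (eb + 1) * (U t epowr eb * ?u t) * (S j epowr (edel - 1) * sj j)
          \<le> 2 epowr (eb + 1) * (U t epowr eb * u t * (Sm t epowr (edel - 1) * (sj j * of_bool (dy (j + 1) < W t))))"
        proof (cases "dy (j + 1) < W t")
          case True
          have "S j epowr (edel - 1) \<le> Sm t epowr (edel - 1)"
            using S_le_Sm[OF True] signs by (intro epowr_mono) auto
          then have "(2 epowr (eb + 1) * (U t epowr eb * u t) * sj j) * S j epowr (edel - 1)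
            \<le> (2 epowr (eb + 1) * (U t epowr eb * u t) * sj j) * Sm t epowr (edel - 1)" by (rule mult_left_mono) simp
          then show ?thesis using True by (simp add: ac_simps)
        qed simp
      qed
      finally show "E j * sj j \<le> (\<integral>\<^sup>+t. 2 epowr (eb + 1) * (U t epowr eb * u t * (Sm t epowr (edel - 1) * (sj j * of_bool (dy (j + 1) < W t)))) \<partial>hl)"
        by (simp add: E_def mult.assoc)
    qed
    also have "\<dots> = (\<integral>\<^sup>+t. 2 epowr (eb + 1) * (U t epowr eb * u t * (Sm t epowr (edel - 1) * Sm t)) \<partial>hl)"
      unfolding Sm_def by (subst nn_integral_count_space_nn_integral[symmetric]) (auto simp: nn_integral_cmult)
    also have "\<dots> = 2 epowr (eb + 1) * X6"
      unfolding X6_def using epowr_add[of "edel - 1" 1] signs by (simp add: nn_integral_cmult)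
    finally show ?thesis .
  qed
  have R: "(\<integral>\<^sup>+t. tail (\<lambda>y. \<theta> y * om y) t epowr p * w t \<partial>hl) \<le> c_tail * (2 epowr (eb + 1) * X6)"
  proof -
    have "(\<integral>\<^sup>+t. tail (\<lambda>y. \<theta> y * om y) t epowr p * w t \<partial>hl)
      \<le> c_tail * (\<integral>\<^sup>+j. dy j * (al j epowr p * cum w om j epowr p) \<partial>zint)"
      unfolding c_tail_def \<theta>_def using rq wpos by (intro tail_staircase_le) auto
    also have "(\<lambda>j. dy j * (al j epowr p * cum w om j epowr p)) = (\<lambda>j. E j * sj j)"
    proof
      fix j
      have e: "1 / p * p = 1" "- ((erho + 1) / p) * p = - (erho + 1)" "(ekap - p) / p * p = ekap - p"
        using rq by simp_all
      have alp: "al j epowr p = E j * (dy j epowr (- (erho + 1)) * beta j epowr (ekap - p))"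
        unfolding al_def using rq
        by (subst epowr_mult, simp, subst epowr_mult, simp, subst epowr_epowr, subst epowr_epowr, subst epowr_epowr)
          (simp only: e epowr_1)
      have "dy j epowr 1 * dy j epowr (- (erho + 1)) = dy j epowr (- erho)"
        using epowr_add_fin[of "dy j" 1 "- (erho + 1)"] by simp
      moreover have "beta j epowr (ekap - p) * beta j epowr p = beta j epowr ekap"
        using epowr_add[of "ekap - p" p "beta j"] kp rq by simp
      moreover have "dy j * (al j epowr p * cum w om j epowr p)
        = E j * ((dy j epowr 1 * dy j epowr (- (erho + 1))) * (beta j epowr (ekap - p) * beta j epowr p))"
        unfolding alp beta_def[symmetric] epowr_1 by (simp only: ac_simps)
      ultimately show "dy j * (al j epowr p * cum w om j epowr p) = E j * sj j" by (simp add: sj_def)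
    qed
    also have "c_tail * (\<integral>\<^sup>+j. E j * sj j \<partial>zint) \<le> c_tail * (2 epowr (eb + 1) * X6)"
      by (intro mult_left_mono Esum) simp
    finally show ?thesis .
  qed
  have Sm_pow: "Sm t epowr (e + 1) \<le> 2 epowr (e + 1) * (\<integral>\<^sup>+j. S j epowr e * (sj j * of_bool (dy (j + 1) < W t)) \<partial>zint)" for t
  proof -
    let ?s = "\<lambda>j. sj j * of_bool (dy (j + 1) < W t)"
    have "Sm t epowr (e + 1) \<le> 2 epowr (e + 1) * (\<integral>\<^sup>+j. (\<integral>\<^sup>+i. ?s i * of_bool (i \<le> j) \<partial>zint) epowr e * ?s j \<partial>zint)"
      unfolding Sm_def by (rule power_le_accumulated[OF accumulates_int e0])
    also have "\<dots> \<le> 2 epowr (e + 1) * (\<integral>\<^sup>+j. S j epowr e * ?s j \<partial>zint)"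
      unfolding S_def using e0
      by (intro mult_left_mono nn_integral_mono mult_right_mono epowr_mono) (auto simp: of_bool_def)
    finally show ?thesis .
  qed
  have low: "U t epowr ((eb + 1) * (r / p)) * Sm t epowr (e + 1)
    \<le> 2 epowr (e + 1) * prim (\<lambda>s. (\<theta> s * om s) epowr r * om s epowr (1 - r)) t" if t: "0 < t" for t
  proof -
    have "U t epowr ((eb + 1) * (r / p)) * Sm t epowr (e + 1)
      \<le> U t epowr ((eb + 1) * (r / p)) * (2 epowr (e + 1) * (\<integral>\<^sup>+j. S j epowr e * (sj j * of_bool (dy (j + 1) < W t)) \<partial>zint))"
      by (intro mult_left_mono Sm_pow) simp
    also have "\<dots> = 2 epowr (e + 1) * (\<integral>\<^sup>+j. U t epowr ((eb + 1) * (r / p)) * (S j epowr e * (sj j * of_bool (dy (j + 1) < W t))) \<partial>zint)"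
      by (subst nn_integral_cmult) (simp_all only: mult.left_commute measurable_count_space, simp)
    also have "\<dots> \<le> 2 epowr (e + 1) * (\<integral>\<^sup>+j. (\<integral>\<^sup>+s. al j epowr r * of_bool (W s \<le> dy (j + 1)) * om s * of_bool (s < t) \<partial>hl) \<partial>zint)"
    proof (intro mult_left_mono nn_integral_mono)
      fix j
      show "U t epowr ((eb + 1) * (r / p)) * (S j epowr e * (sj j * of_bool (dy (j + 1) < W t)))
        \<le> (\<integral>\<^sup>+s. al j epowr r * of_bool (W s \<le> dy (j + 1)) * om s * of_bool (s < t) \<partial>hl)"
      proof (cases "dy (j + 1) < W t")
        case True
        have gt: "dy (j + 1) < W x" if "t < x" for x
          using True prim_mono[of t x w] that by (auto intro: less_le_trans)
        have lt: "s < t" if "W s \<le> dy (j + 1)" for s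
          using prim_less_imp_less[OF le_less_trans[OF that True]] .
        have UU: "U t \<le> Up j"
          unfolding tail_def Up_def using gt by (intro nn_integral_mono mult_left_mono) (auto simp: of_bool_def)
        have "U t epowr ((eb + 1) * (r / p)) * (S j epowr e * sj j) \<le> Up j epowr ((eb + 1) * (r / p)) * (S j epowr e * sj j)"
          using signs by (intro mult_right_mono epowr_mono UU) auto
        also have "\<dots> = al j epowr r * beta j"
        proof -
          have e: "1 / p * r = r / p" "- ((erho + 1) / p) * r = - erho" "(ekap - p) / p * r + 1 = ekap"
          proof -
            have "erho + 1 = p / (p - r)" using rq by (simp add: erho_def field_simps)
            then show "- ((erho + 1) / p) * r = - erho" using rq by (simp add: erho_def)
            have "ekap - p = p * (1 - p) / (p - r)" using rq by (simp add: ekap_def field_simps)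
            then have "(ekap - p) / p * r = (1 - p) * r / (p - r)" using rq by simp
            then show "(ekap - p) / p * r + 1 = ekap" using rq by (simp add: ekap_def field_simps)
          qed simp
          have "al j epowr r = E j epowr (r / p) * (dy j epowr (- erho) * beta j epowr ((ekap - p) / p * r))"
            unfolding al_def using rq
            by (subst epowr_mult, simp, subst epowr_mult, simp, subst epowr_epowr, subst epowr_epowr, subst epowr_epowr)
              (simp only: e(1,2))
          moreover have "beta j epowr ((ekap - p) / p * r) * beta j = beta j epowr ekap"
            using epowr_add[of "(ekap - p) / p * r" 1 "beta j"] kp rq unfolding e(3) by simp
          moreover have "E j epowr (r / p) = Up j epowr ((eb + 1) * (r / p)) * S j epowr e"
            unfolding E_def e_def using rq by (simp add: epowr_mult epowr_epowr)
          ultimately show ?thesis by (simp add: sj_def mult.assoc)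
        qed
        also have "\<dots> = (\<integral>\<^sup>+s. al j epowr r * (om s * of_bool (W s \<le> dy (j + 1))) \<partial>hl)"
          by (simp add: beta_def cum_def nn_integral_cmult)
        also have "\<dots> = (\<integral>\<^sup>+s. al j epowr r * of_bool (W s \<le> dy (j + 1)) * om s * of_bool (s < t) \<partial>hl)"
          using lt by (intro nn_integral_cong) (auto simp: of_bool_def)
        finally show ?thesis using True by simp
      qed simp
    qed simp
    also have "(\<integral>\<^sup>+j. (\<integral>\<^sup>+s. al j epowr r * of_bool (W s \<le> dy (j + 1)) * om s * of_bool (s < t) \<partial>hl) \<partial>zint)
      = (\<integral>\<^sup>+s. (\<integral>\<^sup>+j. al j epowr r * of_bool (W s \<le> dy (j + 1)) * om s * of_bool (s < t) \<partial>zint) \<partial>hl)"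
      by (rule nn_integral_count_space_nn_integral[symmetric]) auto
    also have "\<dots> = prim (\<lambda>s. (\<theta> s * om s) epowr r * om s epowr (1 - r)) t"
      unfolding prim_def[of "\<lambda>s. (\<theta> s * om s) epowr r * om s epowr (1 - r)"]
    proof (rule nn_integral_cong)
      fix s
      have o: "om s epowr r * om s epowr (1 - r) = om s"
        using epowr_add[of r "1 - r" "om s"] rq by simp
      have th: "(\<theta> s * om s) epowr r = (\<integral>\<^sup>+j. al j epowr r * of_bool (W s \<le> dy (j + 1)) \<partial>zint) * om s epowr r"
        unfolding \<theta>_def staircase_def using rq by (simp add: epowr_mult epowr_epowr)
      have "(\<integral>\<^sup>+j. al j epowr r * of_bool (W s \<le> dy (j + 1)) * om s * of_bool (s < t) \<partial>zint)
        = (\<integral>\<^sup>+j. al j epowr r * of_bool (W s \<le> dy (j + 1)) \<partial>zint) * om s * of_bool (s < t)"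
        by (subst nn_integral_multc, simp, subst nn_integral_multc, simp) (rule refl)
      also have "\<dots> = (\<theta> s * om s) epowr r * om s epowr (1 - r) * of_bool (s < t)"
        unfolding th mult.assoc[of _ "om s epowr r" "om s epowr (1 - r)"] o by (rule refl)
      finally show "(\<integral>\<^sup>+j. al j epowr r * of_bool (W s \<le> dy (j + 1)) * om s * of_bool (s < t) \<partial>zint)
        = (\<theta> s * om s) epowr r * om s epowr (1 - r) * of_bool (s < t)" .
    qed
    finally show ?thesis .
  qed
  have "X6 \<le> (\<integral>\<^sup>+t. 2 epowr ((e + 1) * (q / r)) * (prim (\<lambda>s. (\<theta> s * om s) epowr r * om s epowr (1 - r)) t epowr (q / r) * u t) \<partial>hl)"
    unfolding X6_def
  proof (rule nn_integral_mono)
    fix t assume "t \<in> space hl"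
    then have t: "0 < t" by (simp add: space_hl)
    have e1: "(eb + 1) * (r / p) * (q / r) = eb"
    proof -
      have "eb + 1 = p / (p - q)" using rq by (simp add: eb_def field_simps)
      then show ?thesis using rq by (simp add: eb_def)
    qed
    have e2: "(e + 1) * (q / r) = edel"
    proof -
      have "(e + 1) * (q / r) = (edel - 1) * (q / p) + q / r" using rq by (simp add: e_def field_simps)
      also have "\<dots> = edel - (edel * (1 - q / p) - (q / r - q / p))" by (simp add: algebra_simps)
      also have "edel * (1 - q / p) = q / r - q / p" using rq by (simp add: edel_def divide_simps) (simp add: algebra_simps)
      finally show ?thesis by simp
    qed
    have "U t epowr eb * Sm t epowr edel = (U t epowr ((eb + 1) * (r / p)) * Sm t epowr (e + 1)) epowr (q / r)"
      using rq by (subst epowr_mult, simp, subst epowr_epowr, subst epowr_epowr, subst e1, subst e2) simp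
    also have "\<dots> \<le> (2 epowr (e + 1) * prim (\<lambda>s. (\<theta> s * om s) epowr r * om s epowr (1 - r)) t) epowr (q / r)"
      using rq by (intro epowr_mono low t) auto
    also have "\<dots> = 2 epowr ((e + 1) * (q / r)) * prim (\<lambda>s. (\<theta> s * om s) epowr r * om s epowr (1 - r)) t epowr (q / r)"
      using rq by (simp only: epowr_epowr[symmetric]) (simp add: epowr_mult)
    finally have "U t epowr eb * Sm t epowr edel * u t
      \<le> 2 epowr ((e + 1) * (q / r)) * prim (\<lambda>s. (\<theta> s * om s) epowr r * om s epowr (1 - r)) t epowr (q / r) * u t"
      by (rule mult_right_mono) simp
    then show "U t epowr eb * u t * Sm t epowr edel
      \<le> 2 epowr ((e + 1) * (q / r)) * (prim (\<lambda>s. (\<theta> s * om s) epowr r * om s epowr (1 - r)) t epowr (q / r) * u t)"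
      by (simp only: ac_simps)
  qed
  also have "\<dots> = 2 epowr ((e + 1) * (q / r)) * (\<integral>\<^sup>+t. prim (\<lambda>s. (\<theta> s * om s) epowr r * om s epowr (1 - r)) t epowr (q / r) * u t \<partial>hl)"
    by (rule nn_integral_cmult) measurable
  also have "\<dots> \<le> 2 epowr ((e + 1) * (q / r)) * (K * (\<integral>\<^sup>+t. tail (\<lambda>y. \<theta> y * om y) t epowr p * w t \<partial>hl) epowr (q / p))"
    by (intro mult_left_mono K) auto
  also have "\<dots> \<le> 2 epowr ((e + 1) * (q / r)) * (K * (c_tail * (2 epowr (eb + 1) * X6)) epowr (q / p))"
    using rq by (intro mult_left_mono epowr_mono R) auto
  also have "c_tail * (2 epowr (eb + 1) * X6) = c_tail * 2 epowr (eb + 1) * X6" by (simp only: mult.assoc)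
  also have "2 epowr ((e + 1) * (q / r)) * (K * (c_tail * 2 epowr (eb + 1) * X6) epowr (q / p)) = c_6 * K * X6 epowr (q / p)"
    unfolding c_6_def e_def using rq by (subst epowr_mult) (simp_all only: ac_simps, simp_all)
  finally show "X6 \<le> c_6 * K * X6 epowr (q / p)" .
qed (use rq X6_finite in auto)

end

context exponents
begin

definition "c_7 = (3 * 2 epowr (el * eg)) epowr (1 - q / p) * c_5"
text \<open>\<open>c_5\<close> enters because the block of \<open>W t\<close>, which
  \<open>X6\<close> leaves out, is estimated by \<open>D\<close>.\<close>

definition "c_8 = (2 epowr edel * 2 epowr edel) epowr (1 - q / p) * (c_6 + (2 epowr (el * eg)) epowr (1 - q / p) * c_5)"

lemma c78_fin: "c_7 < top" "c_8 < top"
proof -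
  have 2: "(2 epowr x) epowr y < top" for x y by (simp only: epowr_epowr) (simp add: two_epowr)
  have 3: "(3::ennreal) epowr y < top" for y by (intro epowr_less_top) auto
  show "c_7 < top" using c_fin 2 3 rq
    by (auto simp: c_7_def ennreal_mult_less_top epowr_mult)
  show "c_8 < top" using c_fin 2 rq
    by (auto simp: c_8_def ennreal_mult_less_top epowr_mult ennreal_add_less_top)
qed

end

section \<open>From the level sums back to the integrals\<close>

context truncated_weights
begin

definition D5 where "D5 = (\<integral>\<^sup>+x. W x epowr (- (eb + 1)) * w x * prim dB x epowr eg \<partial>hl)
  + (\<integral>\<^sup>+x. w x \<partial>hl) epowr (- eb) * (\<integral>\<^sup>+x. dB x \<partial>hl) epowr eg"
definition D6 where "D6 = (\<integral>\<^sup>+t. U t epowr eb * u t *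
  prim (\<lambda>s. W s epowr (- (erho + 1)) * w s * VV s epowr ekap) t epowr edel \<partial>hl)"

text \<open>Integration by parts: \<open>VV^el\<close> is at most a multiple of the primitive of
  \<open>VV^em * om\<close>, and after the exchange the tail of \<open>U^(q/(1-q)) * u\<close> is at
  most \<open>U^(1/(1-q))\<close>. As \<open>E\<close> is an initial segment, its cutoff passes from
  \<open>t\<close> to the smaller point \<open>y\<close>.\<close>

lemma dB_le_X:
  assumes [measurable]: "Measurable.pred hl E" and down: "\<And>s t. s < t \<Longrightarrow> E t \<Longrightarrow> E s"
  shows "(\<integral>\<^sup>+t. dB t * of_bool (E t) \<partial>hl) \<le> 2 epowr el * (\<integral>\<^sup>+y. X y * of_bool (E y) \<partial>hl)"
proof -
  note signs = exponent_signs rq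
  let ?k = "\<lambda>t. U t epowr (q / (1 - q)) * u t"
  let ?g = "\<lambda>s. VV s epowr em * om s"
  have "(\<integral>\<^sup>+t. dB t * of_bool (E t) \<partial>hl) \<le> (\<integral>\<^sup>+t. 2 epowr el * (prim ?g t * (?k t * of_bool (E t))) \<partial>hl)"
  proof (rule nn_integral_mono)
    fix t
    have "(?k t * of_bool (E t)) * VV t epowr el \<le> (?k t * of_bool (E t)) * (2 epowr el * prim ?g t)"
      using prim_power_bounds(2)[of om em t] signs unfolding el_eq by (intro mult_left_mono) auto
    then show "dB t * of_bool (E t) \<le> 2 epowr el * (prim ?g t * (?k t * of_bool (E t)))"
      unfolding dB_def by (simp only: ac_simps)
  qed
  also have "\<dots> = 2 epowr el * (\<integral>\<^sup>+y. ?g y * tail (\<lambda>t. ?k t * of_bool (E t)) y \<partial>hl)"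
    by (subst nn_integral_cmult, measurable) (subst nn_integral_prim_swap, measurable)
  also have "\<dots> \<le> 2 epowr el * (\<integral>\<^sup>+y. X y * of_bool (E y) \<partial>hl)"
  proof (intro mult_left_mono nn_integral_mono)
    fix y
    show "?g y * tail (\<lambda>t. ?k t * of_bool (E t)) y \<le> X y * of_bool (E y)"
    proof (cases "E y")
      case True
      have "tail (\<lambda>t. ?k t * of_bool (E t)) y \<le> tail ?k y"
        by (intro tail_mono_fun) (auto simp: of_bool_def)
      also have "\<dots> \<le> U y epowr (q / (1 - q) + 1)" using tail_power_bounds(1)[of u "q / (1 - q)" y] signs by simp
      also have "q / (1 - q) + 1 = 1 / (1 - q)" using rq by (simp add: field_simps)
      finally have "?g y * tail (\<lambda>t. ?k t * of_bool (E t)) y \<le> ?g y * U y epowr (1 / (1 - q))" by (rule mult_left_mono) simp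
      then show ?thesis using True by (simp add: X_def ac_simps)
    next
      case False
      then have "\<not> E t" if "y < t" for t using down that by blast
      then have "tail (\<lambda>t. ?k t * of_bool (E t)) y \<le> tail (\<lambda>t. 0) y" by (intro tail_mono_fun) auto
      then show ?thesis by (simp add: tail_def)
    qed
  qed simp
  finally show ?thesis .
qed

lemma cum_dB_le: "cum w dB j \<le> 2 epowr el * cum w X j"
  unfolding cum_def
  by (rule dB_le_X) (auto intro: order_trans[OF prim_mono[OF less_imp_le]])

lemma cum_dB_power_le: "cum w dB j epowr eg \<le> 2 epowr (el * eg) * cum w X j epowr eg"
  using epowr_mono[OF _ cum_dB_le, of eg j] exponent_signs by (simp add: epowr_mult epowr_epowr)

text \<open>On block \<open>k\<close> the integral of \<open>W^(-(eb+1)) w\<close> is at most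
  \<open>2 * dy k^(-eb)\<close>, and \<open>prim dB\<close> is at most \<open>cum w dB k\<close>. In
  the second term of \<open>D5\<close>, a finite total mass of \<open>w\<close> lies in one block,
  and a single term of the level sum bounds it. The constant is \<open>3 = 2 + 1\<close>.\<close>

lemma D5_le: "D5 \<le> 3 * 2 epowr (el * eg) * D"
proof -
  note signs = exponent_signs rq
  let ?c = "2 epowr (el * eg)"
  have sum: "(\<integral>\<^sup>+k. dy k epowr (- eb) * cum w dB k epowr eg \<partial>zint) \<le> ?c * D"
  proof -
    have "(\<integral>\<^sup>+k. dy k epowr (- eb) * cum w dB k epowr eg \<partial>zint)
      \<le> (\<integral>\<^sup>+k. ?c * (dy k epowr (- eb) * cum w X k epowr eg) \<partial>zint)"
    proof (rule nn_integral_mono)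
      fix k
      have "dy k epowr (- eb) * cum w dB k epowr eg \<le> dy k epowr (- eb) * (?c * cum w X k epowr eg)"
        by (intro mult_left_mono cum_dB_power_le) simp
      then show "dy k epowr (- eb) * cum w dB k epowr eg \<le> ?c * (dy k epowr (- eb) * cum w X k epowr eg)"
        by (simp only: ac_simps)
    qed
    then show ?thesis by (simp add: nn_integral_cmult D_def)
  qed
  have 1: "(\<integral>\<^sup>+x. W x epowr (- (eb + 1)) * w x * prim dB x epowr eg \<partial>hl) \<le> 2 * (?c * D)"
  proof -
    have "(\<integral>\<^sup>+x. W x epowr (- (eb + 1)) * w x * prim dB x epowr eg \<partial>hl)
      \<le> (\<integral>\<^sup>+x. (\<integral>\<^sup>+k. dy k epowr (- (eb + 1)) * cum w dB k epowr eg * (w x * of_bool (block k (W x))) \<partial>zint) \<partial>hl)"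
    proof (rule nn_integral_mono)
      fix x assume "x \<in> space hl"
      then have x: "0 < W x" using wpos by (simp add: space_hl)
      show "W x epowr (- (eb + 1)) * w x * prim dB x epowr eg
        \<le> (\<integral>\<^sup>+k. dy k epowr (- (eb + 1)) * cum w dB k epowr eg * (w x * of_bool (block k (W x))) \<partial>zint)"
      proof (cases "W x = top")
        case True
        have "W x epowr (- (eb + 1)) = 0" unfolding True using signs by (intro top_epowr_neg) simp
        then show ?thesis by simp
      next
        case False
        then obtain k where k: "block k (W x)" using block_ex[OF x] by (auto simp: less_top)
        then have k': "dy k \<le> W x" "W x \<le> dy (k + 1)" by (auto simp: block_def)
        have le: "W s \<le> dy (k + 1)" if "s < x" for s
          using prim_mono[of s x w] that k'(2) by (auto intro: order_trans)
        have "prim dB x \<le> cum w dB k"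
          unfolding prim_def[of dB] cum_def by (intro nn_integral_mono mult_left_mono) (use le in \<open>auto simp: of_bool_def\<close>)
        then have "W x epowr (- (eb + 1)) * w x * prim dB x epowr eg \<le> dy k epowr (- (eb + 1)) * w x * cum w dB k epowr eg"
          using signs k' by (intro mult_mono epowr_mono epowr_antimono) auto
        then show ?thesis
          using sum_block[OF k, of "\<lambda>k. dy k epowr (- (eb + 1)) * cum w dB k epowr eg * w x"] by (simp add: ac_simps)
      qed
    qed
    also have "\<dots> = (\<integral>\<^sup>+k. dy k epowr (- (eb + 1)) * cum w dB k epowr eg * (\<integral>\<^sup>+x. w x * of_bool (block k (W x)) \<partial>hl) \<partial>zint)"
      by (subst nn_integral_count_space_nn_integral) (auto simp: nn_integral_cmult)
    also have "\<dots> \<le> (\<integral>\<^sup>+k. dy k epowr (- (eb + 1)) * cum w dB k epowr eg * dy (k + 1) \<partial>zint)"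
    proof (intro nn_integral_mono mult_left_mono)
      fix k
      have "(\<integral>\<^sup>+x. w x * of_bool (block k (W x)) \<partial>hl) \<le> (\<integral>\<^sup>+x. w x * of_bool (W x \<le> dy (k + 1)) \<partial>hl)"
        by (intro nn_integral_mono mult_left_mono) (auto simp: block_def of_bool_def)
      also have "\<dots> \<le> dy (k + 1)" using accumulates_prim[of w] by (auto simp: accumulates_def)
      finally show "(\<integral>\<^sup>+x. w x * of_bool (block k (W x)) \<partial>hl) \<le> dy (k + 1)" .
    qed simp
    also have "\<dots> = (\<integral>\<^sup>+k. 2 * (dy k epowr (- eb) * cum w dB k epowr eg) \<partial>zint)"
    proof (rule nn_integral_cong)
      fix k
      have d: "dy k epowr (- (eb + 1)) * dy k = dy k epowr (- eb)"
        using epowr_add_fin[of "dy k" "- (eb + 1)" 1] by simp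
      show "dy k epowr (- (eb + 1)) * cum w dB k epowr eg * dy (k + 1) = 2 * (dy k epowr (- eb) * cum w dB k epowr eg)"
        unfolding dy_Suc d[symmetric] by (simp only: ac_simps)
    qed
    also have "\<dots> \<le> 2 * (?c * D)"
      by (subst nn_integral_cmult) (auto intro!: mult_left_mono sum)
    finally show ?thesis .
  qed
  have 2: "(\<integral>\<^sup>+x. w x \<partial>hl) epowr (- eb) * (\<integral>\<^sup>+x. dB x \<partial>hl) epowr eg \<le> ?c * D"
  proof (cases "(\<integral>\<^sup>+x. w x \<partial>hl) = top")
    case True
    then show ?thesis using signs by (simp add: top_epowr_neg)
  next
    case False
    have "0 < (\<integral>\<^sup>+x. w x \<partial>hl)" using wpos[of 1] prim_le[of w 1] by (simp add: less_le_trans)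
    then obtain k where k: "block k (\<integral>\<^sup>+x. w x \<partial>hl)" using block_ex False by (auto simp: less_top)
    then have k': "dy k \<le> (\<integral>\<^sup>+x. w x \<partial>hl)" "(\<integral>\<^sup>+x. w x \<partial>hl) \<le> dy (k + 1)" by (auto simp: block_def)
    then have "W x \<le> dy (k + 1)" for x using prim_le order_trans by blast
    then have eq: "(\<integral>\<^sup>+x. dB x \<partial>hl) = cum w dB k" by (simp add: cum_def)
    have "(\<integral>\<^sup>+x. w x \<partial>hl) epowr (- eb) * (\<integral>\<^sup>+x. dB x \<partial>hl) epowr eg \<le> dy k epowr (- eb) * cum w dB k epowr eg"
      unfolding eq using signs k' by (intro mult_right_mono epowr_antimono) auto
    also have "\<dots> \<le> (\<integral>\<^sup>+k. dy k epowr (- eb) * cum w dB k epowr eg \<partial>zint)"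
      by (rule nn_integral_ge_point) simp
    also note sum
    finally show ?thesis .
  qed
  have "D5 \<le> 2 * (?c * D) + ?c * D" unfolding D5_def by (intro add_mono 1 2)
  also have "\<dots> = (2 + 1) * (?c * D)" by (simp only: distrib_right mult_1)
  finally show ?thesis by (simp add: mult.assoc)
qed

text \<open>On blocks before that of \<open>W t\<close>, the primitive \<open>VV\<close> is at most
  \<open>beta i\<close>. The block of \<open>W t\<close> itself may reach beyond \<open>t\<close>,
  so there \<open>VV t\<close> is kept instead of \<open>beta i\<close>.\<close>

lemma inner6_le: "0 < t \<Longrightarrow> prim (\<lambda>s. W s epowr (- (erho + 1)) * w s * VV s epowr ekap) t
  \<le> 2 * (Sm t + (\<integral>\<^sup>+i. dy i epowr (- erho) * VV t epowr ekap * of_bool (block i (W t)) \<partial>zint))"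
proof -
  assume t: "0 < t"
  note signs = exponent_signs rq
  let ?g = "\<lambda>s. W s epowr (- (erho + 1)) * w s * VV s epowr ekap"
  let ?m = "\<lambda>i. beta i epowr ekap * of_bool (dy (i + 1) < W t) + VV t epowr ekap * of_bool (block i (W t))"
  have "prim ?g t \<le> (\<integral>\<^sup>+x. (\<integral>\<^sup>+i. dy i epowr (- (erho + 1)) * ?m i * (w x * of_bool (block i (W x))) \<partial>zint) \<partial>hl)"
    unfolding prim_def[of ?g]
  proof (rule nn_integral_mono)
    fix x assume "x \<in> space hl"
    then have x: "0 < W x" using wpos by (simp add: space_hl)
    show "?g x * of_bool (x < t) \<le> (\<integral>\<^sup>+i. dy i epowr (- (erho + 1)) * ?m i * (w x * of_bool (block i (W x))) \<partial>zint)"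
    proof (cases "W x = top \<or> \<not> x < t")
      case True
      have "W x epowr (- (erho + 1)) = 0" if "W x = top" unfolding that using signs by (intro top_epowr_neg) simp
      then show ?thesis using True by auto
    next
      case False
      then obtain i where i: "block i (W x)" using block_ex[OF x] by (auto simp: less_top)
      then have i': "dy i < W x" "W x \<le> dy (i + 1)" by (auto simp: block_def)
      have xt: "x < t" "W x \<le> W t" using False by (auto intro: prim_mono)
      have "VV x epowr ekap \<le> ?m i"
      proof (cases "dy (i + 1) < W t")
        case True
        have le: "W s \<le> dy (i + 1)" if "s < x" for s
          using prim_mono[of s x w] that i'(2) by (auto intro: order_trans)
        have "VV x \<le> beta i"
          unfolding prim_def[of om] beta_def cum_def by (intro nn_integral_mono mult_left_mono) (use le in \<open>auto simp: of_bool_def\<close>)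
        then have "VV x epowr ekap \<le> beta i epowr ekap" using signs by (intro epowr_mono) auto
        then show ?thesis using True by (simp add: add_increasing2)
      next
        case False
        then have "block i (W t)" using i' xt by (auto simp: block_def not_less intro: less_le_trans)
        moreover have "VV x epowr ekap \<le> VV t epowr ekap" using signs xt by (intro epowr_mono prim_mono) auto
        ultimately show ?thesis by (simp add: add_increasing)
      qed
      then have "?g x \<le> dy i epowr (- (erho + 1)) * w x * ?m i"
        using signs i' by (intro mult_mono epowr_antimono) auto
      then show ?thesis
        using xt sum_block[OF i, of "\<lambda>i. dy i epowr (- (erho + 1)) * ?m i * w x"] by (simp add: ac_simps)
    qed
  qed
  also have "\<dots> = (\<integral>\<^sup>+i. dy i epowr (- (erho + 1)) * ?m i * (\<integral>\<^sup>+x. w x * of_bool (block i (W x)) \<partial>hl) \<partial>zint)"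
    by (subst nn_integral_count_space_nn_integral) (auto simp: nn_integral_cmult)
  also have "\<dots> \<le> (\<integral>\<^sup>+i. dy i epowr (- (erho + 1)) * ?m i * dy (i + 1) \<partial>zint)"
  proof (intro nn_integral_mono mult_left_mono)
    fix k
    have "(\<integral>\<^sup>+x. w x * of_bool (block k (W x)) \<partial>hl) \<le> (\<integral>\<^sup>+x. w x * of_bool (W x \<le> dy (k + 1)) \<partial>hl)"
      by (intro nn_integral_mono mult_left_mono) (auto simp: block_def of_bool_def)
    also have "\<dots> \<le> dy (k + 1)" using accumulates_prim[of w] by (auto simp: accumulates_def)
    finally show "(\<integral>\<^sup>+x. w x * of_bool (block k (W x)) \<partial>hl) \<le> dy (k + 1)" .
  qed simp
  also have "\<dots> = (\<integral>\<^sup>+i. 2 * (sj i * of_bool (dy (i + 1) < W t) + dy i epowr (- erho) * VV t epowr ekap * of_bool (block i (W t))) \<partial>zint)"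
  proof (rule nn_integral_cong)
    fix i
    have d: "dy i epowr (- (erho + 1)) * dy i = dy i epowr (- erho)"
      using epowr_add_fin[of "dy i" "- (erho + 1)" 1] by simp
    have "dy i epowr (- (erho + 1)) * ?m i * dy (i + 1) = 2 * (dy i epowr (- (erho + 1)) * dy i * ?m i)"
      unfolding dy_Suc by (simp only: ac_simps)
    then show "dy i epowr (- (erho + 1)) * ?m i * dy (i + 1)
      = 2 * (sj i * of_bool (dy (i + 1) < W t) + dy i epowr (- erho) * VV t epowr ekap * of_bool (block i (W t)))"
      unfolding d sj_def by (simp only: distrib_left mult.assoc)
  qed
  also have "\<dots> = 2 * (Sm t + (\<integral>\<^sup>+i. dy i epowr (- erho) * VV t epowr ekap * of_bool (block i (W t)) \<partial>zint))"
    unfolding Sm_def by (subst nn_integral_cmult, simp) (subst nn_integral_add, simp_all)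
  finally show ?thesis .
qed

text \<open>For \<open>W t\<close> in block \<open>k\<close> the integrand regroups as
  \<open>(U^(1/(1-q)) * VV^el)^(eg-1) * dB\<close> with weight \<open>dy k^(-eb)\<close>, and the
  bracket is at most a multiple of \<open>cum w X k\<close>. This part of \<open>C6\<close> is thus
  controlled by the level sum of \<open>C5\<close>.\<close>

lemma local6_le: "(\<integral>\<^sup>+t. U t epowr eb * u t *
    (\<integral>\<^sup>+i. dy i epowr (- erho) * VV t epowr ekap * of_bool (block i (W t)) \<partial>zint) epowr edel \<partial>hl)
  \<le> 2 epowr (el * eg) * D"
proof -
  note signs = exponent_signs rq
  have el0: "0 \<le> el" using signs el_eq by simp
  have e1: "eb = 1 / (1 - q) * (eg - 1) + q / (1 - q)"
  proof -
    have "eg - 1 = q * (1 - p) / (p - q)" using rq by (simp add: eg_def field_simps)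
    then have "1 / (1 - q) * (eg - 1) + q / (1 - q) = q / (1 - q) * ((1 - p) / (p - q) + 1)" by (simp add: distrib_left)
    also have "(1 - p) / (p - q) + 1 = (1 - q) / (p - q)" using rq by (simp add: field_simps)
    finally show ?thesis using rq by (simp add: eb_def)
  qed
  have e2: "ekap * edel = el * (eg - 1) + el"
  proof -
    have "ekap * edel = el * eg" using rq by (simp add: ekap_def edel_def el_def eg_def)
    then show ?thesis by (simp add: algebra_simps)
  qed
  have e3: "- erho * edel = - eb" using rq by (simp add: erho_def edel_def eb_def)
  have "(\<integral>\<^sup>+t. U t epowr eb * u t * (\<integral>\<^sup>+i. dy i epowr (- erho) * VV t epowr ekap * of_bool (block i (W t)) \<partial>zint) epowr edel \<partial>hl)
    \<le> (\<integral>\<^sup>+t. (\<integral>\<^sup>+i. 2 epowr (el * (eg - 1)) * (dy i epowr (- eb) * cum w X i epowr (eg - 1)) * (dB t * of_bool (W t \<le> dy (i + 1))) \<partial>zint) \<partial>hl)"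
  proof (rule nn_integral_mono)
    fix t
    show "U t epowr eb * u t * (\<integral>\<^sup>+i. dy i epowr (- erho) * VV t epowr ekap * of_bool (block i (W t)) \<partial>zint) epowr edel
      \<le> (\<integral>\<^sup>+i. 2 epowr (el * (eg - 1)) * (dy i epowr (- eb) * cum w X i epowr (eg - 1)) * (dB t * of_bool (W t \<le> dy (i + 1))) \<partial>zint)"
    proof (cases "\<exists>k. block k (W t)")
      case False
      then show ?thesis using signs by (simp add: zero_epowr)
    next
      case True
      then obtain k where k: "block k (W t)" by blast
      then have k': "W t \<le> dy (k + 1)" by (simp add: block_def)
      have le: "W s \<le> dy (k + 1)" if "s < t" for s
        using prim_mono[of s t w] that k' by (auto intro: order_trans)
      have UV: "U t epowr (1 / (1 - q)) * VV t epowr el \<le> 2 epowr el * cum w X k"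
      proof -
        have "U t epowr (1 / (1 - q)) * VV t epowr el \<le> U t epowr (1 / (1 - q)) * (2 epowr el * prim (\<lambda>s. VV s epowr em * om s) t)"
          using prim_power_bounds(2)[of om em t] signs unfolding el_eq by (intro mult_left_mono) auto
        also have "\<dots> = 2 epowr el * prim (\<lambda>s. U t epowr (1 / (1 - q)) * (VV s epowr em * om s)) t"
          by (subst prim_cmult, measurable) (rule mult.left_commute)
        also have "\<dots> \<le> 2 epowr el * prim X t"
          unfolding X_def using signs
          by (intro mult_left_mono prim_mono_fun mult_right_mono epowr_mono tail_mono) auto
        also have "prim X t \<le> cum w X k"
          unfolding prim_def[of X] cum_def by (intro nn_integral_mono mult_left_mono) (use le in \<open>auto simp: of_bool_def\<close>)
        finally show ?thesis by (simp add: mult_left_mono)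
      qed
      have sb: "(\<integral>\<^sup>+i. dy i epowr (- erho) * VV t epowr ekap * of_bool (block i (W t)) \<partial>zint) = dy k epowr (- erho) * VV t epowr ekap"
        by (rule sum_block[OF k])
      have Ue: "U t epowr eb = U t epowr (1 / (1 - q) * (eg - 1)) * U t epowr (q / (1 - q))"
        using epowr_add[of "1 / (1 - q) * (eg - 1)" "q / (1 - q)" "U t"] signs unfolding e1[symmetric] by simp
      have Ve: "VV t epowr (ekap * edel) = VV t epowr (el * (eg - 1)) * VV t epowr el"
        using epowr_add[of "el * (eg - 1)" el "VV t"] signs el0 unfolding e2 by simp
      have dl: "0 \<le> edel" using signs by simp
      have "U t epowr eb * u t * (dy k epowr (- erho) * VV t epowr ekap) epowr edel
        = U t epowr eb * u t * (dy k epowr (- eb) * VV t epowr (ekap * edel))"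
        using dl by (subst epowr_mult, simp) (simp only: epowr_epowr e3)
      also have "\<dots> = dy k epowr (- eb) * ((U t epowr (1 / (1 - q)) * VV t epowr el) epowr (eg - 1)) * dB t"
      proof -
        have "(U t epowr (1 / (1 - q)) * VV t epowr el) epowr (eg - 1) = U t epowr (1 / (1 - q) * (eg - 1)) * VV t epowr (el * (eg - 1))"
          using signs by (subst epowr_mult, simp) (simp only: epowr_epowr)
        then show ?thesis unfolding Ue Ve dB_def by (simp only: ac_simps)
      qed
      also have "\<dots> \<le> dy k epowr (- eb) * ((2 epowr el * cum w X k) epowr (eg - 1)) * dB t"
        using signs by (intro mult_left_mono mult_right_mono epowr_mono UV) auto
      also have "\<dots> = 2 epowr (el * (eg - 1)) * (dy k epowr (- eb) * cum w X k epowr (eg - 1)) * (dB t * of_bool (W t \<le> dy (k + 1)))"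
      proof -
        have "(2 epowr el * cum w X k) epowr (eg - 1) = 2 epowr (el * (eg - 1)) * cum w X k epowr (eg - 1)"
          using signs by (subst epowr_mult, simp) (simp only: epowr_epowr)
        then show ?thesis using k' by (simp add: ac_simps)
      qed
      also have "\<dots> \<le> (\<integral>\<^sup>+i. 2 epowr (el * (eg - 1)) * (dy i epowr (- eb) * cum w X i epowr (eg - 1)) * (dB t * of_bool (W t \<le> dy (i + 1))) \<partial>zint)"
        by (rule nn_integral_ge_point) simp
      finally show ?thesis unfolding sb .
    qed
  qed
  also have "\<dots> = (\<integral>\<^sup>+i. 2 epowr (el * (eg - 1)) * (dy i epowr (- eb) * cum w X i epowr (eg - 1)) * cum w dB i \<partial>zint)"
    unfolding cum_def[of w dB] by (subst nn_integral_count_space_nn_integral) (auto simp: nn_integral_cmult)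
  also have "\<dots> \<le> (\<integral>\<^sup>+i. 2 epowr (el * (eg - 1)) * (dy i epowr (- eb) * cum w X i epowr (eg - 1)) * (2 epowr el * cum w X i) \<partial>zint)"
    by (intro nn_integral_mono mult_left_mono cum_dB_le) simp
  also have "\<dots> = (\<integral>\<^sup>+i. 2 epowr (el * eg) * (dy i epowr (- eb) * cum w X i epowr eg) \<partial>zint)"
  proof (rule nn_integral_cong)
    fix i
    have "2 epowr (el * (eg - 1)) * 2 epowr el = 2 epowr (el * eg)"
      using epowr_add_fin[of 2 "el * (eg - 1)" el] by (simp add: algebra_simps)
    moreover have "cum w X i epowr (eg - 1) * cum w X i = cum w X i epowr eg"
      using epowr_add[of "eg - 1" 1 "cum w X i"] signs by simp
    moreover have "2 epowr (el * (eg - 1)) * (dy i epowr (- eb) * cum w X i epowr (eg - 1)) * (2 epowr el * cum w X i)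
      = (2 epowr (el * (eg - 1)) * 2 epowr el) * (dy i epowr (- eb) * (cum w X i epowr (eg - 1) * cum w X i))"
      by (simp only: ac_simps)
    ultimately show "2 epowr (el * (eg - 1)) * (dy i epowr (- eb) * cum w X i epowr (eg - 1)) * (2 epowr el * cum w X i)
      = 2 epowr (el * eg) * (dy i epowr (- eb) * cum w X i epowr eg)" by simp
  qed
  also have "\<dots> = 2 epowr (el * eg) * D" unfolding D_def by (rule nn_integral_cmult) simp
  finally show ?thesis .
qed

lemma D6_le: "D6 \<le> 2 epowr edel * 2 epowr edel * (X6 + 2 epowr (el * eg) * D)"
proof -
  note signs = exponent_signs rq
  have dl: "0 \<le> edel" using signs by simp
  let ?L = "\<lambda>t. \<integral>\<^sup>+i. dy i epowr (- erho) * VV t epowr ekap * of_bool (block i (W t)) \<partial>zint"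
  have "D6 \<le> (\<integral>\<^sup>+t. 2 epowr edel * 2 epowr edel * (U t epowr eb * u t * Sm t epowr edel + U t epowr eb * u t * ?L t epowr edel) \<partial>hl)"
    unfolding D6_def
  proof (rule nn_integral_mono)
    fix t assume "t \<in> space hl"
    then have t: "0 < t" by (simp add: space_hl)
    have "prim (\<lambda>s. W s epowr (- (erho + 1)) * w s * VV s epowr ekap) t epowr edel \<le> (2 * (Sm t + ?L t)) epowr edel"
      using dl by (intro epowr_mono inner6_le t)
    also have "\<dots> = 2 epowr edel * (Sm t + ?L t) epowr edel" using dl by (rule epowr_mult)
    also have "\<dots> \<le> 2 epowr edel * (2 epowr edel * (Sm t epowr edel + ?L t epowr edel))"
      using dl by (intro mult_left_mono epowr_add_le) auto
    finally have "U t epowr eb * u t * prim (\<lambda>s. W s epowr (- (erho + 1)) * w s * VV s epowr ekap) t epowr edel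
      \<le> U t epowr eb * u t * (2 epowr edel * (2 epowr edel * (Sm t epowr edel + ?L t epowr edel)))"
      by (rule mult_left_mono) simp
    then show "U t epowr eb * u t * prim (\<lambda>s. W s epowr (- (erho + 1)) * w s * VV s epowr ekap) t epowr edel
      \<le> 2 epowr edel * 2 epowr edel * (U t epowr eb * u t * Sm t epowr edel + U t epowr eb * u t * ?L t epowr edel)"
      by (simp only: ac_simps distrib_left)
  qed
  also have "\<dots> = 2 epowr edel * 2 epowr edel * (X6 + (\<integral>\<^sup>+t. U t epowr eb * u t * ?L t epowr edel \<partial>hl))"
    unfolding X6_def by (subst nn_integral_cmult, measurable) (subst nn_integral_add, measurable)
  also have "\<dots> \<le> 2 epowr edel * 2 epowr edel * (X6 + 2 epowr (el * eg) * D)"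
    by (intro mult_left_mono add_left_mono local6_le) simp
  finally show ?thesis .
qed

lemma necessity: "D5 epowr (1 - q / p) \<le> c_7 * K" "D6 epowr (1 - q / p) \<le> c_8 * K"
proof -
  have e: "0 < 1 - q / p" "1 - q / p \<le> 1" using rq by auto
  have "D5 epowr (1 - q / p) \<le> (3 * 2 epowr (el * eg) * D) epowr (1 - q / p)"
    using e by (intro epowr_mono D5_le) auto
  also have "\<dots> = (3 * 2 epowr (el * eg)) epowr (1 - q / p) * D epowr (1 - q / p)"
    using e by (intro epowr_mult) auto
  also have "\<dots> \<le> (3 * 2 epowr (el * eg)) epowr (1 - q / p) * (c_5 * K)"
    by (intro mult_left_mono D_bound) simp
  finally show "D5 epowr (1 - q / p) \<le> c_7 * K" unfolding c_7_def by (simp only: mult.assoc)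
  have "D6 epowr (1 - q / p) \<le> (2 epowr edel * 2 epowr edel * (X6 + 2 epowr (el * eg) * D)) epowr (1 - q / p)"
    using e by (intro epowr_mono D6_le) auto
  also have "\<dots> = (2 epowr edel * 2 epowr edel) epowr (1 - q / p) * (X6 + 2 epowr (el * eg) * D) epowr (1 - q / p)"
    using e by (intro epowr_mult) auto
  also have "\<dots> \<le> (2 epowr edel * 2 epowr edel) epowr (1 - q / p) * (X6 epowr (1 - q / p) + (2 epowr (el * eg) * D) epowr (1 - q / p))"
    using e by (intro mult_left_mono epowr_subadd) auto
  also have "(2 epowr (el * eg) * D) epowr (1 - q / p) = (2 epowr (el * eg)) epowr (1 - q / p) * D epowr (1 - q / p)"
    using e by (intro epowr_mult) auto
  also have "(2 epowr edel * 2 epowr edel) epowr (1 - q / p) * (X6 epowr (1 - q / p) + (2 epowr (el * eg)) epowr (1 - q / p) * D epowr (1 - q / p))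
    \<le> (2 epowr edel * 2 epowr edel) epowr (1 - q / p) * (c_6 * K + (2 epowr (el * eg)) epowr (1 - q / p) * (c_5 * K))"
    by (intro mult_left_mono add_mono X6_bound D_bound) auto
  finally show "D6 epowr (1 - q / p) \<le> c_8 * K" unfolding c_8_def by (simp only: mult.assoc distrib_right distrib_left)
qed

end

subsection \<open>The two constants\<close>

lemma set_nn_integral_hl: "(\<integral>\<^sup>+t\<in>{0<..}. g t \<partial>lebesgue) = (\<integral>\<^sup>+t. g t \<partial>hl)"
  by (simp add: nn_integral_restrict_space)

lemma set_nn_integral_prim: "(\<integral>\<^sup>+s\<in>{0<..<t}. g s \<partial>lebesgue) = prim g t"
  unfolding prim_def
  by (simp add: nn_integral_restrict_space) (auto intro!: nn_integral_cong simp: indicator_def)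

lemma set_nn_integral_tail: "0 \<le> t \<Longrightarrow> (\<integral>\<^sup>+s\<in>{t<..}. g s \<partial>lebesgue) = tail g t"
  unfolding tail_def
  by (simp add: nn_integral_restrict_space) (auto intro!: nn_integral_cong simp: indicator_def)

lemma prim_cong: "(\<And>s. 0 < s \<Longrightarrow> s < t \<Longrightarrow> f s = g s) \<Longrightarrow> prim f t = prim g t"
  by (intro antisym prim_mono_fun) auto

lemma increases_to_prim:
  assumes [measurable]: "\<And>n. f n \<in> borel_measurable hl" and "\<And>s. 0 < s \<Longrightarrow> increases_to (\<lambda>n. f n s) (F s)"
  shows "increases_to (\<lambda>n. prim (f n) t) (prim F t)"
  unfolding prim_def using assms(2)
  by (intro increases_to_nn_integral increases_to_mult increases_to_const) (auto simp: space_hl)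

lemma V_eq: "r < 1 \<Longrightarrow> V v r 0 (ereal t) = prim (\<lambda>s. v s epowr (1 / (1 - r))) t epowr ((1 - r) / r)"
proof -
  assume "r < 1"
  moreover have "einterval 0 (ereal t) = {0<..<t}" by (auto simp: einterval_def zero_ereal_def)
  ultimately show ?thesis by (simp add: V_def set_nn_integral_prim)
qed

lemma weight_prim_pos:
  assumes w: "weight w" and t: "0 < t" shows "0 < prim w t"
proof (rule ccontr)
  have [measurable]: "w \<in> borel_measurable hl" using w by (simp add: weight_def)
  assume "\<not> 0 < prim w t"
  then have "(\<integral>\<^sup>+s. w s * of_bool (s < t) \<partial>hl) = 0" by (simp add: prim_def)
  then have "AE s in hl. w s * of_bool (s < t) = 0" by (subst (asm) nn_integral_0_iff_AE) auto
  moreover have "AE s in hl. 0 < w s \<and> w s < \<infinity>" using w by (simp add: weight_def)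
  ultimately have "AE s in hl. \<not> s < t" by eventually_elim auto
  then have "AE s in lebesgue. s \<in> {0<..} \<longrightarrow> \<not> s < t" by (simp add: AE_restrict_space_iff)
  then have "AE s in lebesgue. s \<notin> {0<..<t}" by eventually_elim auto
  then have "emeasure lebesgue {0<..<t} = 0" by (subst (asm) AE_iff_measurable[of "{0<..<t}"]) auto
  then show False using t by simp
qed

lemma weight_regular:
  assumes "weight w" "no_jump_to_infinity w" "0 < s" "prim w s < top"
  shows "regular w"
  using assms weight_prim_pos[OF assms(1)]
  unfolding regular_def no_jump_to_infinity_def set_nn_integral_prim weight_def by auto

text \<open>On \<open>(0,t)\<close> the tail is at least \<open>tail f t\<close>, so the integral is
  at least \<open>tail f t^p * W t\<close>. If \<open>W t\<close> is infinite, the tail must vanish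
  at \<open>t\<close>, and \<open>f\<close> is 0 at almost every point where its tail is.\<close>

lemma finite_copson_AE_0:
  assumes [measurable]: "f \<in> borel_measurable hl" "w \<in> borel_measurable hl" and p: "0 < p"
    and R: "(\<integral>\<^sup>+t. tail f t epowr p * w t \<partial>hl) < top"
  shows "AE s in hl. prim w s = top \<longrightarrow> f s = 0"
proof -
  have "tail f t = 0" if "prim w t = top" for t
  proof -
    have "tail f t epowr p * prim w t = (\<integral>\<^sup>+s. tail f t epowr p * (w s * of_bool (s < t)) \<partial>hl)"
      by (simp add: prim_def nn_integral_cmult)
    also have "\<dots> \<le> (\<integral>\<^sup>+s. tail f s epowr p * w s \<partial>hl)"
      using p by (intro nn_integral_mono) (auto simp: of_bool_def intro!: mult_right_mono epowr_mono tail_mono)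
    finally have "tail f t epowr p * prim w t < top" using R by (rule le_less_trans)
    then have "tail f t epowr p = 0" using that by (simp add: ennreal_mult_top split: if_splits)
    then show ?thesis using p by (simp add: epowr_eq_0_iff)
  qed
  moreover have "AE s in hl. f s \<noteq> 0 \<longrightarrow> tail f s > 0"
    by (rule accumulates_AE_pos[OF accumulates_tail]) measurable
  ultimately show ?thesis by (auto elim!: eventually_mono)
qed

section \<open>Comparison of the admissible constants with \<open>C5\<close> and
  \<open>C6\<close>\<close>

context exponents
begin

definition "om_of v = (\<lambda>s. v s epowr (1 / (1 - r)))"
definition "dens u om = (\<lambda>t. tail u t epowr (q / (1 - q)) * u t * prim om t epowr el)"
text \<open>\<open>A5\<close>, \<open>B5\<close> and \<open>A6\<close> are the two terms of
  \<open>C5\<close> and the constant \<open>C6\<close> stripped of the common outer power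
  \<open>eE\<close>, see \<open>C5_eq\<close> and \<open>C6_eq\<close>.\<close>

definition "A5 u om w = (\<integral>\<^sup>+x. prim w x epowr (- (eb + 1)) * w x * prim (dens u om) x epowr eg \<partial>hl)"
definition "B5 u om w = (\<integral>\<^sup>+x. w x \<partial>hl) epowr (- eb) * (\<integral>\<^sup>+x. dens u om x \<partial>hl) epowr eg"
definition "A6 u om w = (\<integral>\<^sup>+t. tail u t epowr eb * u t *
  prim (\<lambda>s. prim w s epowr (- (erho + 1)) * w s * prim om s epowr ekap) t epowr edel \<partial>hl)"
definition "eE = (p - q) / (p * q)"

lemma eE: "0 < eE" "(1 - q / p) * (1 / q) = eE" "- eb * eE = - (1 / p)" "eg * eE = (1 - q) / q"
  using rq by (auto simp: eE_def eb_def eg_def field_simps)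

lemma ep: "p / (p - q) = eb + 1" "p / (p - r) = erho + 1"
  using rq by (auto simp: eb_def erho_def field_simps)

lemma V_powers: "V v r 0 (ereal t) epowr (q / (1 - q)) = prim (om_of v) t epowr el"
  "V v r 0 (ereal t) epowr (p * r / (p - r)) = prim (om_of v) t epowr ekap"
proof -
  have "(1 - r) / r * (q / (1 - q)) = el" "(1 - r) / r * (p * r / (p - r)) = ekap"
    using rq by (auto simp: el_def ekap_def field_simps)
  moreover have "V v r 0 (ereal t) = prim (om_of v) t epowr ((1 - r) / r)"
    unfolding om_of_def using rq by (intro V_eq) auto
  ultimately show "V v r 0 (ereal t) epowr (q / (1 - q)) = prim (om_of v) t epowr el"
    "V v r 0 (ereal t) epowr (p * r / (p - r)) = prim (om_of v) t epowr ekap"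
    by (simp_all only: epowr_epowr)
qed

lemma C5_eq: "C5 p q r u v w = A5 u (om_of v) w epowr eE + B5 u (om_of v) w epowr eE"
proof -
  have 1: "prim (\<lambda>t. (\<integral>\<^sup>+s\<in>{t<..}. u s \<partial>lebesgue) epowr (q / (1 - q)) * u t * prim (om_of v) t epowr el) x
      = prim (dens u (om_of v)) x" for x
    unfolding dens_def by (intro prim_cong) (simp add: set_nn_integral_tail)
  have 2: "(\<integral>\<^sup>+t. (\<integral>\<^sup>+s\<in>{t<..}. u s \<partial>lebesgue) epowr (q / (1 - q)) * u t * prim (om_of v) t epowr el \<partial>hl)
      = (\<integral>\<^sup>+t. dens u (om_of v) t \<partial>hl)"
    unfolding dens_def by (intro nn_integral_cong) (simp add: set_nn_integral_tail space_hl)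
  have 3: "B5 u (om_of v) w epowr eE = (\<integral>\<^sup>+x. w x \<partial>hl) epowr (- (1 / p)) * (\<integral>\<^sup>+t. dens u (om_of v) t \<partial>hl) epowr ((1 - q) / q)"
    unfolding B5_def using eE(1) by (subst epowr_mult, simp) (simp only: epowr_epowr eE)
  show ?thesis
    unfolding C5_def set_nn_integral_prim set_nn_integral_hl V_powers 1 2 3 ep A5_def eE_def[symmetric] eg_def[symmetric]
    by (rule refl)
qed

lemma C6_eq: "C6 p q r u v w = A6 u (om_of v) w epowr eE"
proof -
  have "(\<integral>\<^sup>+t. (\<integral>\<^sup>+s\<in>{t<..}. u s \<partial>lebesgue) epowr eb * u t * h t \<partial>hl) = (\<integral>\<^sup>+t. tail u t epowr eb * u t * h t \<partial>hl)" for h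
    by (intro nn_integral_cong) (simp add: set_nn_integral_tail space_hl)
  then show ?thesis
    unfolding C6_def set_nn_integral_prim set_nn_integral_hl V_powers ep A6_def eE_def[symmetric] eb_def[symmetric] edel_def[symmetric]
    by simp
qed

lemma ineq_holds_iff: "ineq_holds p q r u v w C \<longleftrightarrow> (\<forall>f\<in>borel_measurable hl.
    (\<integral>\<^sup>+t. prim (\<lambda>s. f s epowr r * om_of v s epowr (1 - r)) t epowr (q / r) * u t \<partial>hl) epowr (1 / q)
    \<le> C * (\<integral>\<^sup>+t. tail f t epowr p * w t \<partial>hl) epowr (1 / p))"
proof -
  have "om_of v s epowr (1 - r) = v s" for s using rq by (simp add: om_of_def epowr_epowr)
  moreover have "(\<integral>\<^sup>+t. (\<integral>\<^sup>+s\<in>{t<..}. f s \<partial>lebesgue) epowr p * w t \<partial>hl) = (\<integral>\<^sup>+t. tail f t epowr p * w t \<partial>hl)" for f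
    by (intro nn_integral_cong) (simp add: set_nn_integral_tail space_hl)
  ultimately show ?thesis
    unfolding ineq_holds_def set_nn_integral_prim set_nn_integral_hl Mplus_def by simp
qed

text \<open>For \<open>C = 0\<close> and an infinite integral on the right,
  \<open>0 * \<infinity> = 0\<close> would make the right-hand side 0; with \<open>C > 0\<close>
  this case is trivial. If the integral is finite, \<open>f\<close> vanishes where \<open>W\<close>
  is infinite, as \<open>sufficiency\<close> asks.\<close>

lemma upper_estimate:
  obtains c :: real where "0 < c" and
    "\<And>u v w C. weight u \<Longrightarrow> weight v \<Longrightarrow> weight w \<Longrightarrow> no_jump_to_infinity w \<Longrightarrow>
      ennreal c * (C5 p q r u v w + C6 p q r u v w) \<le> C \<Longrightarrow> 0 < C \<Longrightarrow> ineq_holds p q r u v w C"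
proof -
  obtain c :: real where c: "0 < c" and suff: "\<And>f om u w. regular w \<Longrightarrow> f \<in> borel_measurable hl \<Longrightarrow> om \<in> borel_measurable hl \<Longrightarrow>
      u \<in> borel_measurable hl \<Longrightarrow> AE s in hl. prim w s = top \<longrightarrow> f s = 0 \<Longrightarrow>
      (\<integral>\<^sup>+t. prim (\<lambda>s. f s epowr r * om s epowr (1 - r)) t epowr (q / r) * u t \<partial>hl)
      \<le> ennreal c * (\<integral>\<^sup>+t. tail f t epowr p * w t \<partial>hl) epowr (q / p) *
        ((A5 u om w + B5 u om w) epowr (1 - q / p) + A6 u om w epowr (1 - q / p))"
    using that
    unfolding A5_def B5_def A6_def dens_def ep(2)[symmetric] eb_def eg_def el_def ekap_def edel_def
    by (rule sufficiency[OF rq])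
  define d where "d = c powr (1 / q) * (2 powr (1 / q) * 2 powr eE)"
  show ?thesis
  proof (rule that[of d])
    show "0 < d" using c by (simp add: d_def)
    fix u v w C
    assume weights: "weight u" "weight v" "weight w" and nj: "no_jump_to_infinity w"
      and C: "ennreal d * (C5 p q r u v w + C6 p q r u v w) \<le> C" "0 < C"
    have [measurable]: "u \<in> borel_measurable hl" "v \<in> borel_measurable hl" "w \<in> borel_measurable hl"
      using weights by (auto simp: weight_def)
    have [measurable]: "om_of v \<in> borel_measurable hl" unfolding om_of_def by measurable
    show "ineq_holds p q r u v w C"
      unfolding ineq_holds_iff
    proof
      fix f :: "real \<Rightarrow> ennreal" assume [measurable]: "f \<in> borel_measurable hl"
      let ?L = "\<integral>\<^sup>+t. prim (\<lambda>s. f s epowr r * om_of v s epowr (1 - r)) t epowr (q / r) * u t \<partial>hl"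
      define R where "R = (\<integral>\<^sup>+t. tail f t epowr p * w t \<partial>hl)"
      have "?L epowr (1 / q) \<le> C * R epowr (1 / p)"
      proof (cases "R = top")
        case True
        then have "C * R epowr (1 / p) = top" using C rq by (auto simp: top_epowr ennreal_mult_top)
        then show ?thesis by simp
      next
        case False
        then have f0: "AE s in hl. prim w s = top \<longrightarrow> f s = 0"
          unfolding R_def using rq by (intro finite_copson_AE_0[of f w p]) (auto simp: less_top)
        show ?thesis
        proof (cases "\<exists>s>0. prim w s < top")
          case False
          \<comment> \<open>Here \<open>W\<close> is infinite everywhere, so \<open>regular\<close>
            fails, but then \<open>f\<close> is null and the left-hand side is 0.\<close>
          have "AE s in hl. f s = 0"
            using f0 AE_space
          proof eventually_elim
            case (elim s)
            then show ?case using False by (auto simp: space_hl less_top)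
          qed
          then have "prim (\<lambda>s. f s epowr r * om_of v s epowr (1 - r)) t = (\<integral>\<^sup>+s. 0 \<partial>hl)" for t
            unfolding prim_def by (intro nn_integral_cong_AE) (auto elim!: eventually_mono simp: zero_epowr rq)
          then have "?L = 0" using rq by (simp add: zero_epowr)
          then show ?thesis using rq by (simp add: zero_epowr)
        next
          case True
          then have reg: "regular w" using weight_regular[OF weights(3) nj] by blast
          let ?A = "A5 u (om_of v) w" and ?B = "B5 u (om_of v) w" and ?D = "A6 u (om_of v) w"
          have q: "0 < q" using rq by simp
          have "?L epowr (1 / q) \<le> (ennreal c * R epowr (q / p) * ((?A + ?B) epowr (1 - q / p) + ?D epowr (1 - q / p))) epowr (1 / q)"
            unfolding R_def using q by (intro epowr_mono suff reg f0) auto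
          also have "\<dots> = ennreal (c powr (1 / q)) * R epowr (1 / p) * ((?A + ?B) epowr (1 - q / p) + ?D epowr (1 - q / p)) epowr (1 / q)"
            using q c rq by (simp add: epowr_mult epowr_epowr ennreal_epowr)
          also have "\<dots> \<le> ennreal (c powr (1 / q)) * R epowr (1 / p) *
              (2 epowr (1 / q) * (((?A + ?B) epowr (1 - q / p)) epowr (1 / q) + (?D epowr (1 - q / p)) epowr (1 / q)))"
            using q by (intro mult_left_mono epowr_add_le) auto
          also have "\<dots> = ennreal (c powr (1 / q)) * R epowr (1 / p) * (2 epowr (1 / q) * ((?A + ?B) epowr eE + ?D epowr eE))"
            by (simp only: epowr_epowr eE)
          also have "\<dots> \<le> ennreal (c powr (1 / q)) * R epowr (1 / p) *
              (2 epowr (1 / q) * (2 epowr eE * (?A epowr eE + ?B epowr eE) + 2 epowr eE * ?D epowr eE))"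
          proof (intro mult_left_mono add_mono)
            show "(?A + ?B) epowr eE \<le> 2 epowr eE * (?A epowr eE + ?B epowr eE)" using eE by (intro epowr_add_le) auto
            have "1 \<le> 2 epowr eE" using eE ge_one_powr_ge_zero[of 2 eE] by (simp add: two_epowr)
            then have "1 * ?D epowr eE \<le> 2 epowr eE * ?D epowr eE" by (rule mult_right_mono) simp
            then show "?D epowr eE \<le> 2 epowr eE * ?D epowr eE" by simp
          qed auto
          also have "\<dots> = ennreal d * (C5 p q r u v w + C6 p q r u v w) * R epowr (1 / p)"
            unfolding C5_eq C6_eq d_def two_epowr by (simp add: ennreal_mult distrib_left ac_simps)
          also have "\<dots> \<le> C * R epowr (1 / p)" by (intro mult_right_mono C) simp
          finally show ?thesis .
        qed
      qed
      then show "?L epowr (1 / q) \<le> C * (\<integral>\<^sup>+t. tail f t epowr p * w t \<partial>hl) epowr (1 / p)" by (simp add: R_def)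
    qed
  qed
qed

text \<open>Truncating \<open>u\<close> and \<open>om\<close> only decreases the left-hand side and
  leaves the right-hand side alone, so \<open>C\<close> stays admissible for every \<open>n\<close>.
  The bounds for the truncated weights are uniform in \<open>n\<close> and survive the monotone
  limit.\<close>

lemma lower_estimate:
  obtains c :: real where "0 < c" and
    "\<And>u v w C. weight u \<Longrightarrow> weight v \<Longrightarrow> weight w \<Longrightarrow> ineq_holds p q r u v w C \<Longrightarrow>
      C5 p q r u v w + C6 p q r u v w \<le> ennreal c * C"
proof -
  \<comment> \<open>\<open>c_7\<close> occurs twice since each of the two terms of \<open>C5\<close>
    is bounded by \<open>(A5 + B5)^eE\<close>.\<close>
  define c' where "c' = c_7 epowr (1 / q) + c_7 epowr (1 / q) + c_8 epowr (1 / q)"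
  have "c' < top" using c78_fin rq by (auto simp: c'_def ennreal_add_less_top intro!: epowr_less_top)
  then obtain c0 where c0: "c' = ennreal c0" "0 \<le> c0" by (metis ennreal_cases less_irrefl)
  show ?thesis
  proof (rule that[of "c0 + 1"])
    show "0 < c0 + 1" using c0 by simp
    fix u v w C
    assume weights: "weight u" "weight v" "weight w" and ineq: "ineq_holds p q r u v w C"
    have [measurable]: "u \<in> borel_measurable hl" "v \<in> borel_measurable hl" "w \<in> borel_measurable hl"
      using weights by (auto simp: weight_def)
    define om where "om = om_of v"
    have [measurable]: "om \<in> borel_measurable hl" unfolding om_def om_of_def by measurable
    have q: "0 < q" using rq by simp
    have el0: "0 \<le> el" using exponent_signs el_eq by simp
    \<comment> \<open>For \<open>n = 0\<close> the truncations vanish identically, but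
      \<open>1 / real 0 = 0\<close> is no admissible \<open>a\<close>; hence the default 1.\<close>
    have trunc: "truncated_weights p q r (trunc n u) (trunc n om) w (if n = 0 then 1 else 1 / real n) (C epowr q)" for n
    proof
      show "(\<integral>\<^sup>+s. trunc n u s \<partial>hl) < top" "(\<integral>\<^sup>+s. trunc n om s \<partial>hl) < top" by (rule nn_integral_trunc_finite)+
      show "trunc n om s = 0" if "s \<le> (if n = 0 then 1 else 1 / real n)" for s
        using that by (auto simp: trunc_def split: if_splits)
      show "0 < prim w t" if "0 < t" for t using weight_prim_pos[OF weights(3) that] .
      fix f :: "real \<Rightarrow> ennreal" assume f [measurable]: "f \<in> borel_measurable hl"
      have "(\<integral>\<^sup>+t. prim (\<lambda>s. f s epowr r * trunc n om s epowr (1 - r)) t epowr (q / r) * trunc n u t \<partial>hl)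
        \<le> (\<integral>\<^sup>+t. prim (\<lambda>s. f s epowr r * om s epowr (1 - r)) t epowr (q / r) * u t \<partial>hl)" (is "?Ln \<le> ?L")
        using rq by (intro nn_integral_mono mult_mono epowr_mono prim_mono_fun mult_left_mono trunc_le) auto
      also have "\<dots> = (?L epowr (1 / q)) epowr q" using q by (simp add: epowr_epowr)
      also have "\<dots> \<le> (C * (\<integral>\<^sup>+t. tail f t epowr p * w t \<partial>hl) epowr (1 / p)) epowr q"
        using ineq f q unfolding ineq_holds_iff om_def by (intro epowr_mono) auto
      also have "\<dots> = C epowr q * (\<integral>\<^sup>+t. tail f t epowr p * w t \<partial>hl) epowr (q / p)"
        using q by (simp add: epowr_mult epowr_epowr)
      finally show "?Ln \<le> C epowr q * (\<integral>\<^sup>+t. tail f t epowr p * w t \<partial>hl) epowr (q / p)" .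
    qed (use rq in auto)
    have inc_dens: "increases_to (\<lambda>n. dens (trunc n u) (trunc n om) t) (dens u om t)" if "0 < t" for t
      unfolding dens_def prim_def tail_def using rq that el0
      by (intro increases_to_mult increases_to_epowr increases_to_nn_integral increases_to_trunc increases_to_const)
        (auto simp: space_hl)
    have m_dens [measurable]: "dens (trunc n u) (trunc n om) \<in> borel_measurable hl" for n
      unfolding dens_def by measurable
    note signs = exponent_signs
    have "increases_to (\<lambda>n. (A5 (trunc n u) (trunc n om) w + B5 (trunc n u) (trunc n om) w) epowr (1 - q / p))
      ((A5 u om w + B5 u om w) epowr (1 - q / p))"
      unfolding A5_def B5_def prim_def[of "dens _ _"] using rq signs
      by (intro increases_to_add increases_to_mult increases_to_epowr increases_to_nn_integral increases_to_const inc_dens)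
        (auto simp: space_hl)
    then have 5: "(A5 u om w + B5 u om w) epowr (1 - q / p) \<le> c_7 * C epowr q"
    proof (rule increases_to_le)
      fix n
      interpret tw: truncated_weights p q r "trunc n u" "trunc n om" w "if n = 0 then 1 else 1 / real n" "C epowr q"
        by (rule trunc)
      show "(A5 (trunc n u) (trunc n om) w + B5 (trunc n u) (trunc n om) w) epowr (1 - q / p) \<le> c_7 * C epowr q"
        using tw.necessity(1) unfolding tw.D5_def A5_def B5_def tw.dB_def[abs_def] dens_def .
    qed
    have "increases_to (\<lambda>n. A6 (trunc n u) (trunc n om) w epowr (1 - q / p)) (A6 u om w epowr (1 - q / p))"
      unfolding A6_def tail_def using rq signs
      by (intro increases_to_mult increases_to_epowr increases_to_prim increases_to_nn_integral increases_to_const increases_to_trunc)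
        (auto simp: space_hl)
    then have 6: "A6 u om w epowr (1 - q / p) \<le> c_8 * C epowr q"
    proof (rule increases_to_le)
      fix n
      interpret tw: truncated_weights p q r "trunc n u" "trunc n om" w "if n = 0 then 1 else 1 / real n" "C epowr q"
        by (rule trunc)
      show "A6 (trunc n u) (trunc n om) w epowr (1 - q / p) \<le> c_8 * C epowr q"
        using tw.necessity(2) unfolding tw.D6_def A6_def .
    qed
    have root: "x epowr eE \<le> k epowr (1 / q) * C" if "x epowr (1 - q / p) \<le> k * C epowr q" for x k
    proof -
      have "x epowr eE = (x epowr (1 - q / p)) epowr (1 / q)" by (simp only: epowr_epowr eE)
      also have "\<dots> \<le> (k * C epowr q) epowr (1 / q)" using q by (intro epowr_mono that) auto
      also have "\<dots> = k epowr (1 / q) * C" using q by (simp add: epowr_mult epowr_epowr)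
      finally show ?thesis .
    qed
    have "C5 p q r u v w + C6 p q r u v w
      \<le> (A5 u om w + B5 u om w) epowr eE + (A5 u om w + B5 u om w) epowr eE + A6 u om w epowr eE"
      unfolding C5_eq C6_eq om_def[symmetric] using eE by (intro add_mono epowr_mono) auto
    also have "\<dots> \<le> c_7 epowr (1 / q) * C + c_7 epowr (1 / q) * C + c_8 epowr (1 / q) * C"
      by (intro add_mono root 5 6)
    also have "\<dots> = c' * C" unfolding c'_def by (simp only: distrib_right)
    also have "\<dots> \<le> ennreal (c0 + 1) * C" unfolding c0 using c0 by (intro mult_right_mono ennreal_leI) auto
    finally show "C5 p q r u v w + C6 p q r u v w \<le> ennreal (c0 + 1) * C" .
  qed
qed

end

theorem theorem2p2:
  fixes p q r :: real
  assumes "0 < r" and "r \<le> q" and "q < p" and "p < 1"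
  shows "(\<forall>u v w. weight u \<and> weight v \<and> weight w \<and> no_jump_to_infinity w \<longrightarrow>
            ((\<exists>C<\<infinity>. ineq_holds p q r u v w C) \<longleftrightarrow> max (C5 p q r u v w) (C6 p q r u v w) < \<infinity>))
       \<and> (\<exists>c::real. 0 < c \<and> (\<forall>u v w. weight u \<and> weight v \<and> weight w \<and> no_jump_to_infinity w \<longrightarrow>
            best_constant p q r u v w \<le> ennreal c * (C5 p q r u v w + C6 p q r u v w) \<and>
            C5 p q r u v w + C6 p q r u v w \<le> ennreal c * best_constant p q r u v w))"
proof -
  interpret exponents p q r by standard (use assms in auto)
  obtain c1 where c1: "0 < c1" and up: "\<And>u v w C. weight u \<Longrightarrow> weight v \<Longrightarrow> weight w \<Longrightarrow> no_jump_to_infinity w \<Longrightarrow>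
      ennreal c1 * (C5 p q r u v w + C6 p q r u v w) \<le> C \<Longrightarrow> 0 < C \<Longrightarrow> ineq_holds p q r u v w C"
    using upper_estimate by blast
  obtain c2 where c2: "0 < c2" and low: "\<And>u v w C. weight u \<Longrightarrow> weight v \<Longrightarrow> weight w \<Longrightarrow> ineq_holds p q r u v w C \<Longrightarrow>
      C5 p q r u v w + C6 p q r u v w \<le> ennreal c2 * C"
    using lower_estimate by blast
  \<comment> \<open>\<open>up\<close> needs a positive constant, while \<open>C5 + C6\<close> may be
    0, for instance if \<open>W\<close> is infinite everywhere. The summand \<open>e\<close> repairs
    this and disappears in the infimum.\<close>
  have up': "ineq_holds p q r u v w (ennreal c1 * (C5 p q r u v w + C6 p q r u v w) + ennreal e)"
    if "weight u" "weight v" "weight w" "no_jump_to_infinity w" "0 < e" for u v w e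
    using that by (intro up) (auto simp: add_increasing2 add_pos_nonneg add_nonneg_pos intro: order_less_le_trans)
  show ?thesis
  proof (intro conjI allI impI exI[of _ "max c1 c2"])
    fix u v w assume "weight u \<and> weight v \<and> weight w \<and> no_jump_to_infinity w"
    then have w: "weight u" "weight v" "weight w" "no_jump_to_infinity w" by auto
    show "(\<exists>C<\<infinity>. ineq_holds p q r u v w C) \<longleftrightarrow> max (C5 p q r u v w) (C6 p q r u v w) < \<infinity>"
    proof
      assume "\<exists>C<\<infinity>. ineq_holds p q r u v w C"
      then obtain C where C: "C < top" "ineq_holds p q r u v w C" by auto
      have "C5 p q r u v w + C6 p q r u v w \<le> ennreal c2 * C" by (rule low[OF w(1-3) C(2)])
      also have "\<dots> < top" using C by (simp add: ennreal_mult_less_top)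
      finally show "max (C5 p q r u v w) (C6 p q r u v w) < \<infinity>" by (simp add: ennreal_add_less_top)
    next
      assume "max (C5 p q r u v w) (C6 p q r u v w) < \<infinity>"
      then have "ennreal c1 * (C5 p q r u v w + C6 p q r u v w) + ennreal 1 < \<infinity>"
        by (simp add: ennreal_add_less_top ennreal_mult_less_top)
      then show "\<exists>C<\<infinity>. ineq_holds p q r u v w C" using up'[OF w zero_less_one] by blast
    qed
  next
    show "0 < max c1 c2" using c1 by simp
  next
    fix u v w assume "weight u \<and> weight v \<and> weight w \<and> no_jump_to_infinity w"
    then have w: "weight u" "weight v" "weight w" "no_jump_to_infinity w" by auto
    let ?S = "C5 p q r u v w + C6 p q r u v w"
    have "best_constant p q r u v w \<le> ennreal c1 * ?S"
    proof (rule ennreal_le_epsilon)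
      fix e :: real assume e: "0 < e" "ennreal c1 * ?S < top"
      have "ennreal c1 * ?S + ennreal e < \<infinity>" using e by (simp add: ennreal_add_less_top)
      then show "best_constant p q r u v w \<le> ennreal c1 * ?S + ennreal e"
        unfolding best_constant_def using up'[OF w e(1)] by (intro Inf_lower) simp
    qed
    also have "\<dots> \<le> ennreal (max c1 c2) * ?S" by (intro mult_right_mono ennreal_leI) auto
    finally show "best_constant p q r u v w \<le> ennreal (max c1 c2) * ?S" .
    \<comment> \<open>Dividing by \<open>c2\<close> turns the estimate into a lower bound for every
      admissible \<open>C\<close>, hence for the infimum, which is \<open>top\<close> if there is
      none.\<close>
    have c: "ennreal c2 * ennreal (1 / c2) = 1" using c2 by (simp add: ennreal_mult[symmetric])
    have "ennreal (1 / c2) * ?S \<le> best_constant p q r u v w"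
      unfolding best_constant_def
    proof (rule Inf_greatest)
      fix C assume "C \<in> {C. C < \<infinity> \<and> ineq_holds p q r u v w C}"
      then have "?S \<le> ennreal c2 * C" using low[OF w(1-3)] by blast
      then have "ennreal (1 / c2) * ?S \<le> ennreal (1 / c2) * (ennreal c2 * C)" by (rule mult_left_mono) simp
      also have "\<dots> = (ennreal c2 * ennreal (1 / c2)) * C" by (simp only: ac_simps)
      also have "\<dots> = C" unfolding c by simp
      finally show "ennreal (1 / c2) * ?S \<le> C" .
    qed
    then have "ennreal c2 * (ennreal (1 / c2) * ?S) \<le> ennreal c2 * best_constant p q r u v w" by (rule mult_left_mono) simp
    then have "?S \<le> ennreal c2 * best_constant p q r u v w" using c by (simp add: mult.assoc[symmetric])
    also have "\<dots> \<le> ennreal (max c1 c2) * best_constant p q r u v w" by (intro mult_right_mono ennreal_leI) auto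
    finally show "?S \<le> ennreal (max c1 c2) * best_constant p q r u v w" .
  qed
qed

end
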